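(* Let $d\in\mathbb{N}$ and let $\mu_1,\dots,\mu_d,\nu_1,\dots,\nu_d$ be probability measures on $\mathbb{R}$ with finite first moments such that $\mu_i\le_c\nu_i$ for every $i\in[d]$. Assume that every $\mu_i$ is absolutely continuous with respect to Lebesgue measure on $\mathbb{R}$. Let $|\cdot|$ be the Euclidean norm on $\mathbb{R}^d$ and suppose $\pi\in\mathrm{VMT}(\vec\mu,\vec\nu)$ solves the problem $$\text{maximize } \ \mathbb{E}_\gamma\big[|X-Y|\big]\ \text{ over }\ \gamma\in \mathrm{VMT}(\vec\mu,\vec\nu).$$ Then, given $X$, the conditional distribution of $Y$ lies in the set of extreme points of a convex set $C_X\subseteq\mathbb{R}^d$ depending on $X$, $\pi$-almost surely. That is, writing $\pi=\pi_x\otimes\pi^1$ with $\pi^1$ the law of $X$ under $\pi$, for $\pi^1$-a.e. $x$ there is a convex set $C_x\subseteq\mathbb{R}^d$ such that $\pi_x$ has its full mass in the set of extreme points of $C_x$.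
   Context: $[d]=\{1,\dots,d\}$, $\vec\mu=(\mu_1,\dots,\mu_d)$, $\vec\nu=(\nu_1,\dots,\nu_d)$. For probability measures $\mu,\nu$ on $\mathbb{R}$ with finite first moments, $\mu\le_c\nu$ (convex order) means $\int f\,d\mu\le\int f\,d\nu$ for every convex $f:\mathbb{R}\to\mathbb{R}$. $\mathrm{VMT}(\vec\mu,\vec\nu)$ (vectorial martingale transports) is the set of Borel probability measures $\pi$ on $\mathbb{R}^{d}\times\mathbb{R}^d$ such that $\pi=\mathrm{Law}(X,Y)$ for $\mathbb{R}^d$-valued random variables $X=(X_1,\dots,X_d)$, $Y=(Y_1,\dots,Y_d)$ with $\mathbb{E}[Y|X]=X$, $X_i\sim\mu_i$ and $Y_i\sim\nu_i$ for all $i\in[d]$. (Only the one-dimensional marginals are prescribed.) $\mathbb{E}_\pi$ denotes expectation when $(X,Y)\sim\pi$. $\pi=\pi_x\otimes\pi^1$ denotes disintegration with respect to the first marginal $\pi^1$ on $\mathbb{R}^d$: $\pi(A\times B)=\int_A\pi_x(B)\,d\pi^1(x)$ for Borel $A,B\subseteq\mathbb{R}^d$. *)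

theory Defs
  imports "HOL-Probability.Probability"
begin

text \<open>The Bochner integral is \<open>0\<close> for non-integrable functions, but the integral of a convex
  function may be \<open>+\<infinity>\<close>. The difference below is never \<open>\<infinity> - \<infinity>\<close> for convex \<open>f\<close> and a probability
  measure with finite first moment, since then \<open>f\<close> dominates an integrable affine function.\<close>

definition ext_integral :: "'a measure \<Rightarrow> ('a \<Rightarrow> real) \<Rightarrow> ereal" where
  "ext_integral M f =
     enn2ereal (\<integral>\<^sup>+x. ennreal (f x) \<partial>M) - enn2ereal (\<integral>\<^sup>+x. ennreal (- f x) \<partial>M)"

definition convex_order :: "real measure \<Rightarrow> real measure \<Rightarrow> bool" where
  "convex_order \<mu> \<nu> \<longleftrightarrow>
     (\<forall>f. convex_on UNIV f \<longrightarrow> ext_integral \<mu> f \<le> ext_integral \<nu> f)"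

text \<open>Conditional expectation of an integrable random vector, taken componentwise.\<close>

definition vec_cond_exp ::
    "'a measure \<Rightarrow> 'a measure \<Rightarrow> ('a \<Rightarrow> real ^ 'n) \<Rightarrow> 'a \<Rightarrow> real ^ 'n" where
  "vec_cond_exp M F Y = (\<lambda>\<omega>. \<chi> i. real_cond_exp M F (\<lambda>\<omega>. Y \<omega> $ i) \<omega>)"

text \<open>The random variables \<open>X\<close>, \<open>Y\<close> are the coordinate projections \<^term>\<open>fst\<close>, \<^term>\<open>snd\<close> on the
  probability space \<open>\<pi>\<close>, and \<^term>\<open>vimage_algebra UNIV fst borel\<close> is the sigma-algebra generated
  by \<open>X\<close>. Integrability of \<open>Y\<close>, needed for the conditional expectation to be meaningful, follows
  from the marginal condition once every \<open>\<nu> i\<close> has a finite first moment.\<close>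

definition VMT ::
    "('n::finite \<Rightarrow> real measure) \<Rightarrow> ('n \<Rightarrow> real measure) \<Rightarrow> ((real ^ 'n) \<times> (real ^ 'n)) measure set" where
  "VMT \<mu> \<nu> = {\<pi>. prob_space \<pi> \<and> sets \<pi> = sets borel \<and>
     (AE z in \<pi>. vec_cond_exp \<pi> (vimage_algebra UNIV fst borel) snd z = fst z) \<and>
     (\<forall>i. distr \<pi> borel (\<lambda>z. fst z $ i) = \<mu> i) \<and>
     (\<forall>i. distr \<pi> borel (\<lambda>z. snd z $ i) = \<nu> i)}"

definition disintegration ::
    "('a::topological_space \<times> 'b::topological_space) measure \<Rightarrow> ('a \<Rightarrow> 'b measure) \<Rightarrow> bool" where
  "disintegration \<pi> K \<longleftrightarrow> K \<in> borel \<rightarrow>\<^sub>M prob_algebra borel \<and>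
     (\<forall>A\<in>sets borel. \<forall>B\<in>sets borel.
        emeasure \<pi> (A \<times> B) = (\<integral>\<^sup>+x\<in>A. emeasure (K x) B \<partial>(distr \<pi> borel fst)))"

end

theory Submission
  imports Defs
begin

text \<open>The argument is variational and uses no duality. Write \<open>u = sgn (x - y)\<close>. Let \<open>\<sigma>\<close>, \<open>\<tau>\<close> be small
  functions of \<open>(x, y)\<close> that \<open>K x\<close> integrates to \<open>0\<close>, let \<open>\<sigma>\<close> also be orthogonal to \<open>y\<close>, and put
  \<open>v x = \<integral>y. \<tau> (x, y) * y \<partial>K x\<close>. Tossing a fair sign \<open>s\<close>, reweighting \<open>K x\<close> by \<open>1 + s (\<sigma> + t \<tau>)\<close> and
  moving \<open>x\<close> to \<open>x + s t v x\<close> keeps the law of \<open>Y\<close> and the martingale property, and raises the cost by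
  \<open>t E[\<sigma> (u \<bullet> v) + norm v 1{y = x}] + o(t)\<close>. The laws of the \<open>X i\<close> have densities, so Metropolis rejection
  restores them exactly at a displacement that is \<open>o(t)\<close> in mean; the resulting error in the conditional
  means is removed, at a cost of the same order, by exchanging values of \<open>Y i\<close> between points where it
  is too small and points where it is too large. Optimality therefore forces
  \<open>\<integral>y. \<sigma> (u \<bullet> v) + norm v 1{y = x} \<partial>K x \<le> 0\<close> for almost every \<open>x\<close>.

  With \<open>\<sigma> = 0\<close> this shows that \<open>K x\<close> is a point mass if it has an atom at \<open>x\<close>. With \<open>\<sigma>\<close> the residual of
  the projection of a coordinate of \<open>u\<close> onto the affine functions of \<open>y\<close>, and \<open>v\<close> a positive
  semidefinite image of \<open>\<integral>y. \<sigma> u \<partial>K x\<close>, it shows that \<open>u\<close> is almost everywhere an affine function of \<open>y\<close>.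
  Since \<open>norm u = 1\<close>, strict convexity of the Euclidean ball turns this into extremality.\<close>

section \<open>Integration and measurability\<close>

text \<open>The gain is bilinear. Averaged over \<open>s\<close> the weight is 1, so the law of
  \<open>(x, y)\<close> is untouched; but weight and displacement carry the same sign, so their
  product survives the averaging and pairs \<open>\<sigma>\<close> with the derivative of the norm
  in direction \<open>v x\<close>. Since \<open>\<sigma>\<close> does not change the conditional
  mean, it may have size of order 1, while \<open>\<tau>\<close>, which forces \<open>x\<close> to
  move, carries the factor \<open>t\<close>. The remaining even part of the cost is a second
  difference of the norm: convexity makes it nonnegative, and the kink at \<open>y = x\<close> gives
  \<open>norm (v x)\<close> at first order.

  The obstacle is that marginals and martingale property must hold exactly although the gain has
  order \<open>t\<close> only. One Metropolis step of fixed length keeps a coordinate law exact, but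
  \<open>v\<close> varies with \<open>x\<close>; hence the restriction to sets where
  \<open>v\<close> is almost constant, with an error proportional to the mass of the set, and a
  cover by countably many such sets. Only one-dimensional laws are prescribed, so the coordinates of
  \<open>x\<close> may be moved, and those of \<open>y\<close> exchanged, separately.\<close>

lemma integrable_bounded_mult:
  fixes f g :: "'a \<Rightarrow> real"
  assumes g: "integrable M g" and [measurable]: "f \<in> borel_measurable M"
    and f: "\<And>x. x \<in> space M \<Longrightarrow> \<bar>f x\<bar> \<le> C"
  shows "integrable M (\<lambda>x. f x * g x)"
proof (rule Bochner_Integration.integrable_bound)
  show "integrable M (\<lambda>x. C * g x)" using g by simp
  show "(\<lambda>x. f x * g x) \<in> borel_measurable M" using g by auto
  show "AE x in M. norm (f x * g x) \<le> norm (C * g x)"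
  proof (rule AE_I2)
    fix x assume "x \<in> space M"
    then have "\<bar>f x\<bar> \<le> \<bar>C\<bar>" using f[of x] by linarith
    then show "norm (f x * g x) \<le> norm (C * g x)"
      unfolding real_norm_def abs_mult by (rule mult_right_mono) simp
  qed
qed

lemma
  fixes f :: "'a \<Rightarrow> real"
  assumes "sigma_finite_measure M" "prob_space N" and f: "integrable M f"
  shows integrable_pair_fst: "integrable (M \<Otimes>\<^sub>M N) (\<lambda>z. f (fst z))"
    and integral_pair_fst: "(\<integral>z. f (fst z) \<partial>(M \<Otimes>\<^sub>M N)) = (\<integral>x. f x \<partial>M)"
proof -
  interpret M: sigma_finite_measure M by fact
  interpret N: prob_space N by fact
  interpret pair_sigma_finite M N ..
  have [measurable]: "f \<in> borel_measurable M" using f by auto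
  have "(\<integral>\<^sup>+z. ennreal (norm (f (fst z))) \<partial>(M \<Otimes>\<^sub>M N)) = (\<integral>\<^sup>+x. ennreal (norm (f x)) \<partial>M)"
    by (subst N.nn_integral_fst[symmetric]) (simp_all add: N.emeasure_space_1)
  then show i: "integrable (M \<Otimes>\<^sub>M N) (\<lambda>z. f (fst z))"
    using f by (auto simp: integrable_iff_bounded)
  show "(\<integral>z. f (fst z) \<partial>(M \<Otimes>\<^sub>M N)) = (\<integral>x. f x \<partial>M)"
    by (subst integral_fst'[OF i, symmetric]) (simp add: N.prob_space)
qed

lemma distr_eqI:
  fixes f :: "'a \<Rightarrow> real" and g :: "'b \<Rightarrow> real"
  assumes "prob_space M" "prob_space N" and [measurable]: "f \<in> borel_measurable M" "g \<in> borel_measurable N"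
    and eq: "\<And>A. A \<in> sets borel \<Longrightarrow> (\<integral>z. indicator A (f z) \<partial>M) = (\<integral>z. indicator A (g z) \<partial>N :: real)"
  shows "distr M borel f = distr N borel g"
proof (rule measure_eqI)
  interpret M: prob_space M by fact
  interpret N: prob_space N by fact
  fix A :: "real set" assume "A \<in> sets (distr M borel f)"
  then have A[measurable]: "A \<in> sets borel" by simp
  have "(\<integral>z. indicator A (f z) \<partial>M) = (\<integral>z. indicator (f -` A \<inter> space M) z \<partial>M :: real)"
    "(\<integral>w. indicator A (g w) \<partial>N) = (\<integral>w. indicator (g -` A \<inter> space N) w \<partial>N :: real)"
    by (auto intro!: Bochner_Integration.integral_cong simp: indicator_def)
  then have "(\<integral>z. indicator A (f z) \<partial>M) = measure M (f -` A \<inter> space M)"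
    "(\<integral>w. indicator A (g w) \<partial>N) = measure N (g -` A \<inter> space N)"
    by simp_all
  then show "emeasure (distr M borel f) A = emeasure (distr N borel g) A"
    using eq[OF A] by (simp add: emeasure_distr M.emeasure_eq_measure N.emeasure_eq_measure)
qed simp

section \<open>Vectors by coordinates\<close>

lemma borel_measurable_vec_nth [measurable]: "(\<lambda>x :: real ^ 'n. x $ i) \<in> borel_measurable borel"
  by (intro borel_measurable_continuous_onI continuous_intros)

lemma borel_measurable_vecI:
  fixes f :: "'a \<Rightarrow> real ^ 'n"
  assumes "\<And>i. (\<lambda>x. f x $ i) \<in> borel_measurable M"
  shows "f \<in> borel_measurable M"
  by (rule borel_measurable_euclidean_space[THEN iffD2])
    (use assms in \<open>auto simp: Basis_vec_def inner_axis\<close>)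

lemma coordinate_halfspace_measurable [measurable]:
  "{y :: real ^ 'n. y $ i \<le> r} \<in> sets borel" "{y :: real ^ 'n. r \<le> y $ i} \<in> sets borel"
proof -
  have "{y \<in> space borel. (y :: real ^ 'n) $ i \<le> r} \<in> sets borel" "{y \<in> space borel. r \<le> (y :: real ^ 'n) $ i} \<in> sets borel"
    by measurable
  then show "{y :: real ^ 'n. y $ i \<le> r} \<in> sets borel" "{y :: real ^ 'n. r \<le> y $ i} \<in> sets borel" by simp_all
qed

lemma norm_diff_le_l1: "norm (x - y) \<le> (\<Sum>i\<in>UNIV. \<bar>x $ i\<bar> + \<bar>y $ i\<bar>)" for x y :: "real ^ 'n"
  by (rule order.trans[OF norm_le_l1_cart]) (auto intro!: sum_mono)

lemma integrable_norm_diff: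
  fixes X Y :: "'a \<Rightarrow> real ^ 'n"
  assumes [measurable]: "X \<in> borel_measurable M" "Y \<in> borel_measurable M"
    and "\<And>i. integrable M (\<lambda>w. X w $ i)" "\<And>i. integrable M (\<lambda>w. Y w $ i)"
  shows "integrable M (\<lambda>w. norm (X w - Y w))"
proof (rule Bochner_Integration.integrable_bound)
  show "integrable M (\<lambda>w. \<Sum>i\<in>UNIV. \<bar>X w $ i\<bar> + \<bar>Y w $ i\<bar>)" using assms by simp
  show "AE w in M. norm (norm (X w - Y w)) \<le> norm (\<Sum>i\<in>UNIV. \<bar>X w $ i\<bar> + \<bar>Y w $ i\<bar>)"
    by (intro AE_I2) (simp add: order.trans[OF norm_diff_le_l1 abs_ge_self])
qed measurable

text \<open>If every rational threshold below the mean were exceeded almost surely, \<open>f\<close>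
  would be almost surely at least its mean, hence equal to it. The threshold is rational because
  \<open>first_order_optimality\<close> works with countably many thresholds.\<close>

lemma (in prob_space) rational_below_expectation:
  fixes f :: "'a \<Rightarrow> real"
  assumes f: "integrable M f" and nAE: "\<not> (AE w in M. f w = expectation f)"
  shows "\<exists>a :: rat. of_rat a < expectation f \<and> 0 < prob {w \<in> space M. f w \<le> of_rat a}"
proof (rule ccontr)
  assume *: "\<not> ?thesis"
  have [measurable]: "f \<in> borel_measurable M" using f by auto
  have "AE w in M. of_rat a < expectation f \<longrightarrow> \<not> f w \<le> of_rat a" for a :: rat
  proof (cases "of_rat a < expectation f")
    case True
    then have "prob {w \<in> space M. f w \<le> of_rat a} = 0"
      using * measure_nonneg[of M "{w \<in> space M. f w \<le> of_rat a}"] by (auto simp: less_le)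
    then have "AE w in M. w \<notin> {w \<in> space M. f w \<le> of_rat a}" by (subst (asm) prob_eq_0) auto
    with AE_space show ?thesis by eventually_elim simp
  qed simp
  then have "AE w in M. \<forall>a :: rat. of_rat a < expectation f \<longrightarrow> \<not> f w \<le> of_rat a"
    by (simp add: AE_all_countable)
  then have "AE w in M. 0 \<le> f w - expectation f"
  proof eventually_elim
    case (elim w)
    show ?case
    proof (rule ccontr)
      assume "\<not> 0 \<le> f w - expectation f"
      then obtain a where "f w < of_rat a" "of_rat a < expectation f"
        using of_rat_dense[of "f w" "expectation f"] by auto
      then show False using elim by (auto dest: less_imp_le)
    qed
  qed
  then have "AE w in M. f w - expectation f = 0"
    using integral_nonneg_eq_0_iff_AE[of M "\<lambda>w. f w - expectation f"] f by (simp add: prob_space)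
  then show False using nAE by simp
qed

section \<open>Continuity of translation in \<open>L\<^sup>1\<close>\<close>

lemma lborel_integral_translation:
  fixes f :: "'a::euclidean_space \<Rightarrow> real"
  assumes [measurable]: "f \<in> borel_measurable borel"
  shows "(\<integral>z. f (z + c) \<partial>lborel) = (\<integral>z. f z \<partial>lborel)"
proof -
  have "(\<integral>z. f z \<partial>lborel) = (\<integral>z. f z \<partial>distr lborel borel ((+) c))"
    by (simp add: lborel_distr_plus)
  also have "\<dots> = (\<integral>z. f (c + z) \<partial>lborel)"
    by (rule integral_distr) auto
  finally show ?thesis by (simp add: add.commute)
qed

lemma lborel_integrable_translation:
  fixes f :: "'a::euclidean_space \<Rightarrow> real"
  assumes f: "integrable lborel f"
  shows "integrable lborel (\<lambda>z. f (z + c))"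
proof -
  have [measurable]: "f \<in> borel_measurable borel" using f by auto
  have "integrable (distr lborel borel ((+) c)) f"
    using f by (simp add: lborel_distr_plus)
  then have "integrable lborel (\<lambda>z. f (c + z))"
    by (subst (asm) integrable_distr_eq) auto
  then show ?thesis by (simp add: add.commute)
qed

text \<open>Points of an open set stay in it under small translations, so the mass lost,
  \<open>g n\<close>, tends to 0 pointwise under the bound \<open>indicator U\<close>. For the mass
  gained no such bound is at hand, but translation invariance makes it equal to the mass
  lost.\<close>

lemma tendsto_L1_translation_open:
  fixes c :: "nat \<Rightarrow> 'a::euclidean_space"
  assumes c: "c \<longlonglongrightarrow> 0" and U: "open U" "emeasure lborel U < \<infinity>"
  shows "(\<lambda>n. \<integral>z. \<bar>indicator U (z + c n) - indicator U z :: real\<bar> \<partial>lborel) \<longlonglongrightarrow> 0"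
proof -
  have [measurable]: "U \<in> sets borel" using U by auto
  have iU: "integrable lborel (indicator U :: 'a \<Rightarrow> real)"
    using U by (simp add: integrable_indicator_iff)
  define g where "g n z = max 0 (indicator U z - indicator U (z + c n) :: real)" for n z
  have gm[measurable]: "g n \<in> borel_measurable borel" for n unfolding g_def by measurable
  have gb: "norm (g n z) \<le> indicator U z" for n z
    by (auto simp: g_def indicator_def)
  have gi: "integrable lborel (g n)" for n
    by (rule Bochner_Integration.integrable_bound[OF iU]) (use gb in auto)
  have "(\<lambda>n. \<integral>z. g n z \<partial>lborel) \<longlonglongrightarrow> (\<integral>z. 0 \<partial>(lborel :: 'a measure))"
  proof (rule integral_dominated_convergence[where w="indicator U"])
    show "AE z in lborel. (\<lambda>n. g n z) \<longlonglongrightarrow> 0"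
    proof (rule AE_I2)
      fix z :: 'a
      show "(\<lambda>n. g n z) \<longlonglongrightarrow> 0"
      proof (cases "z \<in> U")
        case True
        have "(\<lambda>n. z + c n) \<longlonglongrightarrow> z + 0" using c by (intro tendsto_intros)
        then have "eventually (\<lambda>n. z + c n \<in> U) sequentially"
          using topological_tendstoD[of _ "z + 0" sequentially U] U True by simp
        then have "eventually (\<lambda>n. g n z = 0) sequentially"
          by eventually_elim (use True in \<open>simp add: g_def\<close>)
        then show ?thesis by (rule tendsto_eventually)
      next
        case False
        then have "g n z = 0" for n by (simp add: g_def indicator_def)
        then show ?thesis by simp
      qed
    qed
  qed (use iU gb in auto)
  moreover have "(\<integral>z. \<bar>indicator U (z + c n) - indicator U z :: real\<bar> \<partial>lborel) = 2 * (\<integral>z. g n z \<partial>lborel)" for n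
  proof -
    have iU': "integrable lborel (\<lambda>z. indicator U (z + c n) :: real)"
      using lborel_integrable_translation[OF iU] .
    have "(\<integral>z. \<bar>indicator U (z + c n) - indicator U z :: real\<bar> \<partial>lborel)
        = (\<integral>z. 2 * g n z + (indicator U (z + c n) - indicator U z) \<partial>lborel)"
      by (rule Bochner_Integration.integral_cong) (auto simp: g_def max_def)
    also have "\<dots> = 2 * (\<integral>z. g n z \<partial>lborel)
        + ((\<integral>z. indicator U (z + c n) \<partial>lborel) - (\<integral>z. indicator U z \<partial>lborel))"
      using gi[of n] iU iU' by simp
    also have "\<dots> = 2 * (\<integral>z. g n z \<partial>lborel)"
      using lborel_integral_translation[of "indicator U" "c n"] by simp
    finally show ?thesis .
  qed
  ultimately show ?thesis
    using tendsto_mult_right_zero by auto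
qed

text \<open>Applied to the densities \<open>dens i\<close>, this makes rejections in the Metropolis
  step rare as the step length vanishes. Outer regularity passes from open sets to sets of finite
  measure.\<close>

lemma tendsto_L1_translation:
  fixes c :: "nat \<Rightarrow> 'a::euclidean_space" and f :: "'a \<Rightarrow> real"
  assumes c: "c \<longlonglongrightarrow> 0" and f: "integrable lborel f"
  shows "(\<lambda>n. \<integral>z. \<bar>f (z + c n) - f z\<bar> \<partial>lborel) \<longlonglongrightarrow> 0"
proof -
  \<comment> \<open>A three-epsilon argument: the translation defects of \<open>f\<close> and \<open>g\<close> differ by at most \<open>2 * \<parallel>f - g\<parallel>\<^sub>1\<close>.\<close>
  have approx: "(\<lambda>n. \<integral>z. \<bar>f (z + c n) - f z\<bar> \<partial>lborel) \<longlonglongrightarrow> 0"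
    if f: "integrable lborel f"
      and ex: "\<And>e. e > 0 \<Longrightarrow> \<exists>g. integrable lborel g \<and> (\<integral>z. \<bar>f z - g z\<bar> \<partial>lborel) \<le> e
        \<and> (\<lambda>n. \<integral>z. \<bar>g (z + c n) - g z\<bar> \<partial>lborel) \<longlonglongrightarrow> 0" for f :: "'a \<Rightarrow> real"
  proof (rule LIMSEQ_I)
    fix r :: real assume r: "r > 0"
    obtain g where g: "integrable lborel g" "(\<integral>z. \<bar>f z - g z\<bar> \<partial>lborel) \<le> r / 4"
        "(\<lambda>n. \<integral>z. \<bar>g (z + c n) - g z\<bar> \<partial>lborel) \<longlonglongrightarrow> 0"
      using ex[of "r / 4"] r by auto
    have [measurable]: "f \<in> borel_measurable borel" "g \<in> borel_measurable borel" using f g by auto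
    obtain N where N: "\<And>n. n \<ge> N \<Longrightarrow> norm ((\<integral>z. \<bar>g (z + c n) - g z\<bar> \<partial>lborel) - 0) < r / 2"
      using LIMSEQ_D[OF g(3), of "r / 2"] r by auto
    have "norm ((\<integral>z. \<bar>f (z + c n) - f z\<bar> \<partial>lborel) - 0) < r" if "n \<ge> N" for n
    proof -
      note fi = f lborel_integrable_translation[OF f, of "c n"] g(1)
        lborel_integrable_translation[OF g(1), of "c n"]
      have "(\<integral>z. \<bar>f (z + c n) - f z\<bar> \<partial>lborel)
          \<le> (\<integral>z. \<bar>f (z + c n) - g (z + c n)\<bar> + (\<bar>g (z + c n) - g z\<bar> + \<bar>f z - g z\<bar>) \<partial>lborel)"
        using fi by (intro integral_mono) (auto intro!: Bochner_Integration.integrable_add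
          Bochner_Integration.integrable_diff integrable_abs)
      also have "\<dots> = (\<integral>z. \<bar>f (z + c n) - g (z + c n)\<bar> \<partial>lborel)
          + ((\<integral>z. \<bar>g (z + c n) - g z\<bar> \<partial>lborel) + (\<integral>z. \<bar>f z - g z\<bar> \<partial>lborel))"
        using fi by (subst Bochner_Integration.integral_add) (auto intro!: Bochner_Integration.integrable_add
          Bochner_Integration.integrable_diff integrable_abs)
      also have "(\<integral>z. \<bar>f (z + c n) - g (z + c n)\<bar> \<partial>lborel) = (\<integral>z. \<bar>f z - g z\<bar> \<partial>lborel)"
        using lborel_integral_translation[of "\<lambda>z. \<bar>f z - g z\<bar>" "c n"] by simp
      finally have "(\<integral>z. \<bar>f (z + c n) - f z\<bar> \<partial>lborel) < r"
        using N[OF that] g(2) by auto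
      then show ?thesis by simp
    qed
    then show "\<exists>no. \<forall>n\<ge>no. norm ((\<integral>z. \<bar>f (z + c n) - f z\<bar> \<partial>lborel) - 0) < r" by blast
  qed
  show ?thesis using f
  proof (induction rule: integrable_induct)
    case (base A k)
    then have [measurable]: "A \<in> sets borel" by simp
    have fin: "emeasure lborel A < \<infinity>" using base by simp
    have ind: "(\<lambda>n. \<integral>z. \<bar>indicator A (z + c n) - indicator A z :: real\<bar> \<partial>lborel) \<longlonglongrightarrow> 0"
    proof (rule approx)
      show "integrable lborel (indicator A :: 'a \<Rightarrow> real)"
        using fin by (simp add: integrable_indicator_iff)
      fix e :: real assume e: "e > 0"
      obtain U where U: "open U" "A \<subseteq> U" "emeasure lborel (U - A) < e"
        using outer_regular_lborel[of A e] e by auto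
      have [measurable]: "U \<in> sets borel" using U by auto
      have fd: "emeasure lborel (U - A) < \<infinity>" using order.strict_trans[OF U(3) ennreal_less_top] by simp
      have "emeasure lborel U \<le> emeasure lborel A + emeasure lborel (U - A)"
        using U(2) by (intro order.trans[OF _ emeasure_subadditive]) (auto intro!: emeasure_mono)
      then have finU: "emeasure lborel U < \<infinity>" using fin fd
        by (simp add: order.strict_trans1)
      have "(\<integral>z. \<bar>indicator A z - indicator U z :: real\<bar> \<partial>lborel) = (\<integral>z. indicator (U - A) z \<partial>lborel)"
        using U(2) by (intro Bochner_Integration.integral_cong) (auto simp: indicator_def)
      also have "\<dots> = measure lborel (U - A)" by simp
      also have "\<dots> \<le> e" using U(3) fd e
        by (simp add: emeasure_eq_ennreal_measure ennreal_less_iff less_top)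
      finally show "\<exists>g. integrable lborel g \<and> (\<integral>z. \<bar>indicator A z - g z :: real\<bar> \<partial>lborel) \<le> e
          \<and> (\<lambda>n. \<integral>z. \<bar>g (z + c n) - g z\<bar> \<partial>lborel) \<longlonglongrightarrow> 0"
        using tendsto_L1_translation_open[OF c U(1) finU] finU
        by (intro exI[of _ "indicator U"]) (simp add: integrable_indicator_iff)
    qed
    have "\<bar>indicator A (z + c n) *\<^sub>R k - indicator A z *\<^sub>R k\<bar>
        = \<bar>k\<bar> * \<bar>indicator A (z + c n) - indicator A z :: real\<bar>" for z n
      by (simp add: indicator_def)
    then show ?case using tendsto_mult_right_zero[OF ind, of "\<bar>k\<bar>"] by simp
  next
    case (add f g)
    have le: "(\<integral>z. \<bar>f (z + c n) + g (z + c n) - (f z + g z)\<bar> \<partial>lborel)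
        \<le> (\<integral>z. \<bar>f (z + c n) - f z\<bar> \<partial>lborel) + (\<integral>z. \<bar>g (z + c n) - g z\<bar> \<partial>lborel)" for n
    proof -
      note fi = add(1,2) lborel_integrable_translation[OF add(1), of "c n"]
        lborel_integrable_translation[OF add(2), of "c n"]
      have "(\<integral>z. \<bar>f (z + c n) + g (z + c n) - (f z + g z)\<bar> \<partial>lborel)
          \<le> (\<integral>z. \<bar>f (z + c n) - f z\<bar> + \<bar>g (z + c n) - g z\<bar> \<partial>lborel)"
        using fi by (intro integral_mono) auto
      then show ?thesis
        using fi by (subst (asm) Bochner_Integration.integral_add) auto
    qed
    have lim0: "(\<lambda>n. (\<integral>z. \<bar>f (z + c n) - f z\<bar> \<partial>lborel) + (\<integral>z. \<bar>g (z + c n) - g z\<bar> \<partial>lborel)) \<longlonglongrightarrow> 0"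
      using tendsto_add[OF add(3,4)] by simp
    show ?case
      by (rule tendsto_sandwich[OF _ _ tendsto_const lim0]) (use le in \<open>auto intro!: always_eventually\<close>)
  next
    case (lim f s)
    show ?case
    proof (rule approx[OF lim(4)])
      fix e :: real assume e: "e > 0"
      have [measurable]: "f \<in> borel_measurable borel" "\<And>i. s i \<in> borel_measurable borel"
        using lim(1,4) by auto
      \<comment> \<open>The approximation comes with
        \<open>norm (s i z) \<le> 2 * norm (f z)\<close>, whence the factor 3 in the dominating
        function.\<close>
      have "(\<lambda>i. \<integral>z. \<bar>f z - s i z\<bar> \<partial>lborel) \<longlonglongrightarrow> (\<integral>z. 0 \<partial>(lborel :: 'a measure))"
      proof (rule integral_dominated_convergence[where w="\<lambda>z. 3 * norm (f z)"])
        show "AE z in lborel. (\<lambda>i. \<bar>f z - s i z\<bar>) \<longlonglongrightarrow> 0"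
        proof (rule AE_I2)
          fix z
          have "(\<lambda>i. s i z) \<longlonglongrightarrow> f z" using lim(2)[of z] by simp
          then have "(\<lambda>i. \<bar>f z - s i z\<bar>) \<longlonglongrightarrow> \<bar>f z - f z\<bar>" by (intro tendsto_intros)
          then show "(\<lambda>i. \<bar>f z - s i z\<bar>) \<longlonglongrightarrow> 0" by simp
        qed
        show "AE z in lborel. norm \<bar>f z - s i z\<bar> \<le> 3 * norm (f z)" for i
        proof (rule AE_I2)
          fix z
          show "norm \<bar>f z - s i z\<bar> \<le> 3 * norm (f z)" using lim(3)[of z i] by simp
        qed
      qed (use lim(4) in auto)
      then have "eventually (\<lambda>i. (\<integral>z. \<bar>f z - s i z\<bar> \<partial>lborel) < e) sequentially"
        using e by (intro order_tendstoD) auto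
      then obtain i where "(\<integral>z. \<bar>f z - s i z\<bar> \<partial>lborel) < e"
        by (auto simp: eventually_sequentially)
      then show "\<exists>g. integrable lborel g \<and> (\<integral>z. \<bar>f z - g z\<bar> \<partial>lborel) \<le> e
          \<and> (\<lambda>n. \<integral>z. \<bar>g (z + c n) - g z\<bar> \<partial>lborel) \<longlonglongrightarrow> 0"
        using lim(1,5) by (intro exI[of _ "s i"]) auto
    qed
  qed
qed

section \<open>Repairing conditional means\<close>

text \<open>The measure is the image under \<open>\<Phi>\<close> of the density \<open>W\<close>
  over counting measure times \<open>N\<close>. Describing it by integrals alone lets each branch
  \<open>j\<close> be evaluated on \<open>N\<close>; even its total mass is obtained by inserting a
  constant for \<open>g\<close>.\<close>

lemma weighted_mixture_exists:
  fixes W :: "'j::finite \<Rightarrow> 'w \<Rightarrow> real" and \<Phi> :: "'j \<Rightarrow> 'w \<Rightarrow> 'b"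
  assumes "sigma_finite_measure N"
    and W: "\<And>j. W j \<in> borel_measurable N" "\<And>j w. 0 \<le> W j w" "\<And>j w. W j w \<le> C"
    and \<Phi>: "\<And>j. \<Phi> j \<in> N \<rightarrow>\<^sub>M S"
  shows "\<exists>\<gamma>. sets \<gamma> = sets S \<and> (\<forall>g::'b \<Rightarrow> real. g \<in> borel_measurable S \<longrightarrow>
    (\<forall>j. integrable N (\<lambda>w. g (\<Phi> j w))) \<longrightarrow> integrable \<gamma> g \<and>
      (\<integral>z. g z \<partial>\<gamma>) = (\<Sum>j\<in>UNIV. \<integral>w. W j w * g (\<Phi> j w) \<partial>N))"
proof -
  interpret N: sigma_finite_measure N by fact
  interpret J: sigma_finite_measure "count_space (UNIV :: 'j set)"
    by (rule sigma_finite_measure_count_space_finite) simp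
  interpret P: pair_sigma_finite "count_space (UNIV :: 'j set)" N ..
  let ?M = "count_space (UNIV :: 'j set) \<Otimes>\<^sub>M N"
  define \<gamma> where "\<gamma> = distr (density ?M (\<lambda>z. ennreal (W (fst z) (snd z)))) S (\<lambda>z. \<Phi> (fst z) (snd z))"
  have Wm[measurable]: "(\<lambda>z. W (fst z) (snd z)) \<in> borel_measurable ?M"
    by (rule measurable_pair_measure_countable1) (use W in auto)
  have \<Phi>m[measurable]: "(\<lambda>z. \<Phi> (fst z) (snd z)) \<in> ?M \<rightarrow>\<^sub>M S"
    by (rule measurable_pair_measure_countable1) (use \<Phi> in auto)
  have main: "integrable \<gamma> g" "(\<integral>z. g z \<partial>\<gamma>) = (\<Sum>j\<in>UNIV. \<integral>w. W j w * g (\<Phi> j w) \<partial>N)"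
    if gm[measurable]: "g \<in> borel_measurable S" and gi: "\<And>j. integrable N (\<lambda>w. g (\<Phi> j w))" for g :: "'b \<Rightarrow> real"
  proof -
    have wi: "integrable N (\<lambda>w. W j w * g (\<Phi> j w))" for j
      by (rule integrable_bounded_mult[where C=C, OF gi W(1)]) (use W(2,3) in \<open>simp add: abs_of_nonneg\<close>)
    have int: "integrable ?M (\<lambda>z. W (fst z) (snd z) * g (\<Phi> (fst z) (snd z)))"
    proof -
      have "(\<integral>\<^sup>+z. ennreal (norm (W (fst z) (snd z) * g (\<Phi> (fst z) (snd z)))) \<partial>?M)
          = (\<Sum>j\<in>UNIV. \<integral>\<^sup>+w. ennreal (norm (W j w * g (\<Phi> j w))) \<partial>N)"
        by (subst N.nn_integral_fst[symmetric]) (simp_all add: nn_integral_count_space_finite)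
      also have "\<dots> < \<infinity>"
        using wi by (auto simp: integrable_iff_bounded)
      finally show ?thesis by (intro integrableI_bounded) auto
    qed
    show "integrable \<gamma> g"
      unfolding \<gamma>_def using int W(2)
      by (subst integrable_distr_eq) (auto simp: integrable_density)
    have "(\<integral>z. g z \<partial>\<gamma>) = (\<integral>z. W (fst z) (snd z) * g (\<Phi> (fst z) (snd z)) \<partial>?M)"
      unfolding \<gamma>_def using W(2) by (subst integral_distr) (auto simp: integral_density)
    also have "\<dots> = (\<Sum>j\<in>UNIV. \<integral>w. W j w * g (\<Phi> j w) \<partial>N)"
      by (subst P.integral_fst'[OF int, symmetric])
        (simp add: lebesgue_integral_count_space_finite)
    finally show "(\<integral>z. g z \<partial>\<gamma>) = (\<Sum>j\<in>UNIV. \<integral>w. W j w * g (\<Phi> j w) \<partial>N)" .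
  qed
  have "sets \<gamma> = sets S" by (simp add: \<gamma>_def)
  then show ?thesis using main by blast
qed

text \<open>At rate \<open>k i w w'\<close> the point \<open>w\<close> gives up its own value of \<open>Y i\<close> for that of \<open>w'\<close>. As \<open>k i\<close> is symmetric
  the law of \<open>Y i\<close> is unchanged, and the weight \<open>1 / \<bar>Y w' $ i - Y w $ i\<bar>\<close> makes the expected
  displacement factor into \<open>p i w - q i w\<close>.\<close>

lemma exchange_repair:
  fixes Q :: "'w measure" and X Y :: "'w \<Rightarrow> real ^ 'n" and p q :: "'n::finite \<Rightarrow> 'w \<Rightarrow> real"
    and a b :: "'n \<Rightarrow> real"
  assumes "prob_space Q"
    and [measurable]: "X \<in> borel_measurable Q" "Y \<in> borel_measurable Q"
      "\<And>i. p i \<in> borel_measurable Q" "\<And>i. q i \<in> borel_measurable Q"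
    and iX: "\<And>i. integrable Q (\<lambda>w. X w $ i)" and iY: "\<And>i. integrable Q (\<lambda>w. Y w $ i)"
    and p0: "\<And>i w. 0 \<le> p i w" and q0: "\<And>i w. 0 \<le> q i w"
    and pa: "\<And>i w. p i w \<noteq> 0 \<Longrightarrow> Y w $ i \<le> a i" and qb: "\<And>i w. q i w \<noteq> 0 \<Longrightarrow> b i \<le> Y w $ i"
    and ab: "\<And>i. a i < b i"
    and pq: "\<And>i w. p i w + q i w \<le> (b i - a i) / CARD('n)"
    and e: "\<And>i. (\<integral>w. p i w \<partial>Q) = (\<integral>w. q i w \<partial>Q)"
    and mart: "\<And>i A. A \<in> sets borel \<Longrightarrow>
      (\<integral>w. indicator A (X w) * (Y w $ i + p i w - q i w - X w $ i) \<partial>Q) = 0"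
  shows "\<exists>\<gamma>. prob_space \<gamma> \<and> sets \<gamma> = sets (borel :: ((real ^ 'n) \<times> (real ^ 'n)) measure) \<and>
    (\<forall>i. distr \<gamma> borel (\<lambda>z. fst z $ i) = distr Q borel (\<lambda>w. X w $ i)) \<and>
    (\<forall>i. distr \<gamma> borel (\<lambda>z. snd z $ i) = distr Q borel (\<lambda>w. Y w $ i)) \<and>
    (\<forall>i. \<forall>A\<in>sets borel. (\<integral>z. indicator A (fst z) * (snd z $ i - fst z $ i) \<partial>\<gamma>) = 0) \<and>
    (\<integral>w. norm (X w - Y w) \<partial>Q) - 2 * (\<Sum>i\<in>UNIV. \<integral>w. p i w \<partial>Q) \<le> (\<integral>z. norm (fst z - snd z) \<partial>\<gamma>)"
proof -
  interpret Q: prob_space Q by fact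
  interpret QQ: pair_prob_space Q Q ..
  define d where "d = real CARD('n)"
  have d: "d > 0" by (simp add: d_def)
  define e where "e i = (\<integral>w. p i w \<partial>Q)" for i
  have e0: "e i \<ge> 0" for i unfolding e_def using p0 by (intro integral_nonneg_AE) auto
  have Ym[measurable]: "(\<lambda>w. Y w $ i) \<in> borel_measurable Q" "(\<lambda>w. X w $ i) \<in> borel_measurable Q" for i
    using iX iY by auto
  have pB: "p i w \<le> (b i - a i) / d" and qB: "q i w \<le> (b i - a i) / d" for i w
    using pq[of i w] p0[of i w] q0[of i w] by (auto simp: d_def)
  have ip: "integrable Q (p i)" and iq: "integrable Q (q i)" for i
    using pB qB p0 q0 by (auto intro!: Q.integrable_const_bound[where B="(b i - a i) / d"])
  have eq: "(\<integral>w. q i w \<partial>Q) = e i" for i using e by (simp add: e_def)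
  \<comment> \<open>Dividing by \<open>e i\<close>, the common mean of \<open>p i\<close> and
    \<open>q i\<close>, integrates out the partner. If \<open>e i = 0\<close>, division by zero
    yields the rate 0, which is right because \<open>p i\<close> and \<open>q i\<close> then vanish
    almost everywhere.\<close>
  define k where "k i w w' = (p i w * q i w' + q i w * p i w') / (e i * \<bar>Y w' $ i - Y w $ i\<bar>)" for i w w'
  \<comment> \<open>The gap between \<open>a i\<close> and \<open>b i\<close> keeps the denominator
    of \<open>k\<close> away from 0 wherever the numerator is not 0, and fixes the direction of the
    exchange.\<close>
  have sgn_p: "\<bar>Y w' $ i - Y w $ i\<bar> \<ge> b i - a i" "Y w' $ i - Y w $ i > 0" if "p i w * q i w' \<noteq> 0" for i w w'
    using that pa[of i w] qb[of i w'] ab[of i] by auto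
  have sgn_q: "\<bar>Y w' $ i - Y w $ i\<bar> \<ge> b i - a i" "Y w' $ i - Y w $ i < 0" if "q i w * p i w' \<noteq> 0" for i w w'
    using that pa[of i w'] qb[of i w] ab[of i] by auto
  have k0: "0 \<le> k i w w'" for i w w' unfolding k_def using p0 q0 e0 by simp
  have ksym: "k i w w' = k i w' w" for i w w'
    unfolding k_def by (simp add: abs_minus_commute algebra_simps)
  have kle: "k i w w' \<le> (p i w * q i w' + q i w * p i w') / (e i * (b i - a i))" for i w w'
  proof (cases "e i = 0 \<or> p i w * q i w' + q i w * p i w' = 0")
    case True then show ?thesis by (auto simp: k_def)
  next
    case False
    then have "p i w * q i w' \<noteq> 0 \<or> q i w * p i w' \<noteq> 0" by auto
    then have "\<bar>Y w' $ i - Y w $ i\<bar> \<ge> b i - a i" using sgn_p(1) sgn_q(1) by blast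
    then show ?thesis unfolding k_def
      using False e0[of i] ab[of i] p0 q0 by (intro divide_left_mono mult_left_mono mult_pos_pos) (auto intro: add_nonneg_nonneg)
  qed
  have kmove: "k i w w' * (Y w' $ i - Y w $ i) = (p i w * q i w' - q i w * p i w') / e i" for i w w'
  proof -
    consider "p i w * q i w' \<noteq> 0" | "q i w * p i w' \<noteq> 0" | "p i w * q i w' = 0" "q i w * p i w' = 0" by auto
    then show ?thesis
    proof cases
      case 1
      have "q i w * p i w' = 0" using sgn_p(2)[OF 1] sgn_q(2)[of i w w'] by fastforce
      then show ?thesis using sgn_p(2)[OF 1] by (auto simp: k_def)
    next
      case 2
      have pq: "p i w * q i w' = 0" using sgn_q(2)[OF 2] sgn_p(2)[of i w w'] by fastforce
      have "\<bar>Y w' $ i - Y w $ i\<bar> = - (Y w' $ i - Y w $ i)" using sgn_q(2)[OF 2] by simp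
      then show ?thesis using sgn_q(2)[OF 2] unfolding k_def pq by (simp add: divide_simps algebra_simps)
    next
      case 3
      then show ?thesis unfolding k_def 3 by simp
    qed
  qed
  have kmove_abs: "k i w w' * \<bar>Y w' $ i - Y w $ i\<bar> \<le> (p i w * q i w' + q i w * p i w') / e i" for i w w'
  proof -
    have "\<not> e i < 0" "0 \<le> p i w * q i w' + q i w * p i w'" using e0[of i] p0 q0 by auto
    then show ?thesis unfolding k_def by (auto simp: divide_simps)
  qed
  have km[measurable]: "(\<lambda>z. k i (fst z) (snd z)) \<in> borel_measurable (Q \<Otimes>\<^sub>M Q)" for i
    unfolding k_def by measurable
  have km2[measurable]: "k i w \<in> borel_measurable Q" if "w \<in> space Q" for i w
    unfolding k_def using that by measurable
  obtain C where kC: "\<And>i w w'. k i w w' \<le> C"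
  proof -
    define B where "B i = (((b i - a i) / d) * ((b i - a i) / d) + ((b i - a i) / d) * ((b i - a i) / d)) / (e i * (b i - a i))" for i
    have "k i w w' \<le> B i" for i w w'
      unfolding B_def using p0 q0 pB qB e0 ab[of i] d
      by (intro order.trans[OF kle] divide_right_mono add_mono mult_mono) auto
    moreover have "B i \<le> Max (range B)" for i by (intro Max_ge) auto
    ultimately have "k i w w' \<le> Max (range B)" for i w w' by (meson order.trans)
    then show ?thesis using that by blast
  qed
  \<comment> \<open>This is the total rate at which \<open>w\<close> gives up coordinate
    \<open>i\<close>. The factor \<open>1 / CARD('n)\<close> in the assumption on
    \<open>p i w + q i w\<close> makes these rates sum to at most 1 over \<open>i\<close>; the
    remainder is the weight of \<open>None\<close>, no exchange.\<close>
  define \<kappa> where "\<kappa> i w = (\<integral>w'. k i w w' \<partial>Q)" for i w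
  have \<kappa>m[measurable]: "\<kappa> i \<in> borel_measurable Q" for i
    unfolding \<kappa>_def by (rule Q.borel_measurable_lebesgue_integral) (use km[of i] in \<open>simp add: split_def\<close>)
  have \<kappa>0: "0 \<le> \<kappa> i w" for i w unfolding \<kappa>_def using k0 by (intro integral_nonneg_AE) auto
  have \<kappa>d: "\<kappa> i w \<le> 1 / d" if "w \<in> space Q" for i w
  proof -
    have "\<kappa> i w \<le> (\<integral>w'. (p i w * q i w' + q i w * p i w') / (e i * (b i - a i)) \<partial>Q)"
      unfolding \<kappa>_def
    proof (rule integral_mono)
      show "integrable Q (k i w)"
        using kC k0 that by (intro Q.integrable_const_bound[where B=C]) (auto intro: km2)
    qed (use ip iq kle in auto)
    also have "\<dots> = (p i w * e i + q i w * e i) / (e i * (b i - a i))"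
      using ip iq by (simp add: eq e_def)
    also have "\<dots> \<le> (p i w + q i w) / (b i - a i)"
      using p0[of i w] q0[of i w] ab[of i] by (cases "e i = 0") (auto simp: distrib_right[symmetric] simp del: distrib_right)
    also have "\<dots> \<le> 1 / d"
      using pq[of i w] ab[of i] d by (simp add: d_def field_simps)
    finally show ?thesis .
  qed
  have \<kappa>sum: "(\<Sum>i\<in>UNIV. \<kappa> i w) \<le> 1" if "w \<in> space Q" for w
    using sum_bounded_above[of UNIV "\<lambda>i. \<kappa> i w" "1 / d"] \<kappa>d[OF that] d by (simp add: d_def)
  \<comment> \<open>The sum of the rates is bounded only on \<open>space Q\<close>, whereas
    \<open>weighted_mixture_exists\<close> wants nonnegative weights everywhere; on
    \<open>space Q\<close> the \<open>max 0\<close> changes nothing.\<close>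
  define W where "W j z = (case j of None \<Rightarrow> max 0 (1 - (\<Sum>i\<in>UNIV. \<kappa> i (fst z))) | Some i \<Rightarrow> k i (fst z) (snd z))"
    for j :: "'n option" and z
  define F where "F j z = (X (fst z), case j of None \<Rightarrow> Y (fst z)
      | Some i \<Rightarrow> Y (fst z) + (Y (snd z) $ i - Y (fst z) $ i) *\<^sub>R axis i 1)" for j :: "'n option" and z
  have Wm: "W j \<in> borel_measurable (Q \<Otimes>\<^sub>M Q)" for j
    by (cases j) (simp_all add: W_def[abs_def])
  have Fm: "F j \<in> (Q \<Otimes>\<^sub>M Q) \<rightarrow>\<^sub>M borel" for j
    unfolding borel_prod[symmetric] by (cases j) (simp_all add: F_def[abs_def])
  have W0: "0 \<le> W j z" for j z by (cases j) (auto simp: W_def k0)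
  have WC: "W j z \<le> max 1 C" for j z
    using \<kappa>0 kC by (cases j) (auto simp: W_def sum_nonneg le_max_iff_disj)
  obtain \<gamma> where \<gamma>s: "sets \<gamma> = sets borel"
    and \<gamma>: "\<forall>g::_ \<Rightarrow> real. g \<in> borel_measurable borel \<longrightarrow> (\<forall>j. integrable (Q \<Otimes>\<^sub>M Q) (\<lambda>w. g (F j w))) \<longrightarrow>
      integrable \<gamma> g \<and> (\<integral>z. g z \<partial>\<gamma>) = (\<Sum>j\<in>UNIV. \<integral>w. W j w * g (F j w) \<partial>(Q \<Otimes>\<^sub>M Q))"
    using weighted_mixture_exists[where W=W and \<Phi>=F and C="max 1 C" and S=borel,
      OF QQ.sigma_finite_measure_axioms Wm W0 WC Fm] by blast
  have \<gamma>i: "integrable \<gamma> g"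
    and \<gamma>e: "(\<integral>z. g z \<partial>\<gamma>) = (\<Sum>j\<in>UNIV. \<integral>w. W j w * g (F j w) \<partial>(Q \<Otimes>\<^sub>M Q))"
    if "g \<in> borel_measurable borel" "\<And>j. integrable (Q \<Otimes>\<^sub>M Q) (\<lambda>w. g (F j w))" for g :: "_ \<Rightarrow> real"
    using \<gamma> that by blast+
  have int1: "integrable (Q \<Otimes>\<^sub>M Q) (\<lambda>z. f (fst z))" "(\<integral>z. f (fst z) \<partial>(Q \<Otimes>\<^sub>M Q)) = (\<integral>w. f w \<partial>Q)"
    "integrable (Q \<Otimes>\<^sub>M Q) (\<lambda>z. f (snd z))"
    if f: "integrable Q f" for f :: "'w \<Rightarrow> real"
  proof -
    show i1: "integrable (Q \<Otimes>\<^sub>M Q) (\<lambda>z. f (fst z))"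
      by (rule integrable_pair_fst[OF Q.sigma_finite_measure_axioms Q.prob_space_axioms f])
    show "(\<integral>z. f (fst z) \<partial>(Q \<Otimes>\<^sub>M Q)) = (\<integral>w. f w \<partial>Q)"
      by (rule integral_pair_fst[OF Q.sigma_finite_measure_axioms Q.prob_space_axioms f])
    show "integrable (Q \<Otimes>\<^sub>M Q) (\<lambda>z. f (snd z))"
      using QQ.integrable_product_swap[OF i1] by (simp add: split_def)
  qed
  have ki: "integrable (Q \<Otimes>\<^sub>M Q) (\<lambda>z. k i (fst z) (snd z) * f z)" if "integrable (Q \<Otimes>\<^sub>M Q) f" for f i
    by (rule integrable_bounded_mult[where C=C, OF that km]) (use k0 kC in \<open>simp add: abs_of_nonneg\<close>)
  have kfst: "(\<integral>z. k i (fst z) (snd z) * f (fst z) \<partial>(Q \<Otimes>\<^sub>M Q)) = (\<integral>w. \<kappa> i w * f w \<partial>Q)"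
    if f: "integrable Q f" for f i
    by (subst QQ.integral_fst'[OF ki[OF int1(1)[OF f]], symmetric]) (simp add: \<kappa>_def)
  \<comment> \<open>Here the symmetry of \<open>k\<close> enters: values received are distributed
    like values given up, so the law of each \<open>Y i\<close> is kept.\<close>
  have ksnd: "(\<integral>z. k i (fst z) (snd z) * f (snd z) \<partial>(Q \<Otimes>\<^sub>M Q)) = (\<integral>w. \<kappa> i w * f w \<partial>Q)"
    if f: "integrable Q f" for f i
  proof -
    have "(\<integral>z. k i (fst z) (snd z) * f (snd z) \<partial>(Q \<Otimes>\<^sub>M Q))
        = (\<integral>z. k i (snd z) (fst z) * f (fst z) \<partial>(Q \<Otimes>\<^sub>M Q))"
      using f by (subst QQ.integral_product_swap[symmetric]) (simp_all add: split_def)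
    also have "\<dots> = (\<integral>z. k i (fst z) (snd z) * f (fst z) \<partial>(Q \<Otimes>\<^sub>M Q))"
      by (simp only: ksym)
    finally show ?thesis using kfst[OF f] by simp
  qed
  have W_None: "(\<integral>z. W None z * f (fst z) \<partial>(Q \<Otimes>\<^sub>M Q)) = (\<integral>w. f w \<partial>Q) - (\<Sum>i\<in>UNIV. \<integral>w. \<kappa> i w * f w \<partial>Q)"
    if f: "integrable Q f" for f
  proof -
    have \<kappa>f: "integrable Q (\<lambda>w. \<kappa> i w * f w)" for i
      by (rule integrable_bounded_mult[where C="1 / d", OF f \<kappa>m]) (use \<kappa>0 \<kappa>d in \<open>simp add: abs_of_nonneg\<close>)
    have "(\<integral>z. W None z * f (fst z) \<partial>(Q \<Otimes>\<^sub>M Q)) = (\<integral>z. f (fst z) - (\<Sum>i\<in>UNIV. \<kappa> i (fst z) * f (fst z)) \<partial>(Q \<Otimes>\<^sub>M Q))"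
      using \<kappa>sum by (intro Bochner_Integration.integral_cong)
        (auto simp: W_def space_pair_measure max_def algebra_simps sum_distrib_left sum_distrib_right)
    also have "\<dots> = (\<integral>w. f w - (\<Sum>i\<in>UNIV. \<kappa> i w * f w) \<partial>Q)"
      using f \<kappa>f by (intro int1(2)) auto
    also have "\<dots> = (\<integral>w. f w \<partial>Q) - (\<Sum>i\<in>UNIV. \<integral>w. \<kappa> i w * f w \<partial>Q)"
      using f \<kappa>f by simp
    finally show ?thesis .
  qed
  have opt: "(\<Sum>j\<in>(UNIV :: 'n option set). h j) = h None + (\<Sum>i\<in>UNIV. h (Some i))" for h :: "'n option \<Rightarrow> real"
    by (simp add: UNIV_option_conv sum.reindex)
  have F_fst: "fst (F j z) = X (fst z)" for j z by (simp add: F_def)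
  have \<gamma>X: "integrable \<gamma> (\<lambda>z. g (fst z))" "(\<integral>z. g (fst z) \<partial>\<gamma>) = (\<integral>w. g (X w) \<partial>Q)"
    if [measurable]: "g \<in> borel_measurable borel" and gi: "integrable Q (\<lambda>w. g (X w))" for g :: "_ \<Rightarrow> real"
  proof -
    have gm: "(\<lambda>z. g (fst z)) \<in> borel_measurable (borel :: ((real ^ 'n) \<times> (real ^ 'n)) measure)"
      unfolding borel_prod[symmetric] by measurable
    have gF: "integrable (Q \<Otimes>\<^sub>M Q) (\<lambda>z. g (fst (F j z)))" for j
      unfolding F_fst using int1(1)[OF gi] .
    show "integrable \<gamma> (\<lambda>z. g (fst z))" by (rule \<gamma>i[OF gm gF])
    show "(\<integral>z. g (fst z) \<partial>\<gamma>) = (\<integral>w. g (X w) \<partial>Q)"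
      unfolding \<gamma>e[OF gm gF] opt F_fst using kfst[OF gi] W_None[OF gi]
      by (simp add: W_def)
  qed
  have F_snd: "snd (F None z) = Y (fst z)" "snd (F (Some i) z) $ l = (if l = i then Y (snd z) $ i else Y (fst z) $ l)" for i l z
    by (auto simp: F_def axis_def)
  have \<gamma>Y: "integrable \<gamma> (\<lambda>z. g (snd z $ l))" "(\<integral>z. g (snd z $ l) \<partial>\<gamma>) = (\<integral>w. g (Y w $ l) \<partial>Q)"
    if [measurable]: "g \<in> borel_measurable borel" and gi: "integrable Q (\<lambda>w. g (Y w $ l))" for g :: "_ \<Rightarrow> real" and l
  proof -
    have gm: "(\<lambda>z. g (snd z $ l)) \<in> borel_measurable (borel :: ((real ^ 'n) \<times> (real ^ 'n)) measure)"
      unfolding borel_prod[symmetric] by measurable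
    have gF: "integrable (Q \<Otimes>\<^sub>M Q) (\<lambda>z. g (snd (F j z) $ l))" for j
    proof (cases j)
      case None
      then show ?thesis using int1(1)[OF gi] by (simp add: F_snd)
    next
      case (Some i)
      then show ?thesis using int1(1)[OF gi] int1(3)[OF gi] by (cases "l = i") (simp_all add: F_snd)
    qed
    show "integrable \<gamma> (\<lambda>z. g (snd z $ l))" by (rule \<gamma>i[OF gm gF])
    have "(\<integral>z. W (Some i) z * g (snd (F (Some i) z) $ l) \<partial>(Q \<Otimes>\<^sub>M Q)) = (\<integral>w. \<kappa> i w * g (Y w $ l) \<partial>Q)" for i
      using kfst[OF gi] ksnd[OF gi] by (cases "l = i") (auto simp: W_def F_snd)
    then show "(\<integral>z. g (snd z $ l) \<partial>\<gamma>) = (\<integral>w. g (Y w $ l) \<partial>Q)"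
      unfolding \<gamma>e[OF gm gF] opt F_snd(1) using W_None[OF gi] by simp
  qed
  have \<gamma>1: "prob_space \<gamma>"
  proof -
    have 1: "integrable Q (\<lambda>w. 1 :: real)" by simp
    have "integrable \<gamma> (\<lambda>z. 1 :: real)" by (rule \<gamma>X(1)[OF _ 1]) simp
    moreover have "(\<integral>z. (1::real) \<partial>\<gamma>) = (\<integral>w. 1 \<partial>Q)" by (rule \<gamma>X(2)[OF _ 1]) simp
    then have "(\<integral>z. (1::real) \<partial>\<gamma>) = 1" by (simp only: Q.prob_space lebesgue_integral_const) simp
    ultimately have "(\<integral>\<^sup>+z. ennreal 1 \<partial>\<gamma>) = ennreal 1"
      by (subst nn_integral_eq_integral) auto
    then show ?thesis by (intro prob_spaceI) simp
  qed
  interpret \<gamma>: prob_space \<gamma> by (rule \<gamma>1)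
  have fm[measurable]: "(\<lambda>z. fst z $ i) \<in> borel_measurable \<gamma>" "(\<lambda>z. snd z $ i) \<in> borel_measurable \<gamma>" for i
    unfolding measurable_cong_sets[OF \<gamma>s refl] borel_prod[symmetric] by measurable
  have ind_i: "integrable Q (\<lambda>w. indicator A (h w) :: real)"
    if [measurable]: "A \<in> sets borel" "h \<in> borel_measurable Q" for A :: "'c::topological_space set" and h
    by (rule Q.integrable_const_bound[where B=1]) (auto simp: indicator_def)
  have margX: "distr \<gamma> borel (\<lambda>z. fst z $ i) = distr Q borel (\<lambda>w. X w $ i)" for i
    using ind_i[of _ "\<lambda>w. X w $ i"] by (intro distr_eqI[OF \<gamma>1 Q.prob_space_axioms] \<gamma>X(2)[of "\<lambda>x. indicator _ (x $ i)"]) auto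
  have margY: "distr \<gamma> borel (\<lambda>z. snd z $ i) = distr Q borel (\<lambda>w. Y w $ i)" for i
    using ind_i[of _ "\<lambda>w. Y w $ i"] by (intro distr_eqI[OF \<gamma>1 Q.prob_space_axioms] \<gamma>Y(2)[of "indicator _"]) auto
  have M: "(\<integral>z. indicator A (fst z) * (snd z $ i - fst z $ i) \<partial>\<gamma>) = 0"
    if A[measurable]: "A \<in> sets borel" for A i
  proof -
    define g where "g z = indicator A (fst z) * (snd z $ i - fst z $ i)" for z :: "(real ^ 'n) \<times> (real ^ 'n)"
    have gm: "g \<in> borel_measurable borel"
      unfolding g_def borel_prod[symmetric] by measurable
    have iXA: "integrable Q (\<lambda>w. indicator A (X w) * f w)" if f: "integrable Q f" for f :: "_ \<Rightarrow> real"
      by (rule Bochner_Integration.integrable_bound[OF f])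
        (use borel_measurable_integrable[OF f] in \<open>auto simp: indicator_def\<close>)
    define f where "f w = indicator A (X w) * (Y w $ i - X w $ i)" for w
    have f: "integrable Q f" unfolding f_def using iX iY by (intro iXA) auto
    define h where "h z = k i (fst z) (snd z) * (Y (snd z) $ i - Y (fst z) $ i) * indicator A (X (fst z))" for z
    have gF: "g (F j z) = f (fst z) + (if j = Some i then indicator A (X (fst z)) * (Y (snd z) $ i - Y (fst z) $ i) else 0)" for j z
      by (cases j) (auto simp: g_def f_def F_fst F_snd algebra_simps)
    have hi0: "integrable (Q \<Otimes>\<^sub>M Q) (\<lambda>z. indicator A (X (fst z)) * (Y (snd z) $ i - Y (fst z) $ i))"
    proof (rule Bochner_Integration.integrable_bound)
      show "integrable (Q \<Otimes>\<^sub>M Q) (\<lambda>z. Y (snd z) $ i - Y (fst z) $ i)"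
        using int1(1,3)[OF iY[of i]] by simp
    qed (auto simp: indicator_def)
    have hi: "integrable (Q \<Otimes>\<^sub>M Q) h" using ki[OF hi0, of i] by (simp add: h_def[abs_def] mult_ac)
    have gi: "integrable (Q \<Otimes>\<^sub>M Q) (\<lambda>z. g (F j z))" for j
      unfolding gF using int1(1)[OF f] hi0 by (cases "j = Some i") simp_all
    have "(\<integral>z. g z \<partial>\<gamma>) = (\<integral>w. f w \<partial>Q) + (\<integral>z. h z \<partial>(Q \<Otimes>\<^sub>M Q))"
    proof -
      have "(\<integral>z. W (Some l) z * g (F (Some l) z) \<partial>(Q \<Otimes>\<^sub>M Q))
          = (\<integral>w. \<kappa> l w * f w \<partial>Q) + (if l = i then \<integral>z. h z \<partial>(Q \<Otimes>\<^sub>M Q) else 0)" for l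
      proof -
        have "(\<integral>z. W (Some l) z * g (F (Some l) z) \<partial>(Q \<Otimes>\<^sub>M Q))
          = (\<integral>z. k l (fst z) (snd z) * f (fst z) + (if l = i then h z else 0) \<partial>(Q \<Otimes>\<^sub>M Q))"
          unfolding gF by (intro Bochner_Integration.integral_cong) (auto simp: W_def h_def algebra_simps)
        also have "\<dots> = (\<integral>w. \<kappa> l w * f w \<partial>Q) + (if l = i then \<integral>z. h z \<partial>(Q \<Otimes>\<^sub>M Q) else 0)"
          using kfst[OF f, of l] ki[OF int1(1)[OF f], of l] hi by (cases "l = i") simp_all
        finally show ?thesis .
      qed
      then show ?thesis unfolding \<gamma>e[OF gm gi] opt
        using W_None[OF f] by (simp add: gF sum.distrib)
    qed
    also have "(\<integral>z. h z \<partial>(Q \<Otimes>\<^sub>M Q)) = (\<integral>w. indicator A (X w) * (p i w - q i w) \<partial>Q)"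
    proof -
      have "h (w, w') = indicator A (X w) * ((p i w * q i w' - q i w * p i w') / e i)" for w w'
        using kmove[of i w w'] by (simp add: h_def)
      then have "(\<integral>w'. h (w, w') \<partial>Q) = indicator A (X w) * ((p i w * e i - q i w * e i) / e i)" for w
        using ip iq by (simp add: eq e_def[symmetric])
      then have "(\<integral>w'. h (w, w') \<partial>Q) = indicator A (X w) * (p i w - q i w) * (e i / e i)" for w
        by (simp add: left_diff_distrib[symmetric])
      then have "(\<integral>z. h z \<partial>(Q \<Otimes>\<^sub>M Q)) = (\<integral>w. indicator A (X w) * (p i w - q i w) * (e i / e i) \<partial>Q)"
        by (subst QQ.integral_fst'[OF hi, symmetric]) simp
      \<comment> \<open>If \<open>e i = 0\<close>, the quotient \<open>e i / e i\<close> is 0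
        instead of 1, but \<open>p i\<close> and \<open>q i\<close> vanish almost
        everywhere.\<close>
      also have "\<dots> = (\<integral>w. indicator A (X w) * (p i w - q i w) \<partial>Q)"
      proof (cases "e i = 0")
        case True
        have "AE w in Q. p i w = 0" "AE w in Q. q i w = 0"
          using integral_nonneg_eq_0_iff_AE[OF ip[of i]] integral_nonneg_eq_0_iff_AE[OF iq[of i]] p0 q0 True eq
          by (auto simp: e_def)
        then show ?thesis using True by (intro integral_cong_AE) auto
      qed simp
      finally show ?thesis .
    qed
    also have "(\<integral>w. f w \<partial>Q) + (\<integral>w. indicator A (X w) * (p i w - q i w) \<partial>Q)
        = (\<integral>w. indicator A (X w) * (Y w $ i + p i w - q i w - X w $ i) \<partial>Q)"
      using f iXA[of "\<lambda>w. p i w - q i w"] ip iq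
      by (subst Bochner_Integration.integral_add[symmetric]) (auto simp: f_def algebra_simps)
    also have "\<dots> = 0" by (rule mart[OF A])
    finally show ?thesis by (simp add: g_def)
  qed
  \<comment> \<open>The norm is 1-Lipschitz, so an exchange costs at most the distance
    \<open>D i\<close>. As the rate is inverse to that distance, the expected cost in coordinate
    \<open>i\<close> is at most \<open>2 * e i\<close>, however far apart the exchanged values
    are.\<close>
  have cost: "(\<integral>w. norm (X w - Y w) \<partial>Q) - 2 * (\<Sum>i\<in>UNIV. \<integral>w. p i w \<partial>Q) \<le> (\<integral>z. norm (fst z - snd z) \<partial>\<gamma>)"
  proof -
    define g where "g z = norm (fst z - snd z)" for z :: "(real ^ 'n) \<times> (real ^ 'n)"
    have gm: "g \<in> borel_measurable borel"
      unfolding g_def borel_prod[symmetric] by measurable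
    define f where "f w = norm (X w - Y w)" for w
    have f: "integrable Q f"
      unfolding f_def using iX iY by (intro integrable_norm_diff) auto
    have gNone: "g (F None z) = f (fst z)" for z by (simp add: g_def f_def F_def)
    have gSome: "\<bar>g (F (Some i) z) - f (fst z)\<bar> \<le> \<bar>Y (snd z) $ i - Y (fst z) $ i\<bar>" for i z
    proof -
      have tri: "\<bar>norm (x - (y + v)) - norm (x - y)\<bar> \<le> norm v" for x y v :: "real ^ 'n"
        using norm_triangle_ineq3[of "x - (y + v)" "x - y"] by simp
      have "\<bar>g (F (Some i) z) - f (fst z)\<bar> \<le> norm ((Y (snd z) $ i - Y (fst z) $ i) *\<^sub>R axis i (1::real) :: real ^ 'n)"
        using tri[of "X (fst z)" "Y (fst z)" "(Y (snd z) $ i - Y (fst z) $ i) *\<^sub>R axis i 1"]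
        by (simp add: g_def f_def F_def del: norm_scaleR)
      then show ?thesis by (simp add: norm_axis_1)
    qed
    define D where "D i z = \<bar>Y (snd z) $ i - Y (fst z) $ i\<bar>" for i z
    have Di: "integrable (Q \<Otimes>\<^sub>M Q) (D i)" for i
      unfolding D_def using int1(1,3)[OF iY[of i]] by simp
    have gi: "integrable (Q \<Otimes>\<^sub>M Q) (\<lambda>z. g (F j z))" for j
    proof (cases j)
      case None then show ?thesis using int1(1)[OF f] by (simp add: gNone)
    next
      case (Some i)
      show ?thesis
      proof (rule Bochner_Integration.integrable_bound)
        show "integrable (Q \<Otimes>\<^sub>M Q) (\<lambda>z. f (fst z) + D i z)" using int1(1)[OF f] Di by simp
        show "(\<lambda>z. g (F j z)) \<in> borel_measurable (Q \<Otimes>\<^sub>M Q)"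
          using measurable_compose[OF Fm gm] .
        show "AE z in Q \<Otimes>\<^sub>M Q. norm (g (F j z)) \<le> norm (f (fst z) + D i z)"
        proof (rule AE_I2)
          fix z
          show "norm (g (F j z)) \<le> norm (f (fst z) + D i z)"
            using gSome[of i z] norm_ge_zero[of "X (fst z) - Y (fst z)"]
            unfolding Some D_def f_def g_def by simp
        qed
      qed
    qed
    have kD: "(\<integral>z. k i (fst z) (snd z) * D i z \<partial>(Q \<Otimes>\<^sub>M Q)) \<le> 2 * e i" for i
    proof -
      have pq_i: "integrable (Q \<Otimes>\<^sub>M Q) (\<lambda>z. p i (fst z) * q i (snd z) + q i (fst z) * p i (snd z))"
      proof (rule QQ.P.integrable_const_bound)
        show "AE z in Q \<Otimes>\<^sub>M Q. norm (p i (fst z) * q i (snd z) + q i (fst z) * p i (snd z))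
            \<le> ((b i - a i) / d) * ((b i - a i) / d) + ((b i - a i) / d) * ((b i - a i) / d)"
        proof (rule AE_I2)
          fix z
          have "0 \<le> p i (fst z) * q i (snd z) + q i (fst z) * p i (snd z)" using p0 q0 by simp
          moreover have "p i (fst z) * q i (snd z) + q i (fst z) * p i (snd z)
              \<le> ((b i - a i) / d) * ((b i - a i) / d) + ((b i - a i) / d) * ((b i - a i) / d)"
            using p0 q0 pB qB ab[of i] d by (intro add_mono mult_mono) auto
          ultimately show "norm (p i (fst z) * q i (snd z) + q i (fst z) * p i (snd z))
            \<le> ((b i - a i) / d) * ((b i - a i) / d) + ((b i - a i) / d) * ((b i - a i) / d)" by simp
        qed
      qed measurable
      have "(\<integral>z. k i (fst z) (snd z) * D i z \<partial>(Q \<Otimes>\<^sub>M Q))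
          \<le> (\<integral>z. (p i (fst z) * q i (snd z) + q i (fst z) * p i (snd z)) / e i \<partial>(Q \<Otimes>\<^sub>M Q))"
        using ki[OF Di[of i], of i] pq_i kmove_abs by (intro integral_mono) (auto simp: D_def)
      also have "\<dots> = (\<integral>w. (p i w * e i + q i w * e i) / e i \<partial>Q)"
        using ip iq pq_i by (subst QQ.integral_fst'[symmetric]) (auto simp: eq e_def[symmetric])
      also have "\<dots> = (e i * e i + e i * e i) / e i"
        using ip iq by (simp add: eq e_def[symmetric])
      also have "\<dots> \<le> 2 * e i" using e0[of i] by (cases "e i = 0") auto
      finally show ?thesis .
    qed
    have "(\<integral>w. \<kappa> i w * f w \<partial>Q) - 2 * e i \<le> (\<integral>z. W (Some i) z * g (F (Some i) z) \<partial>(Q \<Otimes>\<^sub>M Q))" for i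
    proof -
      have "(\<integral>w. \<kappa> i w * f w \<partial>Q) - 2 * e i
          \<le> (\<integral>z. k i (fst z) (snd z) * f (fst z) - k i (fst z) (snd z) * D i z \<partial>(Q \<Otimes>\<^sub>M Q))"
        using kD[of i] kfst[OF f, of i] ki[OF int1(1)[OF f], of i] ki[OF Di[of i], of i] by simp
      also have "\<dots> \<le> (\<integral>z. k i (fst z) (snd z) * g (F (Some i) z) \<partial>(Q \<Otimes>\<^sub>M Q))"
      proof (rule integral_mono)
        show "k i (fst z) (snd z) * f (fst z) - k i (fst z) (snd z) * D i z
            \<le> k i (fst z) (snd z) * g (F (Some i) z)" for z
          using gSome[of i z] k0[of i "fst z" "snd z"] unfolding D_def right_diff_distrib[symmetric]
          by (intro mult_left_mono) linarith+
      qed (use ki[OF int1(1)[OF f], of i] ki[OF Di[of i], of i] ki[OF gi[of "Some i"], of i] in auto)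
      finally show ?thesis by (simp add: W_def)
    qed
    then have "(\<Sum>i\<in>UNIV. (\<integral>w. \<kappa> i w * f w \<partial>Q) - 2 * e i)
        \<le> (\<Sum>i\<in>UNIV. \<integral>z. W (Some i) z * g (F (Some i) z) \<partial>(Q \<Otimes>\<^sub>M Q))"
      by (intro sum_mono) auto
    then have "(\<integral>w. f w \<partial>Q) - 2 * (\<Sum>i\<in>UNIV. e i) \<le> (\<integral>z. g z \<partial>\<gamma>)"
      unfolding \<gamma>e[OF gm gi] opt using W_None[OF f]
      by (simp add: gNone sum_subtractf sum_distrib_left)
    then show ?thesis by (simp add: f_def g_def e_def)
  qed
  show ?thesis
    using \<gamma>1 \<gamma>s margX margY M cost by blast
qed

section \<open>Disintegrations and martingale couplings\<close>

locale disintegrated =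
  fixes \<pi> :: "('a::second_countable_topology \<times> 'b::second_countable_topology) measure"
    and K :: "'a \<Rightarrow> 'b measure"
  assumes prob_space_\<pi>: "prob_space \<pi>" and sets_\<pi>: "sets \<pi> = sets borel"
    and disint: "disintegration \<pi> K"
begin

sublocale prob_space \<pi> by (rule prob_space_\<pi>)

abbreviation \<rho> :: "'a measure" where "\<rho> \<equiv> distr \<pi> borel fst"

lemma sets_\<pi>_pair [measurable_cong]: "sets \<pi> = sets (borel \<Otimes>\<^sub>M borel)"
  unfolding sets_\<pi> borel_prod ..

lemma space_\<pi>: "space \<pi> = UNIV"
  using sets_eq_imp_space_eq[OF sets_\<pi>] by simp

lemma K_prob_algebra: "K \<in> borel \<rightarrow>\<^sub>M prob_algebra borel"
  using disint by (simp add: disintegration_def)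

lemma K_subprob_algebra [measurable]: "K \<in> borel \<rightarrow>\<^sub>M subprob_algebra borel"
  by (rule measurable_prob_algebraD[OF K_prob_algebra])

lemma prob_space_K: "prob_space (K x)"
  and sets_K [measurable_cong, simp]: "sets (K x) = sets borel"
  using measurable_space[OF K_prob_algebra, of x] by (auto simp: space_prob_algebra)

lemma space_K [simp]: "space (K x) = UNIV"
  using sets_eq_imp_space_eq[OF sets_K] by simp

sublocale K: prob_space "K x" for x by (rule prob_space_K)

lemma measure_K_UNIV [simp]: "measure (K x) UNIV = 1"
  using K.prob_space[of x] by simp

lemma prob_space_\<rho>: "prob_space \<rho>"
  by (rule prob_space_distr) measurable

sublocale \<rho>: prob_space \<rho> by (rule prob_space_\<rho>)

section \<open>Measurability and Fubini for the kernel\<close>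

lemma nn_integral_K_measurable:
  assumes "g \<in> borel_measurable (borel \<Otimes>\<^sub>M borel)"
  shows "(\<lambda>x. \<integral>\<^sup>+y. g (x, y) \<partial>K x) \<in> borel_measurable borel"
  by (rule nn_integral_measurable_subprob_algebra2) (use assms in auto)

text \<open>The integral is a difference of two nonnegative integrals only where the section is
  integrable. That condition is itself measurable in \<open>x\<close>, and elsewhere the integral
  has the default value 0.\<close>

lemma integral_K_measurable:
  fixes g :: "'a \<times> 'b \<Rightarrow> real"
  assumes [measurable]: "g \<in> borel_measurable (borel \<Otimes>\<^sub>M borel)"
  shows "(\<lambda>x. \<integral>y. g (x, y) \<partial>K x) \<in> borel_measurable borel"
proof -
  have eq: "(\<integral>y. g (x, y) \<partial>K x) = (if (\<integral>\<^sup>+y. ennreal (norm (g (x, y))) \<partial>K x) < \<infinity>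
      then enn2real (\<integral>\<^sup>+y. ennreal (g (x, y)) \<partial>K x) - enn2real (\<integral>\<^sup>+y. ennreal (- g (x, y)) \<partial>K x) else 0)" for x
  proof (cases "integrable (K x) (\<lambda>y. g (x, y))")
    case True
    then show ?thesis
      using real_lebesgue_integral_def[OF True] by (auto simp: integrable_iff_bounded)
  next
    case False
    then have "\<not> (\<integral>\<^sup>+y. ennreal (norm (g (x, y))) \<partial>K x) < \<infinity>"
      by (auto simp: integrable_iff_bounded)
    then show ?thesis using False by (simp add: not_integrable_integral_eq)
  qed
  note [measurable] = nn_integral_K_measurable[of "\<lambda>z. ennreal (norm (g z))"]
    nn_integral_K_measurable[of "\<lambda>z. ennreal (g z)"] nn_integral_K_measurable[of "\<lambda>z. ennreal (- g z)"]
  show ?thesis unfolding eq by measurable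
qed

lemma integrable_K_measurable:
  fixes g :: "'a \<times> 'b \<Rightarrow> real"
  assumes [measurable]: "g \<in> borel_measurable (borel \<Otimes>\<^sub>M borel)"
  shows "{x. integrable (K x) (\<lambda>y. g (x, y))} \<in> sets borel"
proof -
  have "(\<lambda>x. \<integral>\<^sup>+y. ennreal (norm (g (x, y))) \<partial>K x) \<in> borel_measurable borel"
    by (rule nn_integral_K_measurable[of "\<lambda>z. ennreal (norm (g z))"]) measurable
  then have "{x \<in> space borel. (\<integral>\<^sup>+y. ennreal (norm (g (x, y))) \<partial>K x) < \<infinity>} \<in> sets borel"
    by measurable
  moreover have "integrable (K x) (\<lambda>y. g (x, y)) \<longleftrightarrow> (\<integral>\<^sup>+y. ennreal (norm (g (x, y))) \<partial>K x) < \<infinity>" for x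
    by (auto simp: integrable_iff_bounded)
  ultimately show ?thesis by simp
qed

text \<open>A disintegration prescribes \<open>\<pi>\<close> on rectangles only. These form a
  generator stable under intersection, so \<open>\<pi>\<close> is a composition of
  \<open>\<rho>\<close> with the kernel, and the integral formulas for such compositions become
  available.\<close>

lemma \<pi>_eq_bind: "\<pi> = \<rho> \<bind> (\<lambda>x. distr (K x) (borel \<Otimes>\<^sub>M borel) (\<lambda>y. (x, y)))"
proof -
  define N where "N x = distr (K x) (borel \<Otimes>\<^sub>M borel) (\<lambda>y. (x, y))" for x
  have N: "N \<in> \<rho> \<rightarrow>\<^sub>M subprob_algebra (borel \<Otimes>\<^sub>M borel)"
    unfolding N_def by (rule measurable_distr2[where M=borel]) auto
  have sb: "sets (\<rho> \<bind> N) = sets (borel \<Otimes>\<^sub>M borel)"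
    by (rule sets_bind) (auto simp: N_def)
  let ?E = "{A \<times> B |A B. A \<in> sets (borel :: 'a measure) \<and> B \<in> sets (borel :: 'b measure)}"
  have "\<pi> = \<rho> \<bind> N"
  proof (rule measure_eqI_generator_eq[OF Int_stable_pair_measure_generator, where A="\<lambda>_. UNIV" and \<Omega>=UNIV])
    show "sets \<pi> = sigma_sets UNIV ?E" "sets (\<rho> \<bind> N) = sigma_sets UNIV ?E"
      unfolding sets_\<pi>_pair sb by (simp_all add: sets_pair_measure)
    show "range (\<lambda>_::nat. UNIV) \<subseteq> ?E"
      by (auto intro!: exI[of _ UNIV])
    fix X assume "X \<in> ?E"
    then obtain A B where X: "X = A \<times> B" and [measurable]: "A \<in> sets borel" "B \<in> sets borel" by auto
    have "emeasure (\<rho> \<bind> N) X = (\<integral>\<^sup>+x. emeasure (N x) X \<partial>\<rho>)"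
      unfolding X by (intro emeasure_bind[OF _ N]) auto
    also have "\<dots> = (\<integral>\<^sup>+x\<in>A. emeasure (K x) B \<partial>\<rho>)"
      unfolding X N_def by (intro nn_integral_cong) (auto simp: emeasure_distr indicator_def vimage_def)
    also have "\<dots> = emeasure \<pi> X"
      using disint unfolding X disintegration_def by auto
    finally show "emeasure \<pi> X = emeasure (\<rho> \<bind> N) X" by simp
  qed auto
  then show ?thesis by (simp add: N_def[abs_def])
qed

lemma nn_integral_\<pi>:
  assumes [measurable]: "g \<in> borel_measurable (borel \<Otimes>\<^sub>M borel)"
  shows "(\<integral>\<^sup>+z. g z \<partial>\<pi>) = (\<integral>\<^sup>+x. \<integral>\<^sup>+y. g (x, y) \<partial>K x \<partial>\<rho>)"
proof -
  have N: "(\<lambda>x. distr (K x) (borel \<Otimes>\<^sub>M borel) (\<lambda>y. (x, y))) \<in> \<rho> \<rightarrow>\<^sub>M subprob_algebra (borel \<Otimes>\<^sub>M borel)"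
    by (rule measurable_distr2[where M=borel]) auto
  have "(\<integral>\<^sup>+z. g z \<partial>\<pi>) = (\<integral>\<^sup>+z. g z \<partial>(\<rho> \<bind> (\<lambda>x. distr (K x) (borel \<Otimes>\<^sub>M borel) (\<lambda>y. (x, y)))))"
    by (simp only: \<pi>_eq_bind[symmetric])
  also have "\<dots> = (\<integral>\<^sup>+x. \<integral>\<^sup>+y. g (x, y) \<partial>K x \<partial>\<rho>)"
    by (subst nn_integral_bind[OF _ N]) (simp_all add: nn_integral_distr)
  finally show ?thesis .
qed

lemma AE_\<pi>:
  assumes P: "Measurable.pred (borel \<Otimes>\<^sub>M borel) P"
  shows "(AE z in \<pi>. P z) \<longleftrightarrow> (AE x in \<rho>. AE y in K x. P (x, y))"
proof -
  note [measurable] = P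
  have "(AE z in \<pi>. P z) \<longleftrightarrow> (\<integral>\<^sup>+z. indicator {z. \<not> P z} z \<partial>\<pi>) = 0"
    by (subst nn_integral_0_iff_AE) (auto simp: indicator_def)
  also have "\<dots> \<longleftrightarrow> (\<integral>\<^sup>+x. \<integral>\<^sup>+y. indicator {z. \<not> P z} (x, y) \<partial>K x \<partial>\<rho>) = 0"
    by (subst nn_integral_\<pi>) simp_all
  also have "\<dots> \<longleftrightarrow> (AE x in \<rho>. (\<integral>\<^sup>+y. indicator {z. \<not> P z} (x, y) \<partial>K x) = 0)"
    by (subst nn_integral_0_iff_AE) (simp_all add: nn_integral_K_measurable)
  also have "\<dots> \<longleftrightarrow> (AE x in \<rho>. AE y in K x. P (x, y))"
    by (subst nn_integral_0_iff_AE) (auto simp: indicator_def)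
  finally show ?thesis .
qed

lemma
  fixes g :: "'a \<times> 'b \<Rightarrow> real"
  assumes g: "integrable \<pi> g"
  shows AE_integrable_K: "AE x in \<rho>. integrable (K x) (\<lambda>y. g (x, y))"
    and integrable_integral_K: "integrable \<rho> (\<lambda>x. \<integral>y. g (x, y) \<partial>K x)"
    and integral_\<pi>: "(\<integral>z. g z \<partial>\<pi>) = (\<integral>x. \<integral>y. g (x, y) \<partial>K x \<partial>\<rho>)"
proof -
  have [measurable]: "g \<in> borel_measurable (borel \<Otimes>\<^sub>M borel)"
    using g borel_measurable_integrable measurable_cong_sets[OF sets_\<pi>_pair refl] by blast
  have fin: "(\<integral>\<^sup>+x. \<integral>\<^sup>+y. ennreal (norm (g (x, y))) \<partial>K x \<partial>\<rho>) < \<infinity>"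
    using g by (subst nn_integral_\<pi>[symmetric]) (auto simp: integrable_iff_bounded)
  have "AE x in \<rho>. (\<integral>\<^sup>+y. ennreal (norm (g (x, y))) \<partial>K x) \<noteq> \<infinity>"
  proof (rule nn_integral_PInf_AE[rotated])
    show "(\<lambda>x. \<integral>\<^sup>+y. ennreal (norm (g (x, y))) \<partial>K x) \<in> borel_measurable \<rho>"
      using nn_integral_K_measurable[of "\<lambda>z. ennreal (norm (g z))"] by simp
  qed (use fin in simp)
  then show AE: "AE x in \<rho>. integrable (K x) (\<lambda>y. g (x, y))"
    by eventually_elim (auto simp: integrable_iff_bounded less_top)
  have [measurable]: "(\<lambda>x. \<integral>y. g (x, y) \<partial>K x) \<in> borel_measurable borel"
    by (rule integral_K_measurable) measurable
  show "integrable \<rho> (\<lambda>x. \<integral>y. g (x, y) \<partial>K x)"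
  proof (rule integrableI_bounded)
    have "(\<integral>\<^sup>+x. ennreal (norm (\<integral>y. g (x, y) \<partial>K x)) \<partial>\<rho>) \<le> (\<integral>\<^sup>+x. \<integral>\<^sup>+y. ennreal (norm (g (x, y))) \<partial>K x \<partial>\<rho>)"
    proof (rule nn_integral_mono_AE)
      show "AE x in \<rho>. ennreal (norm (\<integral>y. g (x, y) \<partial>K x)) \<le> (\<integral>\<^sup>+y. ennreal (norm (g (x, y))) \<partial>K x)"
        using AE by eventually_elim (rule integral_norm_bound_ennreal)
    qed
    then show "(\<integral>\<^sup>+x. ennreal (norm (\<integral>y. g (x, y) \<partial>K x)) \<partial>\<rho>) < \<infinity>"
      using fin by (rule order.strict_trans1)
  qed simp
  \<comment> \<open>Taking \<open>s\<close> to be 1 or -1 treats positive and negative parts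
    together.\<close>
  have part: "integrable \<rho> (\<lambda>x. enn2real (\<integral>\<^sup>+y. ennreal (s * g (x, y)) \<partial>K x))
      \<and> enn2real (\<integral>\<^sup>+z. ennreal (s * g z) \<partial>\<pi>) = (\<integral>x. enn2real (\<integral>\<^sup>+y. ennreal (s * g (x, y)) \<partial>K x) \<partial>\<rho>)"
    if s: "\<bar>s\<bar> = 1" for s
  proof -
    have m: "(\<lambda>x. \<integral>\<^sup>+y. ennreal (s * g (x, y)) \<partial>K x) \<in> borel_measurable borel"
      by (rule nn_integral_K_measurable[of "\<lambda>z. ennreal (s * g z)"]) measurable
    note [measurable] = m
    have le: "ennreal (s * g z) \<le> ennreal (norm (g z))" for z
    proof -
      have "s * g z \<le> \<bar>s * g z\<bar>" by simp
      then show ?thesis using s by (intro ennreal_leI) (simp add: abs_mult)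
    qed
    have lt: "(\<integral>\<^sup>+x. \<integral>\<^sup>+y. ennreal (s * g (x, y)) \<partial>K x \<partial>\<rho>) < \<infinity>"
      by (rule order.strict_trans1[OF _ fin]) (intro nn_integral_mono le)
    then have "AE x in \<rho>. (\<integral>\<^sup>+y. ennreal (s * g (x, y)) \<partial>K x) \<noteq> \<infinity>"
      by (intro nn_integral_PInf_AE) auto
    then have eq: "(\<integral>\<^sup>+x. ennreal (enn2real (\<integral>\<^sup>+y. ennreal (s * g (x, y)) \<partial>K x)) \<partial>\<rho>)
        = (\<integral>\<^sup>+x. \<integral>\<^sup>+y. ennreal (s * g (x, y)) \<partial>K x \<partial>\<rho>)"
      by (intro nn_integral_cong_AE) (auto elim!: eventually_mono simp: less_top)
    have i: "integrable \<rho> (\<lambda>x. enn2real (\<integral>\<^sup>+y. ennreal (s * g (x, y)) \<partial>K x))"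
      using lt eq by (intro integrableI_bounded) auto
    have "(\<integral>x. enn2real (\<integral>\<^sup>+y. ennreal (s * g (x, y)) \<partial>K x) \<partial>\<rho>) = enn2real (\<integral>\<^sup>+z. ennreal (s * g z) \<partial>\<pi>)"
      by (subst integral_eq_nn_integral) (simp_all add: eq nn_integral_\<pi>)
    then show ?thesis using i by simp
  qed
  have "(\<integral>z. g z \<partial>\<pi>) = enn2real (\<integral>\<^sup>+z. ennreal (g z) \<partial>\<pi>) - enn2real (\<integral>\<^sup>+z. ennreal (- g z) \<partial>\<pi>)"
    by (rule real_lebesgue_integral_def[OF g])
  also have "\<dots> = (\<integral>x. enn2real (\<integral>\<^sup>+y. ennreal (g (x, y)) \<partial>K x) - enn2real (\<integral>\<^sup>+y. ennreal (- g (x, y)) \<partial>K x) \<partial>\<rho>)"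
    using part[of 1] part[of "-1"] by simp
  also have "\<dots> = (\<integral>x. \<integral>y. g (x, y) \<partial>K x \<partial>\<rho>)"
  proof (rule integral_cong_AE)
    show "AE x in \<rho>. enn2real (\<integral>\<^sup>+y. ennreal (g (x, y)) \<partial>K x) - enn2real (\<integral>\<^sup>+y. ennreal (- g (x, y)) \<partial>K x)
        = (\<integral>y. g (x, y) \<partial>K x)"
      using AE by eventually_elim (simp add: real_lebesgue_integral_def)
    have "(\<lambda>x. \<integral>\<^sup>+y. ennreal (g (x, y)) \<partial>K x) \<in> borel_measurable borel"
      "(\<lambda>x. \<integral>\<^sup>+y. ennreal (- g (x, y)) \<partial>K x) \<in> borel_measurable borel"
      using nn_integral_K_measurable[of "\<lambda>z. ennreal (g z)"] nn_integral_K_measurable[of "\<lambda>z. ennreal (- g z)"] by simp_all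
    then show "(\<lambda>x. enn2real (\<integral>\<^sup>+y. ennreal (g (x, y)) \<partial>K x) - enn2real (\<integral>\<^sup>+y. ennreal (- g (x, y)) \<partial>K x)) \<in> borel_measurable \<rho>"
      by simp
  qed simp
  finally show "(\<integral>z. g z \<partial>\<pi>) = (\<integral>x. \<integral>y. g (x, y) \<partial>K x \<partial>\<rho>)" .
qed

text \<open>Integrating over \<open>y\<close> first, with \<open>x\<close> and the auxiliary
  variable \<open>r\<close> fixed, is possible because \<open>r\<close> is independent of
  \<open>(x, y)\<close>. One null set of points \<open>x\<close> has to serve all \<open>r\<close>,
  hence the quantifier inside \<open>AE\<close>.\<close>

lemma integral_pair_eq_0:
  fixes f :: "('a \<times> 'b) \<times> 'c \<Rightarrow> real"
  assumes "sigma_finite_measure U" and f: "integrable (\<pi> \<Otimes>\<^sub>M U) f"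
    and 0: "AE x in \<rho>. \<forall>r. (\<integral>y. f ((x, y), r) \<partial>K x) = 0"
  shows "(\<integral>z. f z \<partial>(\<pi> \<Otimes>\<^sub>M U)) = 0"
proof -
  interpret U: sigma_finite_measure U by fact
  interpret P: pair_sigma_finite \<pi> U ..
  have "(\<integral>z. f z \<partial>(\<pi> \<Otimes>\<^sub>M U)) = (\<integral>r. \<integral>z. f (z, r) \<partial>\<pi> \<partial>U)"
    using P.integral_snd[of "\<lambda>z r. f (z, r)"] f by (simp add: split_def)
  also have "\<dots> = (\<integral>r. 0 \<partial>U)"
  proof (rule integral_cong_AE)
    have "AE r in U. integrable \<pi> (\<lambda>z. f (z, r))"
      using P.AE_integrable_snd[of "\<lambda>z r. f (z, r)"] f by (simp add: split_def)
    then show "AE r in U. (\<integral>z. f (z, r) \<partial>\<pi>) = 0"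
    proof eventually_elim
      case (elim r)
      have "(\<integral>z. f (z, r) \<partial>\<pi>) = (\<integral>x. \<integral>y. f ((x, y), r) \<partial>K x \<partial>\<rho>)"
        by (rule integral_\<pi>[OF elim])
      also have "\<dots> = 0"
        using 0 by (intro integral_eq_zero_AE) auto
      finally show ?case .
    qed
    have fm[measurable]: "f \<in> borel_measurable (\<pi> \<Otimes>\<^sub>M U)" using f by auto
    show "(\<lambda>r. \<integral>z. f (z, r) \<partial>\<pi>) \<in> borel_measurable U" by measurable
  qed simp
  finally show ?thesis by simp
qed

lemma integrable_K_bounded:
  fixes f :: "'b \<Rightarrow> real"
  assumes "f \<in> borel_measurable borel" and "\<And>y. \<bar>f y\<bar> \<le> C"
  shows "integrable (K x) f"
  by (rule K.integrable_const_bound[where B=C]) (use assms in auto)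

lemma integrable_K_bounded_mult:
  fixes f g :: "'b \<Rightarrow> real"
  assumes "integrable (K x) g" and "f \<in> borel_measurable borel" and "\<And>y. \<bar>f y\<bar> \<le> C"
  shows "integrable (K x) (\<lambda>y. f y * g y)"
  by (rule integrable_bounded_mult[where C=C]) (use assms in auto)

end

text \<open>The events generated by \<open>fst\<close> are the preimages of Borel sets, so the
  conditional expectation can be tested on these. In this form the martingale property is a family
  of integral identities, which can be verified for measures that are known only through their
  integrals.\<close>

lemma vec_cond_exp_fst_iff:
  fixes \<gamma> :: "((real ^ 'n::finite) \<times> (real ^ 'n)) measure"
  assumes "prob_space \<gamma>" and s: "sets \<gamma> = sets borel"
    and i1: "\<And>i. integrable \<gamma> (\<lambda>z. fst z $ i)" and i2: "\<And>i. integrable \<gamma> (\<lambda>z. snd z $ i)"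
  shows "(AE z in \<gamma>. vec_cond_exp \<gamma> (vimage_algebra UNIV fst borel) snd z = fst z) \<longleftrightarrow>
    (\<forall>i. \<forall>A\<in>sets borel. (\<integral>z. indicator A (fst z) * (snd z $ i - fst z $ i) \<partial>\<gamma>) = 0)"
proof -
  interpret \<gamma>: prob_space \<gamma> by fact
  let ?F = "vimage_algebra UNIV fst borel :: ((real ^ 'n) \<times> (real ^ 'n)) measure"
  have sp: "space \<gamma> = UNIV" using sets_eq_imp_space_eq[OF s] by simp
  have s': "sets \<gamma> = sets (borel \<Otimes>\<^sub>M borel)" unfolding s borel_prod ..
  note [measurable_cong] = s'
  have sF: "sets ?F = {fst -` A | A. A \<in> sets borel}"
    by (subst sets_vimage_algebra2) auto
  have "subalgebra \<gamma> ?F"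
    unfolding subalgebra_def
  proof (intro conjI subsetI)
    fix B assume "B \<in> sets ?F"
    then obtain A where A[measurable]: "A \<in> sets borel" and B: "B = fst -` A" unfolding sF by auto
    have "fst -` A \<inter> space \<gamma> \<in> sets \<gamma>" by measurable
    then show "B \<in> sets \<gamma>" by (simp add: B sp)
  qed (simp add: sp)
  then interpret F: finite_measure_subalgebra \<gamma> ?F by unfold_locales
  have cond: "(AE z in \<gamma>. real_cond_exp \<gamma> ?F (\<lambda>z. snd z $ i) z = fst z $ i) \<longleftrightarrow>
    (\<forall>A\<in>sets borel. (\<integral>z. indicator A (fst z) * (snd z $ i - fst z $ i) \<partial>\<gamma>) = 0)" for i
  proof -
    have ind: "(\<integral>z. indicator A (fst z) * (snd z $ i - fst z $ i) \<partial>\<gamma>)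
        = (\<integral>z\<in>fst -` A. snd z $ i \<partial>\<gamma>) - (\<integral>z\<in>fst -` A. fst z $ i \<partial>\<gamma>)"
      if [measurable]: "A \<in> sets borel" for A
    proof -
      have B: "fst -` A \<in> sets \<gamma>"
        using measurable_sets[of fst \<gamma> borel A] by (simp add: sp)
      have "(\<integral>z. indicator A (fst z) * (snd z $ i - fst z $ i) \<partial>\<gamma>)
          = (\<integral>z. indicator (fst -` A) z *\<^sub>R (snd z $ i) - indicator (fst -` A) z *\<^sub>R (fst z $ i) \<partial>\<gamma>)"
        by (intro Bochner_Integration.integral_cong) (auto simp: indicator_def)
      also have "\<dots> = (\<integral>z\<in>fst -` A. snd z $ i \<partial>\<gamma>) - (\<integral>z\<in>fst -` A. fst z $ i \<partial>\<gamma>)"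
        unfolding set_lebesgue_integral_def
        by (intro Bochner_Integration.integral_diff integrable_mult_indicator[OF B] i1 i2)
      finally show ?thesis .
    qed
    show ?thesis
    proof
      assume AE: "AE z in \<gamma>. real_cond_exp \<gamma> ?F (\<lambda>z. snd z $ i) z = fst z $ i"
      show "\<forall>A\<in>sets borel. (\<integral>z. indicator A (fst z) * (snd z $ i - fst z $ i) \<partial>\<gamma>) = 0"
      proof
        fix A :: "(real ^ 'n) set" assume A[measurable]: "A \<in> sets borel"
        have B: "fst -` A \<in> sets ?F" using A unfolding sF by auto
        have B'[measurable]: "fst -` A \<in> sets \<gamma>"
          using measurable_sets[of fst \<gamma> borel A] by (simp add: sp)
        have "(\<integral>z\<in>fst -` A. snd z $ i \<partial>\<gamma>) = (\<integral>z\<in>fst -` A. real_cond_exp \<gamma> ?F (\<lambda>z. snd z $ i) z \<partial>\<gamma>)"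
          by (rule F.real_cond_exp_intA[OF i2 B])
        also have "\<dots> = (\<integral>z\<in>fst -` A. fst z $ i \<partial>\<gamma>)"
          unfolding set_lebesgue_integral_def
          using AE i1[of i] by (intro integral_cong_AE) (auto elim!: eventually_mono)
        finally show "(\<integral>z. indicator A (fst z) * (snd z $ i - fst z $ i) \<partial>\<gamma>) = 0"
          by (simp add: ind[OF A])
      qed
    next
      assume 0: "\<forall>A\<in>sets borel. (\<integral>z. indicator A (fst z) * (snd z $ i - fst z $ i) \<partial>\<gamma>) = 0"
      show "AE z in \<gamma>. real_cond_exp \<gamma> ?F (\<lambda>z. snd z $ i) z = fst z $ i"
      proof (rule F.real_cond_exp_charact[OF _ i2 i1])
        fix B assume "B \<in> sets ?F"
        then obtain A where "A \<in> sets borel" "B = fst -` A" unfolding sF by auto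
        then show "(\<integral>z\<in>B. snd z $ i \<partial>\<gamma>) = (\<integral>z\<in>B. fst z $ i \<partial>\<gamma>)"
          using 0 ind[of A] by auto
      next
        have "fst \<in> ?F \<rightarrow>\<^sub>M (borel :: (real ^ 'n) measure)"
          by (rule measurable_vimage_algebra1) auto
        then show "(\<lambda>z. fst z $ i) \<in> borel_measurable ?F"
          by (rule measurable_compose) measurable
      qed
    qed
  qed
  have "(AE z in \<gamma>. vec_cond_exp \<gamma> ?F snd z = fst z) \<longleftrightarrow>
      (AE z in \<gamma>. \<forall>i. real_cond_exp \<gamma> ?F (\<lambda>z. snd z $ i) z = fst z $ i)"
    by (simp add: vec_cond_exp_def vec_eq_iff)
  also have "\<dots> \<longleftrightarrow> (\<forall>i. AE z in \<gamma>. real_cond_exp \<gamma> ?F (\<lambda>z. snd z $ i) z = fst z $ i)"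
    using AE_finite_all[of "UNIV :: 'n set" "\<lambda>z i. real_cond_exp \<gamma> ?F (\<lambda>z. snd z $ i) z = fst z $ i"]
    by (simp only: ball_UNIV finite)
  finally show ?thesis by (simp add: cond)
qed

text \<open>Integrability of the coordinates is inherited from the prescribed marginals, so
  \<open>vec_cond_exp_fst_iff\<close> applies to every competitor.\<close>

lemma VMT_iff:
  fixes \<mu> \<nu> :: "'n::finite \<Rightarrow> real measure"
  assumes i1: "\<And>i. integrable (\<mu> i) (\<lambda>x. x)" and i2: "\<And>i. integrable (\<nu> i) (\<lambda>x. x)"
  shows "\<gamma> \<in> VMT \<mu> \<nu> \<longleftrightarrow> prob_space \<gamma> \<and> sets \<gamma> = sets borel \<and>
    (\<forall>i. distr \<gamma> borel (\<lambda>z. fst z $ i) = \<mu> i) \<and> (\<forall>i. distr \<gamma> borel (\<lambda>z. snd z $ i) = \<nu> i) \<and>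
    (\<forall>i. \<forall>A\<in>sets borel. (\<integral>z. indicator A (fst z) * (snd z $ i - fst z $ i) \<partial>\<gamma>) = 0)"
    and VMT_integrable: "\<gamma> \<in> VMT \<mu> \<nu> \<Longrightarrow> integrable \<gamma> (\<lambda>z. fst z $ i)"
      "\<gamma> \<in> VMT \<mu> \<nu> \<Longrightarrow> integrable \<gamma> (\<lambda>z. snd z $ i)"
proof -
  have int: "integrable \<gamma> (\<lambda>z. fst z $ i) \<and> integrable \<gamma> (\<lambda>z. snd z $ i)"
    if s: "sets \<gamma> = sets borel" and m: "\<forall>i. distr \<gamma> borel (\<lambda>z. fst z $ i) = \<mu> i"
      "\<forall>i. distr \<gamma> borel (\<lambda>z. snd z $ i) = \<nu> i" for i
  proof -
    have s': "sets \<gamma> = sets (borel \<Otimes>\<^sub>M borel)" unfolding s borel_prod ..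
    note [measurable_cong] = s'
    have "integrable (distr \<gamma> borel (\<lambda>z. fst z $ i)) (\<lambda>x. x)" "integrable (distr \<gamma> borel (\<lambda>z. snd z $ i)) (\<lambda>x. x)"
      using m i1[of i] i2[of i] by simp_all
    from integrable_distr[OF _ this(1)] integrable_distr[OF _ this(2)] show ?thesis by simp
  qed
  show "integrable \<gamma> (\<lambda>z. fst z $ i)" if "\<gamma> \<in> VMT \<mu> \<nu>"
    using int that by (auto simp: VMT_def)
  show "integrable \<gamma> (\<lambda>z. snd z $ i)" if "\<gamma> \<in> VMT \<mu> \<nu>"
    using int that by (auto simp: VMT_def)
  show "\<gamma> \<in> VMT \<mu> \<nu> \<longleftrightarrow> prob_space \<gamma> \<and> sets \<gamma> = sets borel \<and>
    (\<forall>i. distr \<gamma> borel (\<lambda>z. fst z $ i) = \<mu> i) \<and> (\<forall>i. distr \<gamma> borel (\<lambda>z. snd z $ i) = \<nu> i) \<and>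
    (\<forall>i. \<forall>A\<in>sets borel. (\<integral>z. indicator A (fst z) * (snd z $ i - fst z $ i) \<partial>\<gamma>) = 0)"
    using vec_cond_exp_fst_iff[of \<gamma>] int unfolding VMT_def by blast
qed

section \<open>Martingale couplings and their conditional means\<close>

locale martingale_coupling = disintegrated \<pi> K
  for \<pi> :: "((real ^ 'n::finite) \<times> (real ^ 'n)) measure" and K +
  assumes integrable_X: "\<And>i. integrable \<pi> (\<lambda>z. fst z $ i)"
    and integrable_Y: "\<And>i. integrable \<pi> (\<lambda>z. snd z $ i)"
    and martingale: "\<And>i A. A \<in> sets borel \<Longrightarrow> (\<integral>z. indicator A (fst z) * (snd z $ i - fst z $ i) \<partial>\<pi>) = 0"
begin

text \<open>Conditions on tilts are later imposed at every point of this Borel set of full measure,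
  so that no new null set arises with each tilt.\<close>

definition centered :: "(real ^ 'n) set" where
  "centered = {x. \<forall>i. integrable (K x) (\<lambda>y. y $ i) \<and> (\<integral>y. y $ i \<partial>K x) = x $ i}"

lemma integrable_nth: "x \<in> centered \<Longrightarrow> integrable (K x) (\<lambda>y. y $ i)"
  and mean_nth: "x \<in> centered \<Longrightarrow> (\<integral>y. y $ i \<partial>K x) = x $ i"
  by (auto simp: centered_def)

lemma centered_measurable [measurable]: "centered \<in> sets borel"
proof -
  have [measurable]: "{x. integrable (K x) (\<lambda>y. y $ i)} \<in> sets borel" for i
    using integrable_K_measurable[of "\<lambda>z. snd z $ i"] by simp
  have [measurable]: "(\<lambda>x. \<integral>y. y $ i \<partial>K x) \<in> borel_measurable borel" for i
    using integral_K_measurable[of "\<lambda>z. snd z $ i"] by simp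
  have "centered = (\<Inter>i. {x. integrable (K x) (\<lambda>y. y $ i)} \<inter> {x \<in> space borel. (\<integral>y. y $ i \<partial>K x) = x $ i})"
    by (auto simp: centered_def)
  also have "\<dots> \<in> sets borel" by measurable
  finally show ?thesis .
qed

text \<open>An integrable function is determined almost everywhere by its integrals over Borel sets,
  and the martingale identity makes these vanish for the conditional mean of
  \<open>y $ i - x $ i\<close>.\<close>

lemma AE_centered: "AE x in \<rho>. x \<in> centered"
proof -
  have one: "AE x in \<rho>. integrable (K x) (\<lambda>y. y $ i) \<and> (\<integral>y. y $ i \<partial>K x) = x $ i" for i
  proof -
    define g where "g z = snd z $ i - fst z $ i" for z :: "(real ^ 'n) \<times> (real ^ 'n)"
    have g: "integrable \<pi> g" unfolding g_def using integrable_X integrable_Y by simp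
    have [measurable]: "g \<in> borel_measurable (borel \<Otimes>\<^sub>M borel)" unfolding g_def by measurable
    have "AE x in \<rho>. (\<integral>y. g (x, y) \<partial>K x) = 0"
    proof (rule density_unique_real)
      fix A assume "A \<in> sets \<rho>"
      then have A[measurable]: "A \<in> sets borel" by simp
      have iA: "integrable \<pi> (\<lambda>z. indicator A (fst z) * g z)"
        by (rule Bochner_Integration.integrable_bound[OF g]) (auto simp: indicator_def)
      have "(\<integral>x\<in>A. (\<integral>y. g (x, y) \<partial>K x) \<partial>\<rho>) = (\<integral>x. \<integral>y. indicator A x * g (x, y) \<partial>K x \<partial>\<rho>)"
        unfolding set_lebesgue_integral_def by simp
      also have "\<dots> = (\<integral>z. indicator A (fst z) * g z \<partial>\<pi>)"
        by (subst integral_\<pi>[OF iA]) simp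
      also have "\<dots> = 0" using martingale[OF A, of i] by (simp add: g_def)
      finally show "(\<integral>x\<in>A. (\<integral>y. g (x, y) \<partial>K x) \<partial>\<rho>) = (\<integral>x\<in>A. 0 \<partial>\<rho>)"
        by (simp add: set_lebesgue_integral_def)
    qed (use integrable_integral_K[OF g] in auto)
    with AE_integrable_K[OF integrable_Y[of i]] show ?thesis
      by eventually_elim (auto simp: g_def K.prob_space)
  qed
  have "AE x in \<rho>. \<forall>i\<in>UNIV. integrable (K x) (\<lambda>y. y $ i) \<and> (\<integral>y. y $ i \<partial>K x) = x $ i"
    using one by (intro AE_finite_allI) auto
  then show ?thesis by (simp add: centered_def)
qed

end

section \<open>A Metropolis step\<close>

definition sign_of :: "bool \<Rightarrow> real" where "sign_of s = (if s then 1 else -1)"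

lemma abs_sign_of [simp]: "\<bar>sign_of s\<bar> = 1"
  by (simp add: sign_of_def)

lemma sign_of_measurable [measurable]: "sign_of \<in> borel_measurable (uniform_count_measure UNIV)"
  by (simp add: measurable_def)

text \<open>A fair sign together with an independent uniform variable that decides about acceptance.\<close>

definition coin :: "(bool \<times> real) measure" where
  "coin = uniform_count_measure UNIV \<Otimes>\<^sub>M uniform_measure lborel {0..1}"

lemma prob_space_unit_interval: "prob_space (uniform_measure lborel {0..1::real})"
  by (rule prob_space_uniform_measure) auto

lemma prob_space_coin: "prob_space coin"
proof -
  interpret A: prob_space "uniform_count_measure (UNIV :: bool set)"
    by (rule prob_space_uniform_count_measure) auto
  interpret B: prob_space "uniform_measure lborel {0..1::real}"
    by (rule prob_space_unit_interval)
  interpret P: pair_prob_space "uniform_count_measure (UNIV :: bool set)" "uniform_measure lborel {0..1::real}" ..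
  show ?thesis unfolding coin_def by (rule P.prob_space_axioms)
qed

lemma measurable_coin_cong [measurable_cong]: "sets coin = sets (uniform_count_measure UNIV \<Otimes>\<^sub>M borel)"
  unfolding coin_def by (intro sets_pair_measure_cong) auto

lemma integral_coin:
  assumes f: "integrable coin f"
  shows "(\<integral>r. f r \<partial>coin) = ((\<integral>u. f (True, u) \<partial>uniform_measure lborel {0..1}) + (\<integral>u. f (False, u) \<partial>uniform_measure lborel {0..1})) / (2 :: real)"
proof -
  interpret A: prob_space "uniform_count_measure (UNIV :: bool set)"
    by (rule prob_space_uniform_count_measure) auto
  interpret B: prob_space "uniform_measure lborel {0..1::real}"
    by (rule prob_space_unit_interval)
  interpret P: pair_prob_space "uniform_count_measure (UNIV :: bool set)" "uniform_measure lborel {0..1::real}" ..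
  show ?thesis
    using f unfolding coin_def
    by (subst P.integral_fst'[symmetric]) (auto simp: integral_uniform_count_measure UNIV_bool card_UNIV_bool)
qed

lemma integral_coin_sign:
  fixes f :: "real \<Rightarrow> real"
  shows "(\<integral>r. f (sign_of (fst r)) \<partial>coin) = (f 1 + f (-1)) / 2"
proof -
  interpret B: prob_space "uniform_measure lborel {0..1::real}"
    by (rule prob_space_unit_interval)
  interpret C: prob_space coin by (rule prob_space_coin)
  have m: "(\<lambda>s. f (sign_of s)) \<in> borel_measurable (uniform_count_measure UNIV)"
    by (simp add: measurable_def)
  have "integrable coin (\<lambda>r. f (sign_of (fst r)))"
  proof (rule C.integrable_const_bound[where B="\<bar>f 1\<bar> + \<bar>f (-1)\<bar>"])
    show "(\<lambda>r. f (sign_of (fst r))) \<in> borel_measurable coin"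
      using measurable_compose[OF measurable_fst m] by measurable
  qed (auto simp: sign_of_def)
  then show ?thesis by (subst integral_coin) (auto simp: sign_of_def B.prob_space[simplified])
qed

text \<open>One step of the Metropolis algorithm with stationary density \<open>f\<close>, proposing to move by \<open>\<plusminus> c\<close>.\<close>

definition metropolis_step :: "(real \<Rightarrow> real) \<Rightarrow> real \<Rightarrow> bool \<times> real \<Rightarrow> real \<Rightarrow> real" where
  "metropolis_step f c r z = (if snd r * f z \<le> f (z + sign_of (fst r) * c) then sign_of (fst r) * c else 0)"

lemma abs_metropolis_step_le: "\<bar>metropolis_step f c r z\<bar> \<le> \<bar>c\<bar>"
  by (simp add: metropolis_step_def abs_mult)

lemma metropolis_step_measurable [measurable]:
  assumes [measurable]: "f \<in> borel_measurable borel"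
  shows "(\<lambda>p. metropolis_step f c (fst p) (snd p)) \<in> borel_measurable (coin \<Otimes>\<^sub>M borel)"
  unfolding metropolis_step_def by measurable

text \<open>The acceptance probability is \<open>min 1 (F' / F)\<close>. Multiplied by
  \<open>F\<close> it becomes \<open>min F F'\<close>, which is symmetric in the two ends of the
  move, the source of detailed balance, and makes sense for \<open>F = 0\<close>.\<close>

lemma integral_unit_interval_threshold:
  fixes F F' A B :: real
  assumes "0 \<le> F" "0 \<le> F'"
  shows "F * (\<integral>u. (if u * F \<le> F' then A else B) \<partial>uniform_measure lborel {0..1}) = min F F' * A + (F - min F F') * B"
proof (cases "F = 0")
  case False
  then have F: "F > 0" using assms by simp
  interpret V: prob_space "uniform_measure lborel {0..1::real}" by (rule prob_space_unit_interval)
  let ?V = "uniform_measure lborel {0..1::real}"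
  have "{0..1} \<inter> {u. u * F \<le> F'} = {0..min 1 (F' / F)}"
    using F by (auto simp: field_simps)
  then have m: "measure ?V {u. u * F \<le> F'} = min 1 (F' / F)"
    using F assms by (subst measure_uniform_measure) auto
  define S where "S = {u. u * F \<le> F'}"
  have S[measurable]: "S \<in> sets borel" unfolding S_def by measurable
  have i: "integrable ?V (indicator S :: real \<Rightarrow> real)"
    by (rule V.integrable_const_bound[where B=1]) (auto simp: indicator_def)
  have mS: "(\<integral>u. indicator S u \<partial>?V) = min 1 (F' / F)"
    using m by (subst Bochner_Integration.integral_indicator) (auto simp: S_def)
  have "(\<integral>u. (if u * F \<le> F' then A else B) \<partial>?V) = (\<integral>u. indicator S u * (A - B) + B \<partial>?V)"
    by (intro Bochner_Integration.integral_cong) (auto simp: indicator_def S_def)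
  also have "\<dots> = (\<integral>u. indicator S u \<partial>?V) * (A - B) + B"
    using i V.prob_space by (simp del: Bochner_Integration.integral_indicator)
  finally have "(\<integral>u. (if u * F \<le> F' then A else B) \<partial>?V) = min 1 (F' / F) * (A - B) + B"
    by (simp only: mS)
  then show ?thesis
    using F by (auto simp: min_def field_simps)
qed (use assms in simp)

text \<open>Letting \<open>h\<close> depend on both the starting point and the step serves
  \<open>metropolis_stationary\<close>, which looks at the endpoint, and
  \<open>metropolis_rejection\<close>, which looks at the step.\<close>

lemma metropolis_integral:
  assumes [measurable]: "f \<in> borel_measurable borel" and f0: "\<And>z. 0 \<le> f z"
    and [measurable]: "(\<lambda>p. h (fst p) (snd p)) \<in> borel_measurable (borel \<Otimes>\<^sub>M borel)" and hC: "\<And>z s. \<bar>h z s\<bar> \<le> C"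
  shows "f z * (\<integral>r. h z (metropolis_step f c r z) \<partial>coin) =
    ((min (f z) (f (z + c)) * h z c + (f z - min (f z) (f (z + c))) * h z 0) +
     (min (f z) (f (z - c)) * h z (- c) + (f z - min (f z) (f (z - c))) * h z 0)) / 2"
proof -
  interpret C: prob_space coin by (rule prob_space_coin)
  have [measurable]: "(\<lambda>r. metropolis_step f c r z) \<in> borel_measurable coin"
    unfolding metropolis_step_def by measurable
  have "integrable coin (\<lambda>r. h z (metropolis_step f c r z))"
  proof (rule C.integrable_const_bound[where B=C])
    have "(\<lambda>r. (z, metropolis_step f c r z)) \<in> coin \<rightarrow>\<^sub>M borel \<Otimes>\<^sub>M borel" by measurable
    from measurable_compose[OF this assms(3)]
    show "(\<lambda>r. h z (metropolis_step f c r z)) \<in> borel_measurable coin" by simp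
  qed (use hC in auto)
  moreover have "h z (metropolis_step f c (True, u) z) = (if u * f z \<le> f (z + c) then h z c else h z 0)"
    "h z (metropolis_step f c (False, u) z) = (if u * f z \<le> f (z - c) then h z (- c) else h z 0)" for u
    by (auto simp: metropolis_step_def sign_of_def)
  ultimately show ?thesis
    using integral_unit_interval_threshold[OF f0[of z] f0[of "z + c"], of "h z c" "h z 0"]
      integral_unit_interval_threshold[OF f0[of z] f0[of "z - c"], of "h z (- c)" "h z 0"]
    by (simp add: integral_coin distrib_left)
qed

lemma metropolis_stationary:
  fixes g :: "real \<Rightarrow> real"
  assumes f: "integrable lborel f" and f0: "\<And>z. 0 \<le> f z"
    and [measurable]: "g \<in> borel_measurable borel" and gC: "\<And>z. \<bar>g z\<bar> \<le> C"
  shows "(\<integral>z. f z * (\<integral>r. g (z + metropolis_step f c r z) \<partial>coin) \<partial>lborel) = (\<integral>z. f z * g z \<partial>lborel)"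
proof -
  have [measurable]: "f \<in> borel_measurable borel" using f by auto
  have mg: "integrable lborel (\<lambda>z. min (f (z + a)) (f (z + b)) * g (z + d))" for a b d
  proof (rule Bochner_Integration.integrable_bound)
    show "integrable lborel (\<lambda>z. C * f (z + a))" using lborel_integrable_translation[OF f] by simp
    show "AE z in lborel. norm (min (f (z + a)) (f (z + b)) * g (z + d)) \<le> norm (C * f (z + a))"
    proof (rule AE_I2)
      fix z
      have "\<bar>min (f (z + a)) (f (z + b))\<bar> * \<bar>g (z + d)\<bar> \<le> f (z + a) * C"
        using f0 gC[of "z + d"] by (intro mult_mono) auto
      also have "\<dots> \<le> \<bar>C * f (z + a)\<bar>" by (simp add: mult.commute)
      finally show "norm (min (f (z + a)) (f (z + b)) * g (z + d)) \<le> norm (C * f (z + a))"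
        by (simp add: abs_mult)
    qed
  qed simp
  have fg: "integrable lborel (\<lambda>z. f z * g z)"
    using mg[of 0 0 0] by simp
  have mg': "integrable lborel (\<lambda>z. min (f z) (f (z + b)) * g (z + d))" for b d
    using mg[of 0 b d] by simp
  \<comment> \<open>Detailed balance: the accepted flow over \<open>c\<close> into \<open>z\<close> equals the accepted flow over \<open>- c\<close> out of \<open>z\<close>.\<close>
  have flow: "(\<integral>z. min (f z) (f (z + b)) * g (z + b) \<partial>lborel) = (\<integral>z. min (f z) (f (z - b)) * g z \<partial>lborel)" for b
    using lborel_integral_translation[of "\<lambda>z. min (f z) (f (z - b)) * g z" b] by (simp add: min.commute)
  have "f z * (\<integral>r. g (z + metropolis_step f c r z) \<partial>coin)
      = ((min (f z) (f (z + c)) * g (z + c) + (f z * g z - min (f z) (f (z + c)) * g z)) +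
         (min (f z) (f (z - c)) * g (z - c) + (f z * g z - min (f z) (f (z - c)) * g z))) / 2" for z
    by (subst metropolis_integral[where C=C and h="\<lambda>z s. g (z + s)"]) (use f0 gC in \<open>auto simp: left_diff_distrib\<close>)
  then have "(\<integral>z. f z * (\<integral>r. g (z + metropolis_step f c r z) \<partial>coin) \<partial>lborel)
      = (\<integral>z. ((min (f z) (f (z + c)) * g (z + c) + (f z * g z - min (f z) (f (z + c)) * g z)) +
         (min (f z) (f (z - c)) * g (z - c) + (f z * g z - min (f z) (f (z - c)) * g z))) / 2 \<partial>lborel)"
    by (simp only:)
  also have "\<dots> = (((\<integral>z. min (f z) (f (z + c)) * g (z + c) \<partial>lborel)
        + ((\<integral>z. f z * g z \<partial>lborel) - (\<integral>z. min (f z) (f (z + c)) * g z \<partial>lborel)))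
      + ((\<integral>z. min (f z) (f (z - c)) * g (z - c) \<partial>lborel)
        + ((\<integral>z. f z * g z \<partial>lborel) - (\<integral>z. min (f z) (f (z - c)) * g z \<partial>lborel)))) / 2"
    using fg mg'[of c c] mg'[of c 0] mg'[of "- c" "- c"] mg'[of "- c" 0]
    by (simp add: Bochner_Integration.integral_add Bochner_Integration.integral_diff)
  also have "\<dots> = (\<integral>z. f z * g z \<partial>lborel)"
    using flow[of c] flow[of "- c"] by simp
  finally show ?thesis .
qed

text \<open>A proposed move from \<open>z\<close> to \<open>z'\<close> is refused with weight
  \<open>f z - min (f z) (f z')\<close>, which is at most \<open>\<bar>f z' - f z\<bar>\<close>. The
  rejected mass is thus controlled by the translation defect of the density.\<close>

lemma metropolis_rejection:
  assumes f: "integrable lborel f" and f0: "\<And>z. 0 \<le> f z"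
  shows "(\<integral>z. f z * (\<integral>r. of_bool (metropolis_step f c r z \<noteq> sign_of (fst r) * c) \<partial>coin) \<partial>lborel)
      \<le> (\<integral>z. \<bar>f (z + c) - f z\<bar> \<partial>lborel) + (\<integral>z. \<bar>f (z - c) - f z\<bar> \<partial>lborel)"
proof -
  have [measurable]: "f \<in> borel_measurable borel" using f by auto
  have i: "integrable lborel (\<lambda>z. \<bar>f (z + b) - f z\<bar>)" for b
    using lborel_integrable_translation[OF f, of b] f by auto
  have i': "integrable lborel (\<lambda>z. \<bar>f (z + c) - f z\<bar>)" "integrable lborel (\<lambda>z. \<bar>f (z - c) - f z\<bar>)"
    using i[of c] i[of "- c"] by simp_all
  \<comment> \<open>A rejection shows as a step 0, except for \<open>c = 0\<close>, when the
    proposal itself is 0.\<close>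
  define h where "h z s = (of_bool (s = 0 \<and> c \<noteq> 0) :: real)" for z s :: real
  have "(of_bool (metropolis_step f c r z \<noteq> sign_of (fst r) * c) :: real) = h z (metropolis_step f c r z)" for r z
    by (auto simp: h_def metropolis_step_def sign_of_def)
  moreover have "f z * (\<integral>r. h z (metropolis_step f c r z) \<partial>coin) =
    ((min (f z) (f (z + c)) * h z c + (f z - min (f z) (f (z + c))) * h z 0) +
     (min (f z) (f (z - c)) * h z (- c) + (f z - min (f z) (f (z - c))) * h z 0)) / 2" for z
    by (rule metropolis_integral[where C=1]) (use f0 in \<open>auto simp: h_def\<close>)
  moreover have "h z c = 0" "h z (- c) = 0" "0 \<le> h z 0" "h z 0 \<le> 1" for z by (auto simp: h_def)
  ultimately have eq: "f z * (\<integral>r. of_bool (metropolis_step f c r z \<noteq> sign_of (fst r) * c) \<partial>coin)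
      = ((f z - min (f z) (f (z + c))) * h z 0 + (f z - min (f z) (f (z - c))) * h z 0) / 2" for z by simp
  have le: "f z * (\<integral>r. of_bool (metropolis_step f c r z \<noteq> sign_of (fst r) * c) \<partial>coin)
      \<le> \<bar>f (z + c) - f z\<bar> + \<bar>f (z - c) - f z\<bar>" for z
  proof -
    have half: "(a + b) / 2 \<le> \<bar>c\<bar> + \<bar>d\<bar>" if "a \<le> \<bar>c\<bar>" "b \<le> \<bar>d\<bar>" for a b c d :: real
      using that abs_ge_zero[of c] abs_ge_zero[of d] by (simp add: field_simps)
    have "(f z - min (f z) x) * h z 0 \<le> \<bar>x - f z\<bar>" for x
    proof -
      have "(f z - min (f z) x) * h z 0 \<le> (f z - min (f z) x) * 1"
        using \<open>h z 0 \<le> 1\<close> by (intro mult_left_mono) auto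
      then show ?thesis by simp
    qed
    from this[of "f (z + c)"] this[of "f (z - c)"] show ?thesis unfolding eq
      by (rule half)
  qed
  have "(\<integral>z. f z * (\<integral>r. of_bool (metropolis_step f c r z \<noteq> sign_of (fst r) * c) \<partial>coin) \<partial>lborel)
      \<le> (\<integral>z. \<bar>f (z + c) - f z\<bar> + \<bar>f (z - c) - f z\<bar> \<partial>lborel)"
    using i' le f0 by (intro integral_mono') auto
  also have "\<dots> = (\<integral>z. \<bar>f (z + c) - f z\<bar> \<partial>lborel) + (\<integral>z. \<bar>f (z - c) - f z\<bar> \<partial>lborel)"
    using i' by simp
  finally show ?thesis .
qed

section \<open>The competitor at scale \<open>t\<close>\<close>

text \<open>Optimality is phrased with the marginals of \<open>\<pi>\<close> itself and the
  martingale property in integrated form, which is how \<open>exchange_repair\<close> delivers its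
  competitors.\<close>

locale optimal_coupling = martingale_coupling \<pi> K
  for \<pi> :: "((real ^ 'n::finite) \<times> (real ^ 'n)) measure" and K +
  assumes ac: "\<And>i. absolutely_continuous lborel (distr \<pi> borel (\<lambda>z. fst z $ i))"
    and optimal: "\<And>\<gamma>. prob_space \<gamma> \<Longrightarrow> sets \<gamma> = sets borel \<Longrightarrow>
      (\<And>i. distr \<gamma> borel (\<lambda>z. fst z $ i) = distr \<pi> borel (\<lambda>z. fst z $ i)) \<Longrightarrow>
      (\<And>i. distr \<gamma> borel (\<lambda>z. snd z $ i) = distr \<pi> borel (\<lambda>z. snd z $ i)) \<Longrightarrow>
      (\<And>i A. A \<in> sets borel \<Longrightarrow> (\<integral>z. indicator A (fst z) * (snd z $ i - fst z $ i) \<partial>\<gamma>) = 0) \<Longrightarrow>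
      (\<integral>z. norm (fst z - snd z) \<partial>\<gamma>) \<le> (\<integral>z. norm (fst z - snd z) \<partial>\<pi>)"
begin

text \<open>The part of the law of coordinate \<open>i\<close> that comes from \<open>G\<close> is
  dominated by the whole law, hence absolutely continuous, and a Radon-Nikodym derivative of it is
  the density. The restriction is needed because only points of \<open>G\<close> are going to
  move.\<close>

lemma restricted_marginal_density:
  assumes G[measurable]: "G \<in> sets borel"
  shows "\<exists>f. integrable lborel f \<and> (\<forall>z. 0 \<le> f z) \<and>
    (\<forall>\<phi>. \<phi> \<in> borel_measurable borel \<longrightarrow> (\<integral>z. indicator G (fst z) * \<phi> (fst z $ i) \<partial>\<pi>) = (\<integral>z. f z * \<phi> z \<partial>lborel :: real))"
proof -
  define N where "N = distr (density \<pi> (indicator (fst -` G))) borel (\<lambda>z. fst z $ i)"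
  have G'[measurable]: "fst -` G \<in> sets \<pi>"
    using measurable_sets[of fst \<pi> borel G] by (simp add: space_\<pi>)
  have emN: "emeasure N A = emeasure \<pi> (fst -` G \<inter> (\<lambda>z. fst z $ i) -` A)" if [measurable]: "A \<in> sets borel" for A
  proof -
    have A'[measurable]: "(\<lambda>z. fst z $ i) -` A \<in> sets \<pi>"
      using measurable_sets[of "\<lambda>z. fst z $ i" \<pi> borel A] by (simp add: space_\<pi>)
    show ?thesis
      unfolding N_def by (simp add: emeasure_distr emeasure_density space_\<pi> indicator_inter_arith[symmetric])
  qed
  have finN: "finite_measure N"
  proof (rule finite_measureI)
    have "space N = UNIV" by (simp add: N_def)
    then show "emeasure N (space N) \<noteq> \<infinity>" using emN[of UNIV] by (simp add: emeasure_eq_measure)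
  qed
  have sN: "sets N = sets lborel" by (simp add: N_def)
  have acN: "absolutely_continuous lborel N"
    unfolding absolutely_continuous_def
  proof
    fix A assume A: "A \<in> null_sets (lborel :: real measure)"
    then have [measurable]: "A \<in> sets borel" by (auto simp: null_sets_def)
    have "A \<in> null_sets (distr \<pi> borel (\<lambda>z. fst z $ i))"
      using ac[of i] A unfolding absolutely_continuous_def by auto
    then have "emeasure \<pi> ((\<lambda>z. fst z $ i) -` A) = 0"
      by (auto simp: null_sets_def emeasure_distr space_\<pi>)
    moreover have "(\<lambda>z. fst z $ i) -` A \<in> sets \<pi>"
      using measurable_sets[of "\<lambda>z. fst z $ i" \<pi> borel A] by (simp add: space_\<pi>)
    ultimately have "emeasure \<pi> (fst -` G \<inter> (\<lambda>z. fst z $ i) -` A) = 0"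
      using emeasure_mono[of "fst -` G \<inter> (\<lambda>z. fst z $ i) -` A" "(\<lambda>z. fst z $ i) -` A" \<pi>] by auto
    then show "A \<in> null_sets N" by (auto simp: null_sets_def emN sN)
  qed
  obtain f where f[measurable]: "f \<in> borel_measurable lborel" and fR: "AE z in lborel. RN_deriv lborel N z = ennreal (f z)"
    and f0: "\<And>z. 0 \<le> f z"
    using sigma_finite_measure.real_RN_deriv[OF lborel.sigma_finite_measure_axioms finN acN sN] by metis
  have N: "N = density lborel f"
  proof -
    have "N = density lborel (RN_deriv lborel N)"
      using sigma_finite_measure.density_RN_deriv[OF lborel.sigma_finite_measure_axioms acN sN] by simp
    also have "\<dots> = density lborel f"
      using fR by (intro density_cong) auto
    finally show ?thesis .
  qed
  have "(\<integral>\<^sup>+z. ennreal (f z) \<partial>lborel) = emeasure N (space N)"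
    unfolding N by (subst emeasure_density) (auto simp: N)
  also have "\<dots> < \<infinity>" using finite_measure.emeasure_finite[OF finN] by (simp add: less_top)
  finally have fi: "integrable lborel f" using f0 by (intro integrableI_bounded) auto
  have "(\<integral>z. indicator G (fst z) * \<phi> (fst z $ i) \<partial>\<pi>) = (\<integral>z. f z * \<phi> z \<partial>lborel)"
    if [measurable]: "\<phi> \<in> borel_measurable borel" for \<phi> :: "real \<Rightarrow> real"
  proof -
    have "(\<integral>z. f z * \<phi> z \<partial>lborel) = (\<integral>z. \<phi> z \<partial>N)"
      unfolding N using f0 by (subst integral_density) auto
    also have "\<dots> = (\<integral>z. \<phi> (fst z $ i) \<partial>density \<pi> (\<lambda>z. ennreal (indicator (fst -` G) z)))"
      unfolding N_def by (subst integral_distr) (auto simp: ennreal_indicator)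
    also have "\<dots> = (\<integral>z. indicator (fst -` G) z * \<phi> (fst z $ i) \<partial>\<pi>)"
      by (subst integral_density) auto
    finally show ?thesis by (simp add: indicator_def)
  qed
  then show ?thesis using fi f0 by blast
qed

end

text \<open>On \<open>G\<close> the drift is nearly the constant \<open>c\<close>, so that one step length serves all points. The
  condition \<open>spread\<close> provides the mass below \<open>a i\<close> and above \<open>b i\<close> that the exchange draws on; it fails
  only if coordinate \<open>i\<close> is not moved at all.\<close>

locale tilt_data = optimal_coupling \<pi> K
  for \<pi> :: "((real ^ 'n::finite) \<times> (real ^ 'n)) measure" and K +
  fixes G :: "(real ^ 'n) set" and \<sigma> \<tau> :: "(real ^ 'n) \<times> (real ^ 'n) \<Rightarrow> real"
    and c a b :: "'n \<Rightarrow> real" and \<epsilon> m :: real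
  assumes G_measurable [measurable]: "G \<in> sets borel" and G_centered: "G \<subseteq> centered"
    and \<sigma>_measurable [measurable]: "\<sigma> \<in> borel_measurable (borel \<Otimes>\<^sub>M borel)"
    and \<tau>_measurable [measurable]: "\<tau> \<in> borel_measurable (borel \<Otimes>\<^sub>M borel)"
    and \<sigma>_le: "\<And>z. \<bar>\<sigma> z\<bar> \<le> 1 / 4" and \<tau>_le: "\<And>z. \<bar>\<tau> z\<bar> \<le> 1 / 4"
    and \<sigma>_0: "\<And>x. x \<in> G \<Longrightarrow> (\<integral>y. \<sigma> (x, y) \<partial>K x) = 0"
    and \<sigma>_1: "\<And>x i. x \<in> G \<Longrightarrow> (\<integral>y. \<sigma> (x, y) * y $ i \<partial>K x) = 0"
    and \<tau>_0: "\<And>x. x \<in> G \<Longrightarrow> (\<integral>y. \<tau> (x, y) \<partial>K x) = 0"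
    and near: "\<And>x i. x \<in> G \<Longrightarrow> \<bar>(\<integral>y. \<tau> (x, y) * y $ i \<partial>K x) - c i\<bar> \<le> \<epsilon>"
    and \<epsilon>_pos: "0 < \<epsilon>" and m_pos: "0 < m" and a_less_b: "\<And>i. a i < b i"
    and spread: "\<And>x i. x \<in> G \<Longrightarrow>
      (m \<le> measure (K x) {y. y $ i \<le> a i} \<and> m \<le> measure (K x) {y. b i \<le> y $ i}) \<or>
      ((\<integral>y. \<tau> (x, y) * y $ i \<partial>K x) = 0 \<and> c i = 0)"
begin

definition drift :: "real ^ 'n \<Rightarrow> real ^ 'n" where
  "drift x = (\<chi> i. \<integral>y. \<tau> (x, y) * y $ i \<partial>K x)"

lemma drift_nth_measurable [measurable]: "(\<lambda>x. drift x $ i) \<in> borel_measurable borel"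
  using integral_K_measurable[of "\<lambda>z. \<tau> z * snd z $ i"] by (simp add: drift_def)

lemma drift_measurable [measurable]: "drift \<in> borel_measurable borel"
  by (rule borel_measurable_vecI) measurable

lemma drift_near: "x \<in> G \<Longrightarrow> \<bar>drift x $ i - c i\<bar> \<le> \<epsilon>"
  using near by (simp add: drift_def)

lemma norm_drift_le: "x \<in> G \<Longrightarrow> norm (drift x) \<le> (\<Sum>i\<in>UNIV. \<bar>c i\<bar> + \<epsilon>)"
proof -
  assume x: "x \<in> G"
  have "norm (drift x) \<le> (\<Sum>i\<in>UNIV. \<bar>drift x $ i\<bar>)" by (rule norm_le_l1_cart)
  also have "\<dots> \<le> (\<Sum>i\<in>UNIV. \<bar>c i\<bar> + \<epsilon>)"
  proof (rule sum_mono)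
    fix i
    show "\<bar>drift x $ i\<bar> \<le> \<bar>c i\<bar> + \<epsilon>" using drift_near[OF x, of i] by linarith
  qed
  finally show ?thesis .
qed

text \<open>The choice is made before the scale \<open>t\<close> is introduced, so that continuity
  of translation concerns one fixed density as \<open>t\<close> tends to 0.\<close>

definition dens :: "'n \<Rightarrow> real \<Rightarrow> real" where
  "dens i = (SOME f. integrable lborel f \<and> (\<forall>z. 0 \<le> f z) \<and>
    (\<forall>\<phi>. \<phi> \<in> borel_measurable borel \<longrightarrow>
      (\<integral>z. indicator G (fst z) * \<phi> (fst z $ i) \<partial>\<pi>) = (\<integral>z. f z * \<phi> z \<partial>lborel :: real)))"

lemma integrable_dens: "integrable lborel (dens i)"
  and dens_nonneg: "0 \<le> dens i z"
  and integral_dens: "\<phi> \<in> borel_measurable borel \<Longrightarrow>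
    (\<integral>z. indicator G (fst z) * \<phi> (fst z $ i) \<partial>\<pi>) = (\<integral>z. dens i z * \<phi> z \<partial>lborel)"
  using someI_ex[OF restricted_marginal_density[OF G_measurable, of i]] unfolding dens_def by blast+

lemma dens_measurable [measurable]: "dens i \<in> borel_measurable borel"
  using integrable_dens[of i] by auto

end

text \<open>The condition \<open>t_small\<close> is what \<open>exchange_repair\<close> demands of
  the rates: an error of at most \<open>t * (2 * \<bar>c i\<bar> + \<epsilon>)\<close> is spread
  over a mass of at least \<open>m / 2\<close>.\<close>

locale small_tilt = tilt_data \<pi> K G \<sigma> \<tau> c a b \<epsilon> m
  for \<pi> :: "((real ^ 'n::finite) \<times> (real ^ 'n)) measure" and K G \<sigma> \<tau> c a b \<epsilon> m +
  fixes t :: real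
  assumes t_pos: "0 < t" and t_le: "t \<le> 1"
    and t_small: "\<And>i. t * (2 * \<bar>c i\<bar> + \<epsilon>) * (2 / m) \<le> (b i - a i) / CARD('n)"
begin

sublocale coin: prob_space coin by (rule prob_space_coin)
sublocale P: pair_prob_space \<pi> coin ..

abbreviation P :: "(((real ^ 'n) \<times> (real ^ 'n)) \<times> bool \<times> real) measure" where
  "P \<equiv> \<pi> \<Otimes>\<^sub>M coin"

definition weight :: "((real ^ 'n) \<times> (real ^ 'n)) \<times> bool \<times> real \<Rightarrow> real" where
  "weight z = 1 + sign_of (fst (snd z)) * (indicator G (fst (fst z)) * (\<sigma> (fst z) + t * \<tau> (fst z)))"

text \<open>All coordinates share one coin. Their joint law changes in an uncontrolled way, but only
  the one-dimensional laws are prescribed.\<close>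

definition jump :: "'n \<Rightarrow> real ^ 'n \<Rightarrow> bool \<times> real \<Rightarrow> real" where
  "jump i x r = indicator G x * metropolis_step (dens i) (t * c i) r (x $ i)"

text \<open>The new position minus the tilted conditional mean of \<open>Y\<close>: where it is
  positive, values of \<open>Y i\<close> have to be raised.\<close>

definition err :: "'n \<Rightarrow> real ^ 'n \<Rightarrow> bool \<times> real \<Rightarrow> real" where
  "err i x r = jump i x r - indicator G x * (sign_of (fst r) * t * drift x $ i)"

definition X' :: "((real ^ 'n) \<times> (real ^ 'n)) \<times> bool \<times> real \<Rightarrow> real ^ 'n" where
  "X' z = (\<chi> i. fst (fst z) $ i + jump i (fst (fst z)) (snd z))"

lemma weight_measurable [measurable]: "weight \<in> borel_measurable P"
  unfolding weight_def by measurable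

lemma jump_measurable [measurable]: "(\<lambda>z. jump i (fst (fst z)) (snd z)) \<in> borel_measurable P"
  unfolding jump_def metropolis_step_def by measurable

lemma err_measurable [measurable]: "(\<lambda>z. err i (fst (fst z)) (snd z)) \<in> borel_measurable P"
  unfolding err_def by measurable

lemma X'_nth: "X' z $ i = fst (fst z) $ i + jump i (fst (fst z)) (snd z)"
  by (simp add: X'_def)

lemma X'_measurable [measurable]: "X' \<in> borel_measurable P"
  by (rule borel_measurable_vecI) (simp add: X'_nth)

text \<open>The bounds 1/4 on \<open>\<sigma>\<close> and \<open>\<tau>\<close> are chosen for this:
  with \<open>t \<le> 1\<close> the weight stays between 1/2 and 3/2, and reweighting keeps at least
  half of any mass.\<close>

lemma tilt_le: "\<bar>indicator G x * (\<sigma> (x, y) + t * \<tau> (x, y))\<bar> \<le> 1 / 2"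
proof -
  have "\<bar>t * \<tau> (x, y)\<bar> \<le> 1 * (1 / 4)"
    unfolding abs_mult using t_pos t_le \<tau>_le by (intro mult_mono) auto
  then have "\<bar>\<sigma> (x, y) + t * \<tau> (x, y)\<bar> \<le> 1 / 2"
    using abs_triangle_ineq[of "\<sigma> (x, y)" "t * \<tau> (x, y)"] \<sigma>_le[of "(x, y)"] by linarith
  then show ?thesis by (simp add: indicator_def)
qed

lemma weight_bounds: "1 / 2 \<le> weight z" "weight z \<le> 3 / 2"
  using tilt_le[of "fst (fst z)" "snd (fst z)"] unfolding weight_def sign_of_def by (auto simp: abs_le_iff)

lemma weight_nonneg: "0 \<le> weight z"
  using weight_bounds(1)[of z] by simp

section \<open>Means under the weight\<close>

lemma integrable_weight: "integrable P f \<Longrightarrow> integrable P (\<lambda>z. weight z * f z)" for f :: "_ \<Rightarrow> real"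
  by (rule integrable_bounded_mult[where C="3 / 2"]) (use weight_bounds weight_nonneg in \<open>auto simp: abs_of_nonneg\<close>)

lemma integrable_fst_P:
  fixes f :: "_ \<Rightarrow> real"
  assumes f: "integrable \<pi> f"
  shows "integrable P (\<lambda>z. f (fst z))" and "(\<integral>z. f (fst z) \<partial>P) = (\<integral>z. f z \<partial>\<pi>)"
  using integrable_pair_fst[OF sigma_finite_measure_axioms prob_space_coin f]
    integral_pair_fst[OF sigma_finite_measure_axioms prob_space_coin f] .

text \<open>The tilt is odd in the sign, so averaging over the coin at fixed \<open>(x, y)\<close>
  leaves 1. Hence the law of \<open>Y\<close> survives the reweighting exactly.\<close>

lemma integral_weight_fst:
  fixes f :: "_ \<Rightarrow> real"
  assumes f: "integrable \<pi> f"
  shows "(\<integral>z. weight z * f (fst z) \<partial>P) = (\<integral>z. f z \<partial>\<pi>)"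
proof -
  have "(\<integral>z. weight z * f (fst z) \<partial>P) = (\<integral>z. \<integral>r. weight (z, r) * f z \<partial>coin \<partial>\<pi>)"
    by (subst P.integral_fst'[symmetric]) (use integrable_weight[OF integrable_fst_P(1)[OF f]] in auto)
  also have "\<dots> = (\<integral>z. f z \<partial>\<pi>)"
  proof (rule Bochner_Integration.integral_cong)
    fix z
    show "(\<integral>r. weight (z, r) * f z \<partial>coin) = f z"
      using integral_coin_sign[of "\<lambda>s. (1 + s * (indicator G (fst z) * (\<sigma> z + t * \<tau> z))) * f z"]
      by (simp add: weight_def algebra_simps)
  qed simp
  finally show ?thesis .
qed

lemma weight_K_measurable [measurable]: "(\<lambda>y. weight ((x, y), r)) \<in> borel_measurable (K x)"
proof -
  have "(\<lambda>y. 1 + s * (indicator G x * (\<sigma> (x, y) + t * \<tau> (x, y)))) \<in> borel_measurable (K x)" for s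
    by measurable
  then show ?thesis by (simp add: weight_def)
qed

lemma integral_K_weight: "(\<integral>y. weight ((x, y), r) \<partial>K x) = 1"
proof (cases "x \<in> G")
  case True
  have i: "integrable (K x) (\<lambda>y. \<sigma> (x, y))" "integrable (K x) (\<lambda>y. \<tau> (x, y))"
    by (rule integrable_K_bounded[OF _ \<sigma>_le] integrable_K_bounded[OF _ \<tau>_le], measurable)+
  then show ?thesis
    using True \<sigma>_0[OF True] \<tau>_0[OF True] by (simp add: weight_def)
qed (simp add: weight_def)

lemma integral_K_weight_nth:
  assumes x: "x \<in> centered"
  shows "integrable (K x) (\<lambda>y. weight ((x, y), r) * y $ i)"
    and "(\<integral>y. weight ((x, y), r) * y $ i \<partial>K x) = x $ i + indicator G x * (sign_of (fst r) * t * drift x $ i)"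
proof -
  note iy = integrable_nth[OF x, of i]
  show "integrable (K x) (\<lambda>y. weight ((x, y), r) * y $ i)"
    using weight_bounds weight_nonneg by (intro integrable_K_bounded_mult[where C="3/2"] iy) auto
  show "(\<integral>y. weight ((x, y), r) * y $ i \<partial>K x) = x $ i + indicator G x * (sign_of (fst r) * t * drift x $ i)"
  proof (cases "x \<in> G")
    case True
    have i: "integrable (K x) (\<lambda>y. \<sigma> (x, y) * y $ i)" "integrable (K x) (\<lambda>y. \<tau> (x, y) * y $ i)"
      by (rule integrable_K_bounded_mult[OF iy _ \<sigma>_le] integrable_K_bounded_mult[OF iy _ \<tau>_le], measurable)+
    have "(\<integral>y. weight ((x, y), r) * y $ i \<partial>K x)
        = (\<integral>y. y $ i + (sign_of (fst r) * (\<sigma> (x, y) * y $ i) + sign_of (fst r) * t * (\<tau> (x, y) * y $ i)) \<partial>K x)"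
      using True by (intro Bochner_Integration.integral_cong) (auto simp: weight_def algebra_simps)
    also have "\<dots> = x $ i + sign_of (fst r) * t * drift x $ i"
      using i iy \<sigma>_1[OF True] mean_nth[OF x] by (simp add: drift_def)
    finally show ?thesis using True by simp
  qed (use mean_nth[OF x] in \<open>simp add: weight_def\<close>)
qed

text \<open>The tilts have \<open>K x\<close>-mean 0 on \<open>G\<close>, so for fixed
  \<open>x\<close> and coin the weight averages to 1 and quantities not involving \<open>y\<close>
  do not see it. In \<open>integral_weight_fst\<close> it is the coin that is averaged
  instead.\<close>

lemma integral_weight_label:
  fixes g :: "real ^ 'n \<Rightarrow> bool \<times> real \<Rightarrow> real"
  assumes g: "integrable P (\<lambda>z. g (fst (fst z)) (snd z))"
  shows "(\<integral>z. weight z * g (fst (fst z)) (snd z) \<partial>P) = (\<integral>z. g (fst (fst z)) (snd z) \<partial>P)"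
proof -
  note i = integrable_weight[OF g]
  have "(\<integral>z. weight z * g (fst (fst z)) (snd z) - g (fst (fst z)) (snd z) \<partial>P) = 0"
  proof (rule integral_pair_eq_0)
    have "(\<integral>y. weight ((x, y), r) * g x r - g x r \<partial>K x) = 0" for x r
    proof -
      have "integrable (K x) (\<lambda>y. weight ((x, y), r))"
        using weight_bounds weight_nonneg by (intro integrable_K_bounded[where C="3/2"]) auto
      then show ?thesis using integral_K_weight[of x r] by simp
    qed
    then show "AE x in \<rho>. \<forall>r. (\<integral>y. weight ((x, y), r) * g (fst (fst ((x, y), r))) (snd ((x, y), r))
        - g (fst (fst ((x, y), r))) (snd ((x, y), r)) \<partial>K x) = 0" by simp
  qed (use i g in \<open>auto intro: coin.sigma_finite_measure_axioms\<close>)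
  then show ?thesis using i g by simp
qed

text \<open>The part of the law coming from \<open>G\<close> has density \<open>dens i\<close>, for
  which the Metropolis step is stationary; off \<open>G\<close> nothing moves. The law is taken
  under \<open>P\<close>, where the coin is independent of \<open>x\<close>.\<close>

lemma integral_X':
  fixes \<phi> :: "real \<Rightarrow> real"
  assumes [measurable]: "\<phi> \<in> borel_measurable borel" and \<phi>C: "\<And>z. \<bar>\<phi> z\<bar> \<le> C"
  shows "(\<integral>z. \<phi> (X' z $ i) \<partial>P) = (\<integral>z. \<phi> (fst z $ i) \<partial>\<pi>)"
proof -
  have int: "integrable P (\<lambda>z. \<phi> (X' z $ i))"
    by (rule P.P.integrable_const_bound[where B=C]) (use \<phi>C in \<open>auto simp: X'_nth\<close>)
  define \<psi> where "\<psi> z = (\<integral>r. \<phi> (z + metropolis_step (dens i) (t * c i) r z) \<partial>coin)" for z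
  have \<psi>m[measurable]: "\<psi> \<in> borel_measurable borel"
  proof -
    have "(\<lambda>p. (snd p, fst p)) \<in> borel \<Otimes>\<^sub>M coin \<rightarrow>\<^sub>M coin \<Otimes>\<^sub>M borel" by measurable
    from measurable_compose[OF this metropolis_step_measurable[OF dens_measurable]]
    have [measurable]: "(\<lambda>p. metropolis_step (dens i) (t * c i) (snd p) (fst p)) \<in> borel_measurable (borel \<Otimes>\<^sub>M coin)"
      by simp
    show ?thesis
      unfolding \<psi>_def by (rule coin.borel_measurable_lebesgue_integral) (simp add: split_def)
  qed
  have \<psi>C: "\<bar>\<psi> z\<bar> \<le> C" for z
  proof -
    have "\<bar>\<psi> z\<bar> \<le> (\<integral>r. \<bar>\<phi> (z + metropolis_step (dens i) (t * c i) r z)\<bar> \<partial>coin)"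
      unfolding \<psi>_def by (rule integral_abs_bound)
    also have "\<dots> \<le> (\<integral>r. C \<partial>coin)"
      using \<phi>C order.trans[OF abs_ge_zero \<phi>C] by (intro integral_mono coin.integrable_const_bound[where B=C]) (auto simp: metropolis_step_def)
    finally show ?thesis by (simp add: coin.prob_space)
  qed
  have bi: "integrable \<pi> (\<lambda>z. indicator H (fst z) * h (fst z $ i))"
    if [measurable]: "h \<in> borel_measurable borel" "H \<in> sets borel" and "\<And>z. \<bar>h z\<bar> \<le> C" for h :: "real \<Rightarrow> real" and H
    using that(3) abs_ge_zero[of "h 0"] order.trans[OF abs_ge_zero that(3)]
    by (intro integrable_const_bound[where B=C]) (auto simp: indicator_def)
  have "(\<integral>z. \<phi> (X' z $ i) \<partial>P) = (\<integral>z. \<integral>r. \<phi> (X' (z, r) $ i) \<partial>coin \<partial>\<pi>)"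
    by (rule P.integral_fst'[OF int, symmetric])
  also have "\<dots> = (\<integral>z. indicator G (fst z) * \<psi> (fst z $ i) + indicator (- G) (fst z) * \<phi> (fst z $ i) \<partial>\<pi>)"
    by (intro Bochner_Integration.integral_cong)
      (auto simp: X'_nth jump_def \<psi>_def indicator_def coin.prob_space)
  also have "\<dots> = (\<integral>z. indicator G (fst z) * \<psi> (fst z $ i) \<partial>\<pi>) + (\<integral>z. indicator (- G) (fst z) * \<phi> (fst z $ i) \<partial>\<pi>)"
    using \<psi>C \<phi>C by (intro Bochner_Integration.integral_add bi) auto
  also have "(\<integral>z. indicator G (fst z) * \<psi> (fst z $ i) \<partial>\<pi>) = (\<integral>z. indicator G (fst z) * \<phi> (fst z $ i) \<partial>\<pi>)"
    unfolding integral_dens[OF \<psi>m] integral_dens[OF assms(1)] unfolding \<psi>_def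
    by (rule metropolis_stationary[OF integrable_dens dens_nonneg assms(1) \<phi>C])
  also have "\<dots> + (\<integral>z. indicator (- G) (fst z) * \<phi> (fst z $ i) \<partial>\<pi>)
      = (\<integral>z. indicator G (fst z) * \<phi> (fst z $ i) + indicator (- G) (fst z) * \<phi> (fst z $ i) \<partial>\<pi>)"
    using \<phi>C by (intro Bochner_Integration.integral_add[symmetric] bi) auto
  also have "\<dots> = (\<integral>z. \<phi> (fst z $ i) \<partial>\<pi>)"
    by (intro Bochner_Integration.integral_cong) (auto simp: indicator_def)
  finally show ?thesis .
qed

section \<open>Size of the displacement error\<close>

definition rejection :: "'n \<Rightarrow> real" where
  "rejection i = (\<integral>z. \<bar>dens i (z + t * c i) - dens i z\<bar> \<partial>lborel) + (\<integral>z. \<bar>dens i (z - t * c i) - dens i z\<bar> \<partial>lborel)"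

text \<open>On acceptance the error is only the deviation of the drift from \<open>c\<close>; on
  rejection the whole drift is missing. The crude bound limits the exchange rates pointwise, the
  refined one is for the mean error.\<close>

lemma err_le: "\<bar>err i x r\<bar> \<le> indicator G x * (t * (2 * \<bar>c i\<bar> + \<epsilon>))"
  and err_le': "\<bar>err i x r\<bar> \<le> indicator G x * (t * \<epsilon> + t * \<bar>c i\<bar> *
    of_bool (metropolis_step (dens i) (t * c i) r (x $ i) \<noteq> sign_of (fst r) * (t * c i)))"
proof -
  have *: "\<bar>err i x r\<bar> \<le> t * \<epsilon> + t * \<bar>c i\<bar> *
    of_bool (metropolis_step (dens i) (t * c i) r (x $ i) \<noteq> sign_of (fst r) * (t * c i))" if "x \<in> G"
  proof (cases "metropolis_step (dens i) (t * c i) r (x $ i) = sign_of (fst r) * (t * c i)")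
    case True
    then have "err i x r = sign_of (fst r) * (t * (c i - drift x $ i))"
      using that by (simp add: err_def jump_def algebra_simps)
    then have "\<bar>err i x r\<bar> = t * \<bar>drift x $ i - c i\<bar>"
      using t_pos by (simp add: abs_mult abs_minus_commute)
    then show ?thesis using True drift_near[OF that, of i] t_pos by simp
  next
    case False
    then have "metropolis_step (dens i) (t * c i) r (x $ i) = 0" by (auto simp: metropolis_step_def split: if_splits)
    then have "err i x r = - sign_of (fst r) * (t * drift x $ i)"
      using that by (simp add: err_def jump_def)
    then have "\<bar>err i x r\<bar> = t * \<bar>drift x $ i\<bar>"
      using t_pos by (simp add: abs_mult)
    also have "\<dots> \<le> t * (\<epsilon> + \<bar>c i\<bar>)"
      using drift_near[OF that, of i] t_pos by (intro mult_left_mono) auto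
    finally show ?thesis using False by (simp add: distrib_left)
  qed
  show "\<bar>err i x r\<bar> \<le> indicator G x * (t * \<epsilon> + t * \<bar>c i\<bar> *
    of_bool (metropolis_step (dens i) (t * c i) r (x $ i) \<noteq> sign_of (fst r) * (t * c i)))"
    using * by (cases "x \<in> G") (simp_all add: err_def jump_def)
  have "t * \<epsilon> + t * \<bar>c i\<bar> * of_bool B \<le> t * (2 * \<bar>c i\<bar> + \<epsilon>)" for B
    using t_pos by (auto simp: algebra_simps)
  from order.trans[OF * this] show "\<bar>err i x r\<bar> \<le> indicator G x * (t * (2 * \<bar>c i\<bar> + \<epsilon>))"
    by (cases "x \<in> G") (simp_all add: err_def jump_def)
qed

lemma integrable_err: "integrable P (\<lambda>z. err i (fst (fst z)) (snd z))"
proof (rule P.P.integrable_const_bound[where B="t * (2 * \<bar>c i\<bar> + \<epsilon>)"])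
  have "0 \<le> t * (2 * \<bar>c i\<bar> + \<epsilon>)" using t_pos \<epsilon>_pos by simp
  then show "AE z in P. norm (err i (fst (fst z)) (snd z)) \<le> t * (2 * \<bar>c i\<bar> + \<epsilon>)"
    using err_le[of i] by (intro AE_I2) (auto intro!: order.trans[OF err_le] simp: indicator_def)
qed measurable

lemma integral_abs_err_le:
  "(\<integral>z. \<bar>err i (fst (fst z)) (snd z)\<bar> \<partial>P) \<le> t * (\<epsilon> * measure \<rho> G + \<bar>c i\<bar> * rejection i)"
proof -
  define B where "B r z = (of_bool (metropolis_step (dens i) (t * c i) r z \<noteq> sign_of (fst r) * (t * c i)) :: real)" for r z
  have Bm: "(\<lambda>p. B (fst p) (snd p)) \<in> borel_measurable (coin \<Otimes>\<^sub>M borel)"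
    unfolding B_def of_bool_def by measurable
  have Bm'[measurable]: "(\<lambda>z. B (snd z) (fst (fst z) $ i)) \<in> borel_measurable P"
    using measurable_compose[OF _ Bm, of "\<lambda>z. (snd z, fst (fst z) $ i)" P] by simp
  have GB: "integrable P (\<lambda>z. indicator G (fst (fst z)) * B (snd z) (fst (fst z) $ i))"
  proof (rule P.P.integrable_const_bound[where B=1])
    show "AE z in P. norm (indicator G (fst (fst z)) * B (snd z) (fst (fst z) $ i)) \<le> 1"
      by (auto simp: B_def indicator_def)
  qed measurable
  have Gi: "integrable P (\<lambda>z. indicator G (fst (fst z)) :: real)"
    by (rule P.P.integrable_const_bound[where B=1]) (auto simp: indicator_def)
  have "(\<integral>z. \<bar>err i (fst (fst z)) (snd z)\<bar> \<partial>P)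
      \<le> (\<integral>z. t * \<epsilon> * indicator G (fst (fst z)) + t * \<bar>c i\<bar> * (indicator G (fst (fst z)) * B (snd z) (fst (fst z) $ i)) \<partial>P)"
  proof (rule integral_mono)
    show "\<bar>err i (fst (fst z)) (snd z)\<bar> \<le> t * \<epsilon> * indicator G (fst (fst z))
      + t * \<bar>c i\<bar> * (indicator G (fst (fst z)) * B (snd z) (fst (fst z) $ i))" for z
      using err_le'[of i "fst (fst z)" "snd z"] by (simp add: B_def algebra_simps)
  qed (use integrable_err[of i] GB Gi in auto)
  also have "\<dots> = t * \<epsilon> * (\<integral>z. indicator G (fst (fst z)) \<partial>P)
      + t * \<bar>c i\<bar> * (\<integral>z. indicator G (fst (fst z)) * B (snd z) (fst (fst z) $ i) \<partial>P)"
    using GB Gi by simp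
  also have "(\<integral>z. indicator G (fst (fst z)) \<partial>P) = measure \<rho> G"
  proof -
    have "integrable \<pi> (\<lambda>z. indicator G (fst z) :: real)"
      by (rule integrable_const_bound[where B=1]) (auto simp: indicator_def)
    from integrable_fst_P(2)[OF this] have "(\<integral>z. indicator G (fst (fst z)) \<partial>P) = (\<integral>z. indicator G (fst z) \<partial>\<pi> :: real)" .
    also have "\<dots> = (\<integral>x. indicator G x \<partial>\<rho>)" by (subst integral_distr) auto
    also have "\<dots> = measure \<rho> G" by (subst Bochner_Integration.integral_indicator) auto
    finally show ?thesis .
  qed
  finally have main: "(\<integral>z. \<bar>err i (fst (fst z)) (snd z)\<bar> \<partial>P) \<le> t * \<epsilon> * measure \<rho> G
      + t * \<bar>c i\<bar> * (\<integral>z. indicator G (fst (fst z)) * B (snd z) (fst (fst z) $ i) \<partial>P)" .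
  have "(\<integral>z. indicator G (fst (fst z)) * B (snd z) (fst (fst z) $ i) \<partial>P) \<le> rejection i"
  proof -
    have [measurable]: "(\<lambda>z. \<integral>r. B r z \<partial>coin) \<in> borel_measurable borel"
      using measurable_compose[OF _ Bm, of "\<lambda>p. (snd p, fst p)" "borel \<Otimes>\<^sub>M coin"]
      by (intro coin.borel_measurable_lebesgue_integral) (simp add: split_def)
    have "(\<integral>z. indicator G (fst (fst z)) * B (snd z) (fst (fst z) $ i) \<partial>P)
        = (\<integral>z. indicator G (fst z) * (\<integral>r. B r (fst z $ i) \<partial>coin) \<partial>\<pi>)"
      by (subst P.integral_fst'[OF GB, symmetric]) simp
    also have "\<dots> = (\<integral>z. dens i z * (\<integral>r. B r z \<partial>coin) \<partial>lborel)"
      by (rule integral_dens) measurable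
    also have "\<dots> \<le> rejection i"
      unfolding B_def rejection_def by (rule metropolis_rejection[OF integrable_dens dens_nonneg])
    finally show ?thesis .
  qed
  then have "t * \<bar>c i\<bar> * (\<integral>z. indicator G (fst (fst z)) * B (snd z) (fst (fst z) $ i) \<partial>P)
      \<le> t * \<bar>c i\<bar> * rejection i"
    using t_pos by (intro mult_left_mono) auto
  with main show ?thesis by (simp add: algebra_simps)
qed

definition mass :: "(real ^ 'n) set \<Rightarrow> real ^ 'n \<Rightarrow> bool \<times> real \<Rightarrow> real" where
  "mass S x r = (\<integral>y. indicator S y \<partial>K x) +
    sign_of (fst r) * (\<integral>y. indicator S y * (indicator G x * (\<sigma> (x, y) + t * \<tau> (x, y))) \<partial>K x)"

lemma mass_measurable:
  assumes [measurable]: "S \<in> sets borel"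
  shows "(\<lambda>z. mass S (fst (fst z)) (snd z)) \<in> borel_measurable P"
proof -
  have [measurable]: "(\<lambda>x. \<integral>y. indicator S y \<partial>K x :: real) \<in> borel_measurable borel"
    "(\<lambda>x. \<integral>y. indicator S y * (indicator G x * (\<sigma> (x, y) + t * \<tau> (x, y))) \<partial>K x) \<in> borel_measurable borel"
    using integral_K_measurable[of "\<lambda>z. indicator S (snd z)"]
      integral_K_measurable[of "\<lambda>z. indicator S (snd z) * (indicator G (fst z) * (\<sigma> z + t * \<tau> z))"] by simp_all
  show ?thesis unfolding mass_def by measurable
qed

lemma mass_eq:
  assumes [measurable]: "S \<in> sets borel"
  shows "(\<integral>y. weight ((x, y), r) * indicator S y \<partial>K x) = mass S x r"
    and "integrable (K x) (\<lambda>y. weight ((x, y), r) * indicator S y)"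
    and "measure (K x) S / 2 \<le> mass S x r"
proof -
  have i: "integrable (K x) (indicator S :: _ \<Rightarrow> real)"
    by (rule integrable_K_bounded[where C=1]) (auto simp: indicator_def)
  have bound: "\<bar>indicator S y * (indicator G x * (\<sigma> (x, y) + t * \<tau> (x, y)))\<bar> \<le> 1 / 2" for y
    using tilt_le[of x y] by (simp add: indicator_def)
  have i2: "integrable (K x) (\<lambda>y. indicator S y * (indicator G x * (\<sigma> (x, y) + t * \<tau> (x, y))))"
    by (rule integrable_K_bounded[OF _ bound]) measurable
  show eq: "(\<integral>y. weight ((x, y), r) * indicator S y \<partial>K x) = mass S x r"
  proof -
    have "(\<integral>y. weight ((x, y), r) * indicator S y \<partial>K x) = (\<integral>y. indicator S y + sign_of (fst r) *
        (indicator S y * (indicator G x * (\<sigma> (x, y) + t * \<tau> (x, y)))) \<partial>K x)"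
      by (intro Bochner_Integration.integral_cong) (auto simp: weight_def algebra_simps)
    also have "\<dots> = mass S x r" unfolding mass_def using i i2 by (simp del: Bochner_Integration.integral_indicator)
    finally show ?thesis .
  qed
  show i3: "integrable (K x) (\<lambda>y. weight ((x, y), r) * indicator S y)"
    using weight_bounds weight_nonneg by (intro integrable_K_bounded_mult[where C="3/2"] i) auto
  have "(\<integral>y. (1 / 2) * indicator S y \<partial>K x) \<le> (\<integral>y. weight ((x, y), r) * indicator S y \<partial>K x)"
    using i i3 weight_bounds(1) by (intro integral_mono mult_right_mono) auto
  then show "measure (K x) S / 2 \<le> mass S x r"
    unfolding eq by simp
qed

section \<open>Exchange rates that compensate the error\<close>

definition lower :: "'n \<Rightarrow> (real ^ 'n) set" where "lower i = {y. y $ i \<le> a i}"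
definition upper :: "'n \<Rightarrow> (real ^ 'n) set" where "upper i = {y. b i \<le> y $ i}"

lemma lower_upper_measurable [measurable]: "lower i \<in> sets borel" "upper i \<in> sets borel"
  by (simp_all add: lower_def upper_def)

text \<open>A nonzero error excludes the alternative of \<open>spread\<close> in which the
  coordinate has neither drift nor step; the other one gives mass \<open>m\<close>, of which the
  weight keeps at least half.\<close>

lemma mass_ge_if_err:
  assumes "err i x r \<noteq> 0"
  shows "m / 2 \<le> mass (lower i) x r" "m / 2 \<le> mass (upper i) x r"
proof -
  have x: "x \<in> G" using assms by (auto simp: err_def jump_def split: split_indicator_asm)
  have "\<not> (drift x $ i = 0 \<and> c i = 0)"
    using assms by (auto simp: err_def jump_def metropolis_step_def split: if_splits)
  then have "m \<le> measure (K x) (lower i)" "m \<le> measure (K x) (upper i)"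
    using spread[OF x, of i] by (auto simp: drift_def lower_def upper_def)
  then show "m / 2 \<le> mass (lower i) x r" "m / 2 \<le> mass (upper i) x r"
    using mass_eq(3)[of "lower i" x r] mass_eq(3)[of "upper i" x r] by auto
qed

text \<open>The rates \<open>p\<close> and \<open>q\<close> of \<open>exchange_repair\<close>: conditionally on \<open>x\<close> and the coin they have mean
  \<open>max 0 err\<close> and \<open>max 0 (- err)\<close>. The divisor \<open>mass\<close> may vanish only where \<open>err = 0\<close>.\<close>

definition raise :: "'n \<Rightarrow> ((real ^ 'n) \<times> (real ^ 'n)) \<times> bool \<times> real \<Rightarrow> real" where
  "raise i z = max 0 (err i (fst (fst z)) (snd z)) * (indicator (lower i) (snd (fst z)) / mass (lower i) (fst (fst z)) (snd z))"

definition drop :: "'n \<Rightarrow> ((real ^ 'n) \<times> (real ^ 'n)) \<times> bool \<times> real \<Rightarrow> real" where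
  "drop i z = max 0 (- err i (fst (fst z)) (snd z)) * (indicator (upper i) (snd (fst z)) / mass (upper i) (fst (fst z)) (snd z))"

lemma raise_drop_measurable [measurable]: "raise i \<in> borel_measurable P" "drop i \<in> borel_measurable P"
  using mass_measurable[of "lower i"] mass_measurable[of "upper i"]
  unfolding raise_def drop_def by measurable

lemma raise_drop_bounds:
  "0 \<le> raise i z" "raise i z \<le> max 0 (err i (fst (fst z)) (snd z)) * (2 / m)"
  "0 \<le> drop i z" "drop i z \<le> max 0 (- err i (fst (fst z)) (snd z)) * (2 / m)"
proof -
  let ?x = "fst (fst z)" and ?r = "snd z"
  have frac: "0 \<le> max 0 e * (indicator S y / k) \<and> max 0 e * (indicator S y / k) \<le> max 0 e * (2 / m)"
    if "e \<noteq> 0 \<Longrightarrow> m / 2 \<le> k" for e k :: real and S and y :: "real ^ 'n"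
  proof (cases "e = 0")
    case False
    then have k: "m / 2 \<le> k" using that by simp
    then have k0: "0 < k" using m_pos by linarith
    have "indicator S y / k \<le> 1 / k" using k0 by (intro divide_right_mono) (auto simp: indicator_def)
    also have "\<dots> \<le> 1 / (m / 2)" using k m_pos by (intro divide_left_mono) auto
    also have "\<dots> = 2 / m" by simp
    finally show ?thesis using k0 by (intro conjI mult_left_mono mult_nonneg_nonneg) auto
  qed simp
  show "0 \<le> raise i z" "raise i z \<le> max 0 (err i ?x ?r) * (2 / m)"
    using frac[of "err i ?x ?r"] mass_ge_if_err(1)[of i ?x ?r] unfolding raise_def by blast+
  show "0 \<le> drop i z" "drop i z \<le> max 0 (- err i ?x ?r) * (2 / m)"
    using frac[of "- err i ?x ?r"] mass_ge_if_err(2)[of i ?x ?r] unfolding drop_def by auto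
qed

lemma raise_drop_sum: "raise i z + drop i z \<le> (b i - a i) / CARD('n)"
proof -
  let ?e = "err i (fst (fst z)) (snd z)"
  have "raise i z + drop i z \<le> max 0 ?e * (2 / m) + max 0 (- ?e) * (2 / m)"
    using raise_drop_bounds[of i z] by linarith
  also have "\<dots> = \<bar>?e\<bar> * (2 / m)" by (simp add: max_def)
  also have "\<dots> \<le> (t * (2 * \<bar>c i\<bar> + \<epsilon>)) * (2 / m)"
  proof (rule mult_right_mono)
    have "0 \<le> t * (2 * \<bar>c i\<bar> + \<epsilon>)" using t_pos \<epsilon>_pos by simp
    then show "\<bar>?e\<bar> \<le> t * (2 * \<bar>c i\<bar> + \<epsilon>)"
      using err_le[of i "fst (fst z)" "snd z"] by (cases "fst (fst z) \<in> G") auto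
  qed (use m_pos in simp)
  also have "\<dots> \<le> (b i - a i) / CARD('n)" by (rule t_small)
  finally show ?thesis .
qed

lemma integral_K_raise_drop:
  "integrable (K x) (\<lambda>y. weight ((x, y), r) * raise i ((x, y), r))"
  "(\<integral>y. weight ((x, y), r) * raise i ((x, y), r) \<partial>K x) = max 0 (err i x r)"
  "integrable (K x) (\<lambda>y. weight ((x, y), r) * drop i ((x, y), r))"
  "(\<integral>y. weight ((x, y), r) * drop i ((x, y), r) \<partial>K x) = max 0 (- err i x r)"
proof -
  have raise: "weight ((x, y), r) * raise i ((x, y), r)
      = max 0 (err i x r) / mass (lower i) x r * (weight ((x, y), r) * indicator (lower i) y)" for y
    by (simp add: raise_def)
  have drop: "weight ((x, y), r) * drop i ((x, y), r)
      = max 0 (- err i x r) / mass (upper i) x r * (weight ((x, y), r) * indicator (upper i) y)" for y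
    by (simp add: drop_def)
  have k: "mass (lower i) x r \<noteq> 0 \<and> mass (upper i) x r \<noteq> 0" if "err i x r \<noteq> 0"
    using mass_ge_if_err[OF that] m_pos by auto
  show "integrable (K x) (\<lambda>y. weight ((x, y), r) * raise i ((x, y), r))"
    "integrable (K x) (\<lambda>y. weight ((x, y), r) * drop i ((x, y), r))"
    unfolding raise drop by (intro integrable_mult_right mass_eq(2) lower_upper_measurable)+
  show "(\<integral>y. weight ((x, y), r) * raise i ((x, y), r) \<partial>K x) = max 0 (err i x r)"
    "(\<integral>y. weight ((x, y), r) * drop i ((x, y), r) \<partial>K x) = max 0 (- err i x r)"
    unfolding raise drop integral_mult_right_zero mass_eq(1)[OF lower_upper_measurable(1)] mass_eq(1)[OF lower_upper_measurable(2)]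
    using k by (cases "err i x r = 0"; simp)+
qed

lemma integrable_raise_drop: "integrable P (raise i)" "integrable P (drop i)"
proof -
  have le: "raise i z \<le> (b i - a i) / CARD('n)" "drop i z \<le> (b i - a i) / CARD('n)" for z
    using raise_drop_bounds(1,3)[of i z] raise_drop_sum[of i z] by linarith+
  show "integrable P (raise i)"
    by (rule P.P.integrable_const_bound[where B="(b i - a i) / CARD('n)"])
      (use le(1) raise_drop_bounds(1) in auto)
  show "integrable P (drop i)"
    by (rule P.P.integrable_const_bound[where B="(b i - a i) / CARD('n)"])
      (use le(2) raise_drop_bounds(3) in auto)
qed

lemma integrable_X': "integrable P (\<lambda>z :: ((real ^ 'n) \<times> (real ^ 'n)) \<times> bool \<times> real. X' z $ i)"
proof (rule Bochner_Integration.integrable_bound)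
  show "integrable P (\<lambda>z. \<bar>fst (fst z) $ i\<bar> + \<bar>t * c i\<bar>)"
    using integrable_fst_P(1)[OF integrable_X[of i]] by auto
  show "AE z in P. norm (X' z $ i) \<le> norm (\<bar>fst (fst z) $ i\<bar> + \<bar>t * c i\<bar>)"
  proof (rule AE_I2)
    fix z :: "((real ^ 'n) \<times> (real ^ 'n)) \<times> bool \<times> real"
    have "\<bar>jump i (fst (fst z)) (snd z)\<bar> \<le> \<bar>t * c i\<bar>"
      using abs_metropolis_step_le[of "dens i" "t * c i" "snd z" "fst (fst z) $ i"]
      by (auto simp: jump_def indicator_def)
    then show "norm (X' z $ i) \<le> norm (\<bar>fst (fst z) $ i\<bar> + \<bar>t * c i\<bar>)"
      by (simp add: X'_nth)
  qed
qed (simp add: X'_nth)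

section \<open>The reweighted space and its marginals\<close>

definition Q :: "(((real ^ 'n) \<times> (real ^ 'n)) \<times> bool \<times> real) measure" where
  "Q = density P (\<lambda>z. ennreal (weight z))"

lemma Q_cong [measurable_cong]: "sets Q = sets P"
  by (simp add: Q_def)

lemma integral_Q: "f \<in> borel_measurable P \<Longrightarrow> (\<integral>z. f z \<partial>Q) = (\<integral>z. weight z * f z \<partial>P)" for f :: "_ \<Rightarrow> real"
  unfolding Q_def using weight_nonneg by (subst integral_density) auto

lemma integrable_Q: "integrable P f \<Longrightarrow> integrable Q f" for f :: "_ \<Rightarrow> real"
  unfolding Q_def using weight_nonneg integrable_weight by (subst integrable_density) auto

lemma prob_space_Q: "prob_space Q"
proof (rule prob_spaceI)
  have i1: "integrable \<pi> (\<lambda>z. 1 :: real)" by simp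
  have w: "integrable P (\<lambda>z. weight z * 1)" by (rule integrable_weight) simp
  have "emeasure Q (space Q) = (\<integral>\<^sup>+z. ennreal (weight z * 1) \<partial>P)"
    unfolding Q_def by (subst emeasure_density) (auto intro!: nn_integral_cong)
  also have "\<dots> = ennreal (\<integral>z. weight z * 1 \<partial>P)"
    using weight_nonneg by (intro nn_integral_eq_integral w) auto
  also have "(\<integral>z. weight z * 1 \<partial>P) = 1"
    using integral_weight_fst[OF i1] by (simp add: prob_space)
  finally show "emeasure Q (space Q) = 1" by simp
qed

lemma integral_Q_raise: "(\<integral>z. raise i z \<partial>Q) = (\<integral>z. max 0 (err i (fst (fst z)) (snd z)) \<partial>P)"
proof -
  have ie: "integrable P (\<lambda>z. max 0 (err i (fst (fst z)) (snd z)))"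
    using integrable_err[of i] by (intro integrable_max) auto
  have "(\<integral>z. weight z * raise i z - max 0 (err i (fst (fst z)) (snd z)) \<partial>P) = 0"
  proof (rule integral_pair_eq_0)
    show "AE x in \<rho>. \<forall>r. (\<integral>y. weight ((x, y), r) * raise i ((x, y), r)
        - max 0 (err i (fst (fst ((x, y), r))) (snd ((x, y), r))) \<partial>K x) = 0"
      using integral_K_raise_drop(1,2) by simp
  qed (use ie integrable_weight[OF integrable_raise_drop(1)] in \<open>auto intro: coin.sigma_finite_measure_axioms\<close>)
  then show ?thesis
    using ie integrable_weight[OF integrable_raise_drop(1)] by (simp add: integral_Q)
qed

text \<open>Given \<open>x\<close> and the coin, \<open>X'\<close> is constant, so the test set
  factors out. The tilted mean of \<open>Y i\<close> falls short of \<open>X'\<close> by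
  \<open>err\<close>, and \<open>raise\<close> minus \<open>drop\<close> adds
  \<open>max 0 err - max 0 (- err) = err\<close>. Conditioning on \<open>x\<close> and the coin is
  finer than conditioning on \<open>X'\<close>, hence suffices.\<close>

lemma martingale_Q:
  assumes A[measurable]: "A \<in> sets borel"
  shows "(\<integral>z. indicator A (X' z) * (snd (fst z) $ i + raise i z - drop i z - X' z $ i) \<partial>Q) = 0"
proof -
  have i0: "integrable P (\<lambda>z. snd (fst z) $ i + raise i z - drop i z - X' z $ i)"
    using integrable_fst_P(1)[OF integrable_Y[of i]] integrable_raise_drop integrable_X' by simp
  have i1: "integrable P (\<lambda>z. indicator A (X' z) * (snd (fst z) $ i + raise i z - drop i z - X' z $ i))"
    by (rule Bochner_Integration.integrable_bound[OF i0]) (use i0 in \<open>auto simp: indicator_def\<close>)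
  have "(\<integral>z. weight z * (indicator A (X' z) * (snd (fst z) $ i + raise i z - drop i z - X' z $ i)) \<partial>P) = 0"
  proof (rule integral_pair_eq_0[OF coin.sigma_finite_measure_axioms integrable_weight[OF i1]])
    show "AE x in \<rho>. \<forall>r. (\<integral>y. weight ((x, y), r) * (indicator A (X' ((x, y), r)) *
       (snd (fst ((x, y), r)) $ i + raise i ((x, y), r) - drop i ((x, y), r) - X' ((x, y), r) $ i)) \<partial>K x) = 0"
      using AE_centered
    proof eventually_elim
      case (elim x)
      show ?case
      proof
        fix r
        \<comment> \<open>\<open>X'\<close> ignores \<open>y\<close>, so an arbitrary value, here 0,
          names the common position.\<close>
        define x' where "x' = X' ((x, 0), r)"
        have X'c: "X' ((x, y), r) = x'" for y by (simp add: X'_def x'_def)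
        have iw: "integrable (K x) (\<lambda>y. weight ((x, y), r))"
          using weight_bounds weight_nonneg by (intro integrable_K_bounded[where C="3/2"]) auto
        have "(\<integral>y. weight ((x, y), r) * (indicator A (X' ((x, y), r)) *
            (snd (fst ((x, y), r)) $ i + raise i ((x, y), r) - drop i ((x, y), r) - X' ((x, y), r) $ i)) \<partial>K x)
          = (\<integral>y. indicator A x' * (weight ((x, y), r) * y $ i + weight ((x, y), r) * raise i ((x, y), r)
            - weight ((x, y), r) * drop i ((x, y), r) - weight ((x, y), r) * x' $ i) \<partial>K x)"
          unfolding X'c by (simp add: algebra_simps)
        also have "\<dots> = indicator A x' * ((x $ i + indicator G x * (sign_of (fst r) * t * drift x $ i))
            + max 0 (err i x r) - max 0 (- err i x r) - x' $ i)"
          using integral_K_weight_nth[OF elim, of r i] integral_K_raise_drop[of x r i] iw integral_K_weight[of x r]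
          by simp
        also have "\<dots> = 0" by (simp add: x'_def X'_nth err_def max_def)
        finally show "(\<integral>y. weight ((x, y), r) * (indicator A (X' ((x, y), r)) *
            (snd (fst ((x, y), r)) $ i + raise i ((x, y), r) - drop i ((x, y), r) - X' ((x, y), r) $ i)) \<partial>K x) = 0" .
      qed
    qed
  qed
  moreover have "(\<lambda>z. indicator A (X' z) * (snd (fst z) $ i + raise i z - drop i z - X' z $ i)) \<in> borel_measurable P"
    using i1 by auto
  ultimately show ?thesis by (simp only: integral_Q)
qed

text \<open>\<open>X'\<close> depends on \<open>x\<close> and the coin only, so
  \<open>integral_weight_label\<close> removes the weight and stationarity under \<open>P\<close>
  finishes.\<close>

lemma distr_Q_X': "distr Q borel (\<lambda>z. X' z $ i) = distr \<pi> borel (\<lambda>z. fst z $ i)"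
proof (rule distr_eqI[OF prob_space_Q prob_space_\<pi>])
  fix A :: "real set" assume A[measurable]: "A \<in> sets borel"
  have i: "integrable P (\<lambda>z. indicator A (fst (fst z) $ i + jump i (fst (fst z)) (snd z)) :: real)"
    by (rule P.P.integrable_const_bound[where B=1]) (auto simp: indicator_def)
  have "(\<integral>z. indicator A (X' z $ i) \<partial>Q) = (\<integral>z. indicator A (X' z $ i) \<partial>P :: real)"
    using integral_weight_label[OF i] i by (simp add: integral_Q X'_nth)
  also have "\<dots> = (\<integral>z. indicator A (fst z $ i) \<partial>\<pi>)"
    by (rule integral_X'[where C=1]) (auto simp: indicator_def)
  finally show "(\<integral>z. indicator A (X' z $ i) \<partial>Q) = (\<integral>z. indicator A (fst z $ i) \<partial>\<pi> :: real)" .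
qed measurable

lemma distr_Q_Y: "distr Q borel (\<lambda>z. snd (fst z) $ i) = distr \<pi> borel (\<lambda>z. snd z $ i)"
proof (rule distr_eqI[OF prob_space_Q prob_space_\<pi>])
  fix A :: "real set" assume A[measurable]: "A \<in> sets borel"
  have i: "integrable \<pi> (\<lambda>z. indicator A (snd z $ i) :: real)"
    by (rule integrable_const_bound[where B=1]) (auto simp: indicator_def)
  show "(\<integral>z. indicator A (snd (fst z) $ i) \<partial>Q) = (\<integral>z. indicator A (snd z $ i) \<partial>\<pi> :: real)"
    using integral_weight_fst[OF i] by (subst integral_Q) auto
qed measurable

text \<open>The coordinates of \<open>X'\<close> and \<open>Y\<close> have the laws they had under
  \<open>\<pi>\<close>, hence equal means; \<open>martingale_Q\<close> on the whole space then
  balances the two rates, as \<open>exchange_repair\<close> requires.\<close>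

lemma integral_raise_eq_drop: "(\<integral>z. raise i z \<partial>Q) = (\<integral>z. drop i z \<partial>Q)"
proof -
  note int = integrable_Q[OF integrable_fst_P(1)[OF integrable_Y[of i]]] integrable_Q[OF integrable_raise_drop(1)[of i]]
    integrable_Q[OF integrable_raise_drop(2)[of i]] integrable_Q[OF integrable_X'[of i]]
  have "(\<integral>z. X' z $ i \<partial>Q) = (\<integral>u. u \<partial>distr Q borel (\<lambda>z. X' z $ i))"
    by (subst integral_distr) (auto simp: X'_nth)
  also have "\<dots> = (\<integral>z. fst z $ i \<partial>\<pi>)"
    unfolding distr_Q_X' by (subst integral_distr) auto
  also have "\<dots> = (\<integral>z. snd z $ i \<partial>\<pi>)"
    using martingale[of UNIV i] integrable_X[of i] integrable_Y[of i] by simp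
  also have "\<dots> = (\<integral>z. snd (fst z) $ i \<partial>Q)"
    using integral_weight_fst[OF integrable_Y[of i]] by (subst integral_Q) auto
  finally show ?thesis using martingale_Q[of UNIV i] int by simp
qed

text \<open>The first integral is the cost of the ideal competitor, which moves \<open>x\<close>
  exactly to the tilted conditional mean and need not have the right marginals. Passing to
  \<open>X'\<close> costs the mean error once, and \<open>exchange_repair\<close> costs it at most
  twice, whence the factor 3.\<close>

lemma tilted_cost_le:
  "(\<integral>z. weight z * norm (fst (fst z) + (indicator G (fst (fst z)) * (sign_of (fst (snd z)) * t)) *\<^sub>R drift (fst (fst z)) - snd (fst z)) \<partial>P)
    - (\<integral>z. norm (fst z - snd z) \<partial>\<pi>) \<le> 3 * (\<Sum>i\<in>UNIV. t * (\<epsilon> * measure \<rho> G + \<bar>c i\<bar> * rejection i))"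
proof -
  define E where "E i = (\<integral>z. \<bar>err i (fst (fst z)) (snd z)\<bar> \<partial>P)" for i
  define N where "N z = norm (fst (fst z) + (indicator G (fst (fst z)) * (sign_of (fst (snd z)) * t)) *\<^sub>R drift (fst (fst z)) - snd (fst z))"
    for z :: "((real ^ 'n) \<times> (real ^ 'n)) \<times> bool \<times> real"
  have Nm[measurable]: "N \<in> borel_measurable P" unfolding N_def by measurable
  have XY: "\<exists>\<gamma>. prob_space \<gamma> \<and> sets \<gamma> = sets (borel :: ((real ^ 'n) \<times> (real ^ 'n)) measure) \<and>
    (\<forall>i. distr \<gamma> borel (\<lambda>z. fst z $ i) = distr Q borel (\<lambda>w. X' w $ i)) \<and>
    (\<forall>i. distr \<gamma> borel (\<lambda>z. snd z $ i) = distr Q borel (\<lambda>w. snd (fst w) $ i)) \<and>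
    (\<forall>i. \<forall>A\<in>sets borel. (\<integral>z. indicator A (fst z) * (snd z $ i - fst z $ i) \<partial>\<gamma>) = 0) \<and>
    (\<integral>w. norm (X' w - snd (fst w)) \<partial>Q) - 2 * (\<Sum>i\<in>UNIV. \<integral>w. raise i w \<partial>Q) \<le> (\<integral>z. norm (fst z - snd z) \<partial>\<gamma>)"
  proof (rule exchange_repair[where q=drop and a=a and b=b])
    show "raise i w \<noteq> 0 \<Longrightarrow> snd (fst w) $ i \<le> a i" for i w
      by (auto simp: raise_def lower_def indicator_def split: if_splits)
    show "drop i w \<noteq> 0 \<Longrightarrow> b i \<le> snd (fst w) $ i" for i w
      by (auto simp: drop_def upper_def indicator_def split: if_splits)
    show "X' \<in> borel_measurable Q" "(\<lambda>w. snd (fst w)) \<in> borel_measurable Q"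
      "raise i \<in> borel_measurable Q" "drop i \<in> borel_measurable Q" for i
      by measurable
    show "integrable Q (\<lambda>w. X' w $ i)" for i by (rule integrable_Q[OF integrable_X'])
    show "integrable Q (\<lambda>w. snd (fst w) $ i)" for i by (rule integrable_Q[OF integrable_fst_P(1)[OF integrable_Y]])
    show "raise i w + drop i w \<le> (b i - a i) / real CARD('n)" for i w by (rule raise_drop_sum)
  qed (rule prob_space_Q raise_drop_bounds(1) raise_drop_bounds(3) a_less_b integral_raise_eq_drop martingale_Q; assumption?)+
  then obtain \<gamma> where \<gamma>: "prob_space \<gamma>" "sets \<gamma> = sets borel"
    "\<And>i. distr \<gamma> borel (\<lambda>z. fst z $ i) = distr \<pi> borel (\<lambda>z. fst z $ i)"
    "\<And>i. distr \<gamma> borel (\<lambda>z. snd z $ i) = distr \<pi> borel (\<lambda>z. snd z $ i)"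
    "\<And>i A. A \<in> sets borel \<Longrightarrow> (\<integral>z. indicator A (fst z) * (snd z $ i - fst z $ i) \<partial>\<gamma>) = 0"
    and cost: "(\<integral>w. norm (X' w - snd (fst w)) \<partial>Q) - 2 * (\<Sum>i\<in>UNIV. \<integral>w. raise i w \<partial>Q) \<le> (\<integral>z. norm (fst z - snd z) \<partial>\<gamma>)"
    unfolding distr_Q_X' distr_Q_Y by blast
  have raiseE: "(\<integral>w. raise i w \<partial>Q) \<le> E i" for i
    unfolding integral_Q_raise E_def using integrable_err[of i]
    by (intro integral_mono integrable_max) auto
  have errQ: "integrable Q (\<lambda>z. \<bar>err i (fst (fst z)) (snd z)\<bar>)" "(\<integral>z. \<bar>err i (fst (fst z)) (snd z)\<bar> \<partial>Q) = E i" for i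
    using integrable_err[of i] integral_weight_label[of "\<lambda>x r. \<bar>err i x r\<bar>"]
    by (auto simp: E_def integral_Q intro!: integrable_Q)
  have XN: "N z - (\<Sum>i\<in>UNIV. \<bar>err i (fst (fst z)) (snd z)\<bar>) \<le> norm (X' z - snd (fst z))"
    for z
  proof -
    define u where "u = fst (fst z) + (indicator G (fst (fst z)) * (sign_of (fst (snd z)) * t)) *\<^sub>R drift (fst (fst z))"
    have "(X' z - u) $ i = err i (fst (fst z)) (snd z)" for i
      by (simp add: u_def X'_nth err_def)
    then have "norm (X' z - u) \<le> (\<Sum>i\<in>UNIV. \<bar>err i (fst (fst z)) (snd z)\<bar>)"
      using norm_le_l1_cart[of "X' z - u"] by simp
    moreover have "N z \<le> norm (X' z - snd (fst z)) + norm (X' z - u)"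
      using norm_triangle_ineq4[of "X' z - snd (fst z)" "X' z - u"] by (simp add: N_def u_def)
    ultimately show "N z - (\<Sum>i\<in>UNIV. \<bar>err i (fst (fst z)) (snd z)\<bar>) \<le> norm (X' z - snd (fst z))" by linarith
  qed
  have iXY: "integrable Q (\<lambda>z. norm (X' z - snd (fst z)))"
    using integrable_Q[OF integrable_X'] integrable_Q[OF integrable_fst_P(1)[OF integrable_Y]]
    by (intro integrable_norm_diff) auto
  have iN: "integrable Q N"
  proof (rule Bochner_Integration.integrable_bound)
    show "integrable Q (\<lambda>z. norm (X' z - snd (fst z)) + (\<Sum>i\<in>UNIV. \<bar>err i (fst (fst z)) (snd z)\<bar>))"
      using iXY errQ by simp
    show "AE z in Q. norm (N z) \<le> norm (norm (X' z - snd (fst z)) + (\<Sum>i\<in>UNIV. \<bar>err i (fst (fst z)) (snd z)\<bar>))"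
    proof (rule AE_I2)
      fix z
      have "0 \<le> N z" by (simp add: N_def)
      then show "norm (N z) \<le> norm (norm (X' z - snd (fst z)) + (\<Sum>i\<in>UNIV. \<bar>err i (fst (fst z)) (snd z)\<bar>))"
        using XN[of z] by simp
    qed
  qed measurable
  have "(\<integral>z. N z \<partial>Q) - (\<Sum>i\<in>UNIV. E i) = (\<integral>z. N z - (\<Sum>i\<in>UNIV. \<bar>err i (fst (fst z)) (snd z)\<bar>) \<partial>Q)"
    using iN errQ by simp
  also have "\<dots> \<le> (\<integral>z. norm (X' z - snd (fst z)) \<partial>Q)"
    using iN errQ iXY XN by (intro integral_mono) auto
  also have "\<dots> \<le> (\<integral>z. norm (fst z - snd z) \<partial>\<pi>) + 2 * (\<Sum>i\<in>UNIV. E i)"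
    using cost optimal[OF \<gamma>] sum_mono[of UNIV "\<lambda>i. \<integral>w. raise i w \<partial>Q" E, OF raiseE] by simp
  finally have "(\<integral>z. N z \<partial>Q) - (\<integral>z. norm (fst z - snd z) \<partial>\<pi>) \<le> 3 * (\<Sum>i\<in>UNIV. E i)" by simp
  also have "\<dots> \<le> 3 * (\<Sum>i\<in>UNIV. t * (\<epsilon> * measure \<rho> G + \<bar>c i\<bar> * rejection i))"
    using integral_abs_err_le unfolding E_def by (intro mult_left_mono sum_mono) auto
  finally show ?thesis by (simp add: integral_Q N_def[abs_def])
qed

text \<open>A lower bound for the difference quotient of the cost, by convexity of the norm.\<close>

definition quotient :: "(real ^ 'n) \<times> (real ^ 'n) \<Rightarrow> real" where
  "quotient z = indicator G (fst z) * (norm (drift (fst z)) * of_bool (snd z = fst z) + (\<sigma> z + t * \<tau> z) *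
    ((norm (fst z - snd z + t *\<^sub>R drift (fst z)) - norm (fst z - snd z - t *\<^sub>R drift (fst z))) / (2 * t)))"

lemma quotient_measurable [measurable]: "quotient \<in> borel_measurable \<pi>"
  unfolding quotient_def by measurable

lemma symmetric_quotient_norm_le:
  "\<bar>(norm (u + t *\<^sub>R v) - norm (u - t *\<^sub>R v)) / (2 * t)\<bar> \<le> norm v" for u v :: "real ^ 'n"
proof -
  have "\<bar>norm (u + t *\<^sub>R v) - norm (u - t *\<^sub>R v)\<bar> \<le> norm ((u + t *\<^sub>R v) - (u - t *\<^sub>R v))"
    by (rule norm_triangle_ineq3)
  also have "(u + t *\<^sub>R v) - (u - t *\<^sub>R v) = (2 * t) *\<^sub>R v" by (simp add: scaleR_2[symmetric])
  finally show ?thesis using t_pos by (simp add: field_simps)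
qed

text \<open>The bound does not depend on \<open>t\<close>, so it can serve as dominating constant
  when the scale tends to 0.\<close>

lemma quotient_bounded: "\<bar>quotient z\<bar> \<le> 2 * (\<Sum>i\<in>UNIV. \<bar>c i\<bar> + \<epsilon>)"
proof (cases "fst z \<in> G")
  case True
  let ?v = "norm (drift (fst z))"
  have "\<bar>\<sigma> z + t * \<tau> z\<bar> \<le> 1 / 2"
    using tilt_le[of "fst z" "snd z"] True by simp
  define w where "w = (\<sigma> z + t * \<tau> z) * ((norm (fst z - snd z + t *\<^sub>R drift (fst z)) - norm (fst z - snd z - t *\<^sub>R drift (fst z))) / (2 * t))"
  have "\<bar>w\<bar> \<le> 1 / 2 * ?v"
    unfolding w_def abs_mult[of "\<sigma> z + t * \<tau> z"] using \<open>\<bar>\<sigma> z + t * \<tau> z\<bar> \<le> 1 / 2\<close>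
    by (intro mult_mono symmetric_quotient_norm_le) auto
  moreover have "quotient z = ?v * of_bool (snd z = fst z) + w"
    using True by (simp add: quotient_def w_def)
  moreover have "\<bar>?v * of_bool (snd z = fst z)\<bar> \<le> ?v" by simp
  ultimately have "\<bar>quotient z\<bar> \<le> 1 / 2 * ?v + ?v" by linarith
  also have "\<dots> \<le> 2 * (\<Sum>i\<in>UNIV. \<bar>c i\<bar> + \<epsilon>)"
    using norm_drift_le[OF True] norm_ge_zero[of "drift (fst z)"] by linarith
  finally show ?thesis .
next
  case False
  have "0 \<le> (\<Sum>i\<in>UNIV. \<bar>c i\<bar> + \<epsilon>)" using \<epsilon>_pos by (intro sum_nonneg) auto
  then show ?thesis using False by (simp add: quotient_def)
qed

lemma integral_quotient_le:
  "(\<integral>z. quotient z \<partial>\<pi>) \<le> 3 * (\<Sum>i\<in>UNIV. \<epsilon> * measure \<rho> G + \<bar>c i\<bar> * rejection i)"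
proof -
  define N where "N s z = norm (fst z - snd z + (indicator G (fst z) * (s * t)) *\<^sub>R drift (fst z))"
    for s and z :: "(real ^ 'n) \<times> (real ^ 'n)"
  define \<kappa> where "\<kappa> z = indicator G (fst z) * (\<sigma> z + t * \<tau> z)" for z
  define C where "C = (\<Sum>i\<in>UNIV. \<bar>c i\<bar> + \<epsilon>)"
  have C0: "0 \<le> C" unfolding C_def using \<epsilon>_pos by (intro sum_nonneg) auto
  have Nm[measurable]: "N s \<in> borel_measurable \<pi>" for s unfolding N_def by measurable
  have [measurable]: "\<kappa> \<in> borel_measurable \<pi>" unfolding \<kappa>_def by measurable
  have i0: "integrable \<pi> (\<lambda>z. norm (fst z - snd z))"
    using integrable_X integrable_Y by (intro integrable_norm_diff) auto
  have Nle: "N s z \<le> norm (fst z - snd z) + C" if "\<bar>s\<bar> = 1" for s z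
  proof -
    have "N s z \<le> norm (fst z - snd z) + norm ((indicator G (fst z) * (s * t)) *\<^sub>R drift (fst z))"
      unfolding N_def by (rule norm_triangle_ineq)
    also have "norm ((indicator G (fst z) * (s * t)) *\<^sub>R drift (fst z)) \<le> C"
    proof (cases "fst z \<in> G")
      case True
      have "t * norm (drift (fst z)) \<le> 1 * C"
        using t_le t_pos norm_drift_le[OF True] unfolding C_def by (intro mult_mono) auto
      then show ?thesis using True that t_pos by (simp add: abs_mult)
    qed (use C0 in simp)
    finally show ?thesis by simp
  qed
  have iN: "integrable \<pi> (N s)" if "\<bar>s\<bar> = 1" for s
  proof (rule Bochner_Integration.integrable_bound)
    show "integrable \<pi> (\<lambda>z. norm (fst z - snd z) + C)" using i0 by simp
    show "AE z in \<pi>. norm (N s z) \<le> norm (norm (fst z - snd z) + C)"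
      using Nle[OF that] C0 by (intro AE_I2) (auto simp: N_def intro: order.trans[OF _ abs_ge_self])
  qed measurable
  have \<kappa>le: "\<bar>\<kappa> z\<bar> \<le> 1 / 2" for z
    using tilt_le[of "fst z" "snd z"] by (simp add: \<kappa>_def)
  have i\<kappa>N: "integrable \<pi> (\<lambda>z. \<kappa> z * N s z)" if s: "\<bar>s\<bar> = 1" for s
  proof (rule Bochner_Integration.integrable_bound[OF iN[OF s]])
    have "\<bar>\<kappa> z\<bar> * \<bar>N s z\<bar> \<le> 1 * \<bar>N s z\<bar>" for z
      using \<kappa>le[of z] by (intro mult_right_mono) auto
    then show "AE z in \<pi>. norm (\<kappa> z * N s z) \<le> norm (N s z)"
      by (intro AE_I2) (simp add: abs_mult)
  qed measurable
  have P: "(\<integral>z. weight z * norm (fst (fst z) + (indicator G (fst (fst z)) * (sign_of (fst (snd z)) * t)) *\<^sub>R drift (fst (fst z)) - snd (fst z)) \<partial>P)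
      = (\<integral>z. ((1 + \<kappa> z) * N 1 z + (1 - \<kappa> z) * N (-1) z) / 2 \<partial>\<pi>)"
  proof -
    define F where "F z = weight z * N (sign_of (fst (snd z))) (fst z)" for z
    have wF: "weight z * norm (fst (fst z) + (indicator G (fst (fst z)) * (sign_of (fst (snd z)) * t)) *\<^sub>R drift (fst (fst z)) - snd (fst z)) = F z" for z
      unfolding F_def N_def by (simp add: algebra_simps)
    have Nm2: "(\<lambda>z. N (sign_of (fst (snd z))) (fst z)) \<in> borel_measurable P"
      unfolding N_def by measurable
    have "integrable P (\<lambda>z. N (sign_of (fst (snd z))) (fst z))"
    proof (rule Bochner_Integration.integrable_bound[OF _ Nm2])
      show "integrable P (\<lambda>z. norm (fst (fst z) - snd (fst z)) + C)"
        using integrable_fst_P(1)[OF i0] by simp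
      show "AE z in P. norm (N (sign_of (fst (snd z))) (fst z)) \<le> norm (norm (fst (fst z) - snd (fst z)) + C)"
      proof (rule AE_I2)
        fix z :: "((real ^ 'n) \<times> (real ^ 'n)) \<times> bool \<times> real"
        have "0 \<le> N (sign_of (fst (snd z))) (fst z)" by (simp add: N_def)
        then show "norm (N (sign_of (fst (snd z))) (fst z)) \<le> norm (norm (fst (fst z) - snd (fst z)) + C)"
          using Nle[of "sign_of (fst (snd z))" "fst z"] C0 by simp
      qed
    qed
    then have iF: "integrable P F" unfolding F_def by (rule integrable_weight)
    have "(\<integral>z. F z \<partial>P) = (\<integral>z. \<integral>r. F (z, r) \<partial>coin \<partial>\<pi>)"
      by (rule P.integral_fst'[OF iF, symmetric])
    also have "\<dots> = (\<integral>z. ((1 + \<kappa> z) * N 1 z + (1 - \<kappa> z) * N (-1) z) / 2 \<partial>\<pi>)"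
    proof (rule Bochner_Integration.integral_cong)
      fix z
      show "(\<integral>r. F (z, r) \<partial>coin) = ((1 + \<kappa> z) * N 1 z + (1 - \<kappa> z) * N (-1) z) / 2"
        using integral_coin_sign[of "\<lambda>s. (1 + s * \<kappa> z) * N s z"]
        by (simp add: F_def weight_def \<kappa>_def)
    qed simp
    finally show ?thesis by (simp only: wF)
  qed
  have iM: "integrable \<pi> (\<lambda>z. ((1 + \<kappa> z) * N 1 z + (1 - \<kappa> z) * N (-1) z) / 2)"
    using iN[of 1] iN[of "-1"] i\<kappa>N[of 1] i\<kappa>N[of "-1"] by (simp add: distrib_right left_diff_distrib)
  have iq: "integrable \<pi> quotient"
    by (rule integrable_const_bound[where B="2 * (\<Sum>i\<in>UNIV. \<bar>c i\<bar> + \<epsilon>)"]) (use quotient_bounded in auto)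
  \<comment> \<open>Averaging over the sign leaves the even part
    \<open>(N 1 z + N (-1) z) / 2\<close> and \<open>\<kappa> z\<close> times the odd part. The even
    part is at least \<open>norm (fst z - snd z)\<close> by the triangle inequality, and for
    \<open>snd z = fst z\<close> it equals \<open>t * norm (drift (fst z))\<close> on
    \<open>G\<close>.\<close>
  have pt: "t * quotient z \<le> ((1 + \<kappa> z) * N 1 z + (1 - \<kappa> z) * N (-1) z) / 2 - norm (fst z - snd z)" for z
  proof (cases "fst z \<in> G")
    case False
    then show ?thesis by (simp add: quotient_def \<kappa>_def N_def field_simps)
  next
    case True
    let ?u = "fst z - snd z" and ?v = "drift (fst z)"
    have N1: "N 1 z = norm (?u + t *\<^sub>R ?v)" "N (-1) z = norm (?u - t *\<^sub>R ?v)"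
      using True by (simp_all add: N_def)
    have q: "t * quotient z = t * norm ?v * of_bool (snd z = fst z) + \<kappa> z * (N 1 z - N (-1) z) / 2"
      using True t_pos unfolding N1 by (simp add: quotient_def \<kappa>_def field_simps)
    have "t * norm ?v * of_bool (snd z = fst z) + norm ?u \<le> (N 1 z + N (-1) z) / 2"
    proof (cases "snd z = fst z")
      case True
      then show ?thesis unfolding N1 using t_pos by simp
    next
      case False
      have "norm (?u + ?u) \<le> norm (?u + t *\<^sub>R ?v) + norm (?u - t *\<^sub>R ?v)"
        using norm_triangle_ineq[of "?u + t *\<^sub>R ?v" "?u - t *\<^sub>R ?v"] by simp
      moreover have "norm (?u + ?u) = 2 * norm ?u" by (simp add: scaleR_2[symmetric])
      ultimately show ?thesis using False unfolding N1 by simp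
    qed
    then show ?thesis unfolding q by (simp add: algebra_simps add_divide_distrib diff_divide_distrib)
  qed
  have "t * (\<integral>z. quotient z \<partial>\<pi>) = (\<integral>z. t * quotient z \<partial>\<pi>)" by simp
  also have "\<dots> \<le> (\<integral>z. ((1 + \<kappa> z) * N 1 z + (1 - \<kappa> z) * N (-1) z) / 2 - norm (fst z - snd z) \<partial>\<pi>)"
    using iM iq i0 pt by (intro integral_mono) auto
  also have "\<dots> = (\<integral>z. ((1 + \<kappa> z) * N 1 z + (1 - \<kappa> z) * N (-1) z) / 2 \<partial>\<pi>) - (\<integral>z. norm (fst z - snd z) \<partial>\<pi>)"
    using iM i0 by (rule Bochner_Integration.integral_diff)
  also have "\<dots> \<le> 3 * (\<Sum>i\<in>UNIV. t * (\<epsilon> * measure \<rho> G + \<bar>c i\<bar> * rejection i))"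
    using tilted_cost_le unfolding P .
  also have "\<dots> = t * (3 * (\<Sum>i\<in>UNIV. \<epsilon> * measure \<rho> G + \<bar>c i\<bar> * rejection i))"
    by (simp add: sum_distrib_left[symmetric])
  finally show ?thesis using t_pos by simp
qed

end

text \<open>The difference of the squared norms is exactly \<open>4 * t n * (u \<bullet> v)\<close>,
  so the quotient equals \<open>2 * (u \<bullet> v) / (A n + B n)\<close> and continuity of the norm
  is enough.\<close>

lemma symmetric_quotient_norm_tendsto:
  fixes u v :: "'a::real_inner"
  assumes u: "u \<noteq> 0" and t: "t \<longlonglongrightarrow> 0" and t0: "\<And>n. 0 < t n"
  shows "(\<lambda>n. (norm (u + t n *\<^sub>R v) - norm (u - t n *\<^sub>R v)) / (2 * t n)) \<longlonglongrightarrow> sgn u \<bullet> v"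
proof -
  define A where "A n = norm (u + t n *\<^sub>R v)" for n
  define B where "B n = norm (u - t n *\<^sub>R v)" for n
  have "(\<lambda>n. A n + B n) \<longlonglongrightarrow> norm (u + 0 *\<^sub>R v) + norm (u - 0 *\<^sub>R v)"
    unfolding A_def B_def by (intro tendsto_intros t)
  then have AB: "(\<lambda>n. A n + B n) \<longlonglongrightarrow> norm u + norm u" by simp
  then have lim: "(\<lambda>n. 2 * (u \<bullet> v) / (A n + B n)) \<longlonglongrightarrow> 2 * (u \<bullet> v) / (norm u + norm u)"
    using u by (intro tendsto_divide tendsto_const AB) auto
  have "(A n - B n) / (2 * t n) = 2 * (u \<bullet> v) / (A n + B n)" for n
  proof -
    have "(A n)\<^sup>2 - (B n)\<^sup>2 = 4 * t n * (u \<bullet> v)"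
      unfolding A_def B_def power2_norm_eq_inner by (simp add: algebra_simps inner_commute)
    then have sq: "(A n - B n) * (A n + B n) = 4 * t n * (u \<bullet> v)"
      by (simp add: power2_eq_square algebra_simps)
    have "A n + B n \<noteq> 0"
    proof
      assume "A n + B n = 0"
      moreover have "0 \<le> A n" "0 \<le> B n" by (auto simp: A_def B_def)
      ultimately have "A n = 0" "B n = 0" by linarith+
      then have "u + t n *\<^sub>R v = 0" "u - t n *\<^sub>R v = 0" by (auto simp: A_def B_def)
      then have "u + u = 0" by (metis add.right_neutral add_diff_cancel_left' diff_add_eq diff_zero)
      then show False using u by (simp add: scaleR_2[symmetric])
    qed
    then show ?thesis using sq t0[of n] by (simp add: field_simps)
  qed
  moreover have "2 * (u \<bullet> v) / (norm u + norm u) = sgn u \<bullet> v"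
    using u by (simp add: sgn_div_norm field_simps)
  ultimately show ?thesis using lim by (simp add: A_def B_def)
qed

section \<open>The limit of vanishing scale\<close>

context tilt_data
begin

text \<open>In \<open>integral_quotient_le\<close> the set \<open>G\<close> and the vector
  \<open>c\<close> stay fixed while the scale tends to 0: rejections vanish by
  \<open>tendsto_L1_translation\<close>, and only the deviation \<open>\<epsilon>\<close> of the
  drift from \<open>c\<close> remains on the right.\<close>

lemma first_order_gain_le:
  "(\<integral>z. indicator G (fst z) * (norm (drift (fst z)) * of_bool (snd z = fst z)
      + \<sigma> z * (sgn (fst z - snd z) \<bullet> drift (fst z))) \<partial>\<pi>) \<le> 3 * real CARD('n) * \<epsilon> * measure \<rho> G"
proof -
  \<comment> \<open>\<open>s i\<close> is the largest scale that \<open>t_small\<close> allows in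
    coordinate \<open>i\<close>; \<open>t0\<close> meets all constraints at once.\<close>
  define s where "s i = ((b i - a i) / CARD('n)) / ((2 * \<bar>c i\<bar> + \<epsilon>) * (2 / m))" for i
  have pos: "0 < (2 * \<bar>c i\<bar> + \<epsilon>) * (2 / m)" for i using \<epsilon>_pos m_pos by (intro mult_pos_pos) auto
  have s0: "0 < s i" for i
    unfolding s_def using a_less_b[of i] by (intro divide_pos_pos pos) auto
  define t0 where "t0 = min 1 (Min (range s))"
  have t0: "0 < t0" "t0 \<le> 1" "t0 \<le> s i" for i
    using s0 by (auto simp: t0_def min_le_iff_disj)
  define t where "t n = t0 / real (Suc n)" for n
  have t: "0 < t n" "t n \<le> t0" for n
    using t0(1) by (auto simp: t_def field_simps mult_left_le)
  have tlim: "t \<longlonglongrightarrow> 0"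
    unfolding t_def using LIMSEQ_Suc[OF lim_const_over_n[of t0]] by simp
  have st: "small_tilt \<pi> K G \<sigma> \<tau> c a b \<epsilon> m (t n)" for n
  proof unfold_locales
    show "0 < t n" "t n \<le> 1" using t[of n] t0(2) by auto
    fix i
    have "t n \<le> s i" using t(2)[of n] t0(3)[of i] by simp
    then have "t n * ((2 * \<bar>c i\<bar> + \<epsilon>) * (2 / m)) \<le> (b i - a i) / CARD('n)"
      unfolding s_def by (rule pos_le_divide_eq[OF pos[of i], THEN iffD1])
    then show "t n * (2 * \<bar>c i\<bar> + \<epsilon>) * (2 / m) \<le> (b i - a i) / real CARD('n)"
      by (simp add: mult.assoc)
  qed
  define C where "C = (\<Sum>i\<in>UNIV. \<bar>c i\<bar> + \<epsilon>)"
  define q where "q n z = indicator G (fst z) * (norm (drift (fst z)) * of_bool (snd z = fst z) + (\<sigma> z + t n * \<tau> z) *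
    ((norm (fst z - snd z + t n *\<^sub>R drift (fst z)) - norm (fst z - snd z - t n *\<^sub>R drift (fst z))) / (2 * t n)))"
    for n and z :: "(real ^ 'n) \<times> (real ^ 'n)"
  define R where "R i n = (\<integral>z. \<bar>dens i (z + t n * c i) - dens i z\<bar> \<partial>lborel) + (\<integral>z. \<bar>dens i (z - t n * c i) - dens i z\<bar> \<partial>lborel)"
    for i n
  define g where "g z = indicator G (fst z) * (norm (drift (fst z)) * of_bool (snd z = fst z)
      + \<sigma> z * (sgn (fst z - snd z) \<bullet> drift (fst z)))" for z
  have q_le: "(\<integral>z. q n z \<partial>\<pi>) \<le> 3 * (\<Sum>i\<in>UNIV. \<epsilon> * measure \<rho> G + \<bar>c i\<bar> * R i n)" for n
    using small_tilt.integral_quotient_le[OF st[of n]]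
    unfolding small_tilt.quotient_def[OF st[of n]] small_tilt.rejection_def[OF st[of n]] q_def R_def .
  have q_bound: "\<bar>q n z\<bar> \<le> 2 * C" for n z
    using small_tilt.quotient_bounded[OF st[of n], of z]
    unfolding small_tilt.quotient_def[OF st[of n]] q_def C_def .
  have [measurable]: "q n \<in> borel_measurable \<pi>" "g \<in> borel_measurable \<pi>" for n
    unfolding q_def g_def by measurable
  have "(\<lambda>n. t n * c i) \<longlonglongrightarrow> 0 * c i" "(\<lambda>n. - (t n * c i)) \<longlonglongrightarrow> - (0 * c i)" for i
    by (intro tendsto_intros tlim)+
  then have tc: "(\<lambda>n. t n * c i) \<longlonglongrightarrow> 0" "(\<lambda>n. - (t n * c i)) \<longlonglongrightarrow> 0" for i by simp_all
  have R: "R i \<longlonglongrightarrow> 0" for i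
    using tendsto_add[OF tendsto_L1_translation[OF tc(1)[of i] integrable_dens[of i]]
      tendsto_L1_translation[OF tc(2)[of i] integrable_dens[of i]]]
    by (simp add: R_def[abs_def])
  have "(\<lambda>n. 3 * (\<Sum>i\<in>UNIV. \<epsilon> * measure \<rho> G + \<bar>c i\<bar> * R i n)) \<longlonglongrightarrow> 3 * (\<Sum>i\<in>(UNIV :: 'n set). \<epsilon> * measure \<rho> G + \<bar>c i\<bar> * 0)"
    by (intro tendsto_intros R)
  then have rhs: "(\<lambda>n. 3 * (\<Sum>i\<in>UNIV. \<epsilon> * measure \<rho> G + \<bar>c i\<bar> * R i n)) \<longlonglongrightarrow> 3 * real CARD('n) * \<epsilon> * measure \<rho> G"
    by (simp add: mult.assoc)
  have "(\<lambda>n. \<integral>z. q n z \<partial>\<pi>) \<longlonglongrightarrow> (\<integral>z. g z \<partial>\<pi>)"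
  proof (rule integral_dominated_convergence[where w="\<lambda>_. 2 * C"])
    show "AE z in \<pi>. (\<lambda>n. q n z) \<longlonglongrightarrow> g z"
    proof (rule AE_I2)
      fix z
      let ?u = "fst z - snd z" and ?v = "drift (fst z)"
      have "(\<lambda>n. (norm (?u + t n *\<^sub>R ?v) - norm (?u - t n *\<^sub>R ?v)) / (2 * t n)) \<longlonglongrightarrow> sgn ?u \<bullet> ?v"
      proof (cases "?u = 0")
        case True
        then show ?thesis by (simp del: scaleR_left.minus)
      next
        case False
        then show ?thesis by (rule symmetric_quotient_norm_tendsto[OF _ tlim t(1)])
      qed
      then have "(\<lambda>n. q n z) \<longlonglongrightarrow> indicator G (fst z) * (norm ?v * of_bool (snd z = fst z)
          + (\<sigma> z + 0 * \<tau> z) * (sgn ?u \<bullet> ?v))"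
        unfolding q_def by (intro tendsto_intros tlim)
      then show "(\<lambda>n. q n z) \<longlonglongrightarrow> g z" by (simp add: g_def)
    qed
    show "AE z in \<pi>. norm (q n z) \<le> 2 * C" for n using q_bound by simp
  qed auto
  then have "(\<integral>z. g z \<partial>\<pi>) \<le> 3 * real CARD('n) * \<epsilon> * measure \<rho> G"
    by (rule LIMSEQ_le[OF _ rhs]) (use q_le in auto)
  then show ?thesis by (simp add: g_def)
qed

text \<open>Both sides are proportional to the mass of \<open>G\<close>, so a pointwise gain
  \<open>\<delta>\<close> above \<open>3 * CARD('n) * \<epsilon>\<close> forces \<open>G\<close> to
  be null.\<close>

lemma uniform_gain_le:
  assumes \<delta>: "\<And>x. x \<in> G \<Longrightarrow> \<delta> \<le> (\<integral>y. norm (drift x) * of_bool (y = x) + \<sigma> (x, y) * (sgn (x - y) \<bullet> drift x) \<partial>K x)"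
  shows "\<delta> * measure \<rho> G \<le> 3 * real CARD('n) * \<epsilon> * measure \<rho> G"
proof -
  define g where "g z = indicator G (fst z) * (norm (drift (fst z)) * of_bool (snd z = fst z)
      + \<sigma> z * (sgn (fst z - snd z) \<bullet> drift (fst z)))" for z
  define C where "C = (\<Sum>i\<in>UNIV. \<bar>c i\<bar> + \<epsilon>)"
  have C0: "0 \<le> C" unfolding C_def using \<epsilon>_pos by (intro sum_nonneg) auto
  have [measurable]: "g \<in> borel_measurable \<pi>" unfolding g_def by measurable
  have gC: "\<bar>g z\<bar> \<le> 2 * C" for z
  proof (cases "fst z \<in> G")
    case True
    let ?v = "drift (fst z)"
    have v: "norm ?v \<le> C" unfolding C_def by (rule norm_drift_le[OF True])
    have "\<bar>sgn (fst z - snd z) \<bullet> ?v\<bar> \<le> norm (sgn (fst z - snd z)) * norm ?v"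
      by (rule Cauchy_Schwarz_ineq2)
    also have "\<dots> \<le> 1 * C" using v by (intro mult_mono) (auto simp: norm_sgn)
    finally have "\<bar>\<sigma> z\<bar> * \<bar>sgn (fst z - snd z) \<bullet> ?v\<bar> \<le> 1 / 4 * (1 * C)"
      using \<sigma>_le[of z] by (intro mult_mono) auto
    moreover have "\<bar>norm ?v * of_bool (snd z = fst z)\<bar> \<le> norm ?v" by simp
    moreover have "g z = norm ?v * of_bool (snd z = fst z) + \<sigma> z * (sgn (fst z - snd z) \<bullet> ?v)"
      using True by (simp add: g_def)
    ultimately show ?thesis
      using v C0 abs_triangle_ineq[of "norm ?v * of_bool (snd z = fst z)" "\<sigma> z * (sgn (fst z - snd z) \<bullet> ?v)"]
      unfolding abs_mult[of "\<sigma> z"] by linarith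
  qed (use C0 in \<open>simp add: g_def\<close>)
  have ig: "integrable \<pi> g"
    by (rule integrable_const_bound[where B="2 * C"]) (use gC in auto)
  have "\<delta> * measure \<rho> G = (\<integral>x. \<delta> * indicator G x \<partial>\<rho>)" by simp
  also have "\<dots> \<le> (\<integral>x. \<integral>y. g (x, y) \<partial>K x \<partial>\<rho>)"
  proof (rule integral_mono)
    show "integrable \<rho> (\<lambda>x. \<delta> * indicator G x)"
      by (rule \<rho>.integrable_const_bound[where B="\<bar>\<delta>\<bar>"]) (auto simp: indicator_def)
    show "integrable \<rho> (\<lambda>x. \<integral>y. g (x, y) \<partial>K x)" by (rule integrable_integral_K[OF ig])
    show "\<delta> * indicator G x \<le> (\<integral>y. g (x, y) \<partial>K x)" for x
      using \<delta>[of x] by (cases "x \<in> G") (simp_all add: g_def)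
  qed
  also have "\<dots> = (\<integral>z. g z \<partial>\<pi>)" by (rule integral_\<pi>[OF ig, symmetric])
  also have "\<dots> \<le> 3 * real CARD('n) * \<epsilon> * measure \<rho> G"
    unfolding g_def by (rule first_order_gain_le)
  finally show ?thesis .
qed

end

section \<open>First-order optimality conditions\<close>

context disintegrated
begin

lemma measure_K_measurable [measurable]:
  assumes [measurable]: "S \<in> sets borel"
  shows "(\<lambda>x. measure (K x) S) \<in> borel_measurable borel"
  using integral_K_measurable[of "\<lambda>z. indicator S (snd z)"] by simp

text \<open>Gram-Schmidt keeps the coefficients measurable in \<open>x\<close>; a vanishing remainder gets the
  coefficient \<open>u / 0 = 0\<close>.\<close>

lemma kernel_projection:
  fixes f :: "'a \<times> 'b \<Rightarrow> real" and e :: "'i \<Rightarrow> 'a \<times> 'b \<Rightarrow> real"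
  assumes "finite I"
    and "f \<in> borel_measurable (borel \<Otimes>\<^sub>M borel)" and "\<And>x. \<exists>C. \<forall>y. \<bar>f (x, y)\<bar> \<le> C"
    and "\<And>i. i \<in> I \<Longrightarrow> e i \<in> borel_measurable (borel \<Otimes>\<^sub>M borel)"
    and "\<And>i x. i \<in> I \<Longrightarrow> \<exists>C. \<forall>y. \<bar>e i (x, y)\<bar> \<le> C"
  shows "\<exists>c. (\<forall>i. c i \<in> borel_measurable borel) \<and>
    (\<forall>x. \<forall>i\<in>I. (\<integral>y. (f (x, y) - (\<Sum>k\<in>I. c k x * e k (x, y))) * e i (x, y) \<partial>K x) = 0)"
  using assms
proof (induction I arbitrary: f rule: finite_induct)
  case empty
  then show ?case by (intro exI[of _ "\<lambda>_ _. 0"]) auto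
next
  case (insert l I)
  have em: "e k \<in> borel_measurable (borel \<Otimes>\<^sub>M borel)" "\<exists>C. \<forall>y. \<bar>e k (x, y)\<bar> \<le> C" if "k \<in> insert l I" for k x
    using insert.prems(3)[OF that] insert.prems(4)[OF that] by blast+
  have IH: "\<exists>c. (\<forall>i. c i \<in> borel_measurable borel) \<and>
      (\<forall>x. \<forall>i\<in>I. (\<integral>y. (g (x, y) - (\<Sum>k\<in>I. c k x * e k (x, y))) * e i (x, y) \<partial>K x) = 0)"
    if g: "g \<in> borel_measurable (borel \<Otimes>\<^sub>M borel)" and gb: "\<And>x. \<exists>C. \<forall>y. \<bar>g (x, y)\<bar> \<le> C" for g
    by (rule insert.IH[OF g gb]) (rule em, simp)+
  obtain cf where cf[measurable]: "\<And>i. cf i \<in> borel_measurable borel"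
    and cf0: "\<And>x i. i \<in> I \<Longrightarrow> (\<integral>y. (f (x, y) - (\<Sum>k\<in>I. cf k x * e k (x, y))) * e i (x, y) \<partial>K x) = 0"
    using IH[OF insert.prems(1,2)] by blast
  obtain ce where ce[measurable]: "\<And>i. ce i \<in> borel_measurable borel"
    and ce0: "\<And>x i. i \<in> I \<Longrightarrow> (\<integral>y. (e l (x, y) - (\<Sum>k\<in>I. ce k x * e k (x, y))) * e i (x, y) \<partial>K x) = 0"
    using IH[OF em(1)[OF insertI1] em(2)[OF insertI1]] by blast
  \<comment> \<open>\<open>A\<close> and \<open>B\<close> are the remainders of \<open>f\<close> and
    of the new function \<open>e l\<close> after projection onto the old ones; what is left is to
    project \<open>A\<close> onto \<open>B\<close>.\<close>
  define A where "A z = f z - (\<Sum>k\<in>I. cf k (fst z) * e k z)" for z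
  define B where "B z = e l z - (\<Sum>k\<in>I. ce k (fst z) * e k z)" for z
  have sm[measurable]: "(\<lambda>z. \<Sum>k\<in>I. h k (fst z) * e k z) \<in> borel_measurable (borel \<Otimes>\<^sub>M borel)"
    if [measurable]: "\<And>i. h i \<in> borel_measurable borel" for h :: "'i \<Rightarrow> 'a \<Rightarrow> real"
  proof (rule borel_measurable_sum)
    fix k assume "k \<in> I"
    then have [measurable]: "e k \<in> borel_measurable (borel \<Otimes>\<^sub>M borel)" using em by simp
    show "(\<lambda>z. h k (fst z) * e k z) \<in> borel_measurable (borel \<Otimes>\<^sub>M borel)" by measurable
  qed
  have [measurable]: "f \<in> borel_measurable (borel \<Otimes>\<^sub>M borel)" "e l \<in> borel_measurable (borel \<Otimes>\<^sub>M borel)"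
    using insert.prems(1) em by auto
  have Am[measurable]: "A \<in> borel_measurable (borel \<Otimes>\<^sub>M borel)" unfolding A_def by measurable
  have Bm[measurable]: "B \<in> borel_measurable (borel \<Otimes>\<^sub>M borel)" unfolding B_def by measurable
  have sb: "\<exists>C. \<forall>y. \<bar>\<Sum>k\<in>I. h k * e k (x, y)\<bar> \<le> C" for h :: "'i \<Rightarrow> real" and x
  proof -
    have "\<forall>k\<in>I. \<exists>C. \<forall>y. \<bar>e k (x, y)\<bar> \<le> C" using em by simp
    then obtain C where C: "\<And>k y. k \<in> I \<Longrightarrow> \<bar>e k (x, y)\<bar> \<le> C k" by metis
    have "\<bar>\<Sum>k\<in>I. h k * e k (x, y)\<bar> \<le> (\<Sum>k\<in>I. \<bar>h k\<bar> * C k)" for y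
      using C by (intro order.trans[OF sum_abs] sum_mono) (auto simp: abs_mult intro: mult_left_mono)
    then show ?thesis by blast
  qed
  have diffb: "\<exists>C. \<forall>y. \<bar>u y - v y\<bar> \<le> C" if ub: "\<exists>C. \<forall>y. \<bar>u y\<bar> \<le> C" and vb: "\<exists>C. \<forall>y. \<bar>v y\<bar> \<le> C" for u v :: "'b \<Rightarrow> real"
  proof -
    obtain C where C: "\<And>y. \<bar>u y\<bar> \<le> C" using ub by blast
    obtain D where D: "\<And>y. \<bar>v y\<bar> \<le> D" using vb by blast
    from C D have "\<bar>u y - v y\<bar> \<le> C + D" for y by (metis abs_triangle_ineq4 add_mono order.trans)
    then show ?thesis by blast
  qed
  have Ab: "\<exists>C. \<forall>y. \<bar>A (x, y)\<bar> \<le> C" for x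
    unfolding A_def fst_conv by (rule diffb[OF insert.prems(2) sb])
  have Bb: "\<exists>C. \<forall>y. \<bar>B (x, y)\<bar> \<le> C" for x
    unfolding B_def fst_conv by (rule diffb[OF em(2) sb]) simp
  have prod_i: "integrable (K x) (\<lambda>y. g (x, y) * h (x, y))"
    if [measurable]: "g \<in> borel_measurable (borel \<Otimes>\<^sub>M borel)" "h \<in> borel_measurable (borel \<Otimes>\<^sub>M borel)"
      and gb: "\<exists>C. \<forall>y. \<bar>g (x, y)\<bar> \<le> C" and hb: "\<exists>C. \<forall>y. \<bar>h (x, y)\<bar> \<le> C" for g h :: "'a \<times> 'b \<Rightarrow> real" and x
  proof -
    obtain C D where C: "\<And>y. \<bar>g (x, y)\<bar> \<le> C" and D: "\<And>y. \<bar>h (x, y)\<bar> \<le> D" using gb hb by auto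
    show ?thesis
      by (rule integrable_K_bounded_mult[OF integrable_K_bounded[OF _ D] _ C]) measurable
  qed
  define \<theta> where "\<theta> x = (\<integral>y. A (x, y) * B (x, y) \<partial>K x) / (\<integral>y. B (x, y) * B (x, y) \<partial>K x)" for x
  have th_m[measurable]: "\<theta> \<in> borel_measurable borel"
  proof -
    have [measurable]: "(\<lambda>x. \<integral>y. A (x, y) * B (x, y) \<partial>K x) \<in> borel_measurable borel"
      "(\<lambda>x. \<integral>y. B (x, y) * B (x, y) \<partial>K x) \<in> borel_measurable borel"
      using integral_K_measurable[of "\<lambda>z. A z * B z"] integral_K_measurable[of "\<lambda>z. B z * B z"] by simp_all
    show ?thesis unfolding \<theta>_def by measurable
  qed
  define c where "c k = (\<lambda>x. if k = l then \<theta> x else cf k x - \<theta> x * ce k x)" for k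
  have cm: "c k \<in> borel_measurable borel" for k
    unfolding c_def by (cases "k = l") simp_all
  have res: "f (x, y) - (\<Sum>k\<in>insert l I. c k x * e k (x, y)) = A (x, y) - \<theta> x * B (x, y)" for x y
  proof -
    have "(\<Sum>k\<in>I. c k x * e k (x, y)) = (\<Sum>k\<in>I. cf k x * e k (x, y) - \<theta> x * (ce k x * e k (x, y)))"
      using insert.hyps by (intro sum.cong) (auto simp: c_def algebra_simps)
    then show ?thesis
      using insert.hyps by (simp add: A_def B_def c_def sum_subtractf sum_distrib_left[symmetric] algebra_simps)
  qed
  have orth: "(\<integral>y. (A (x, y) - \<theta> x * B (x, y)) * e i (x, y) \<partial>K x) = 0" if i: "i \<in> I" for x i
  proof -
    have AB: "integrable (K x) (\<lambda>y. A (x, y) * e i (x, y))" "integrable (K x) (\<lambda>y. B (x, y) * e i (x, y))"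
      using i by (intro prod_i Am Bm Ab Bb em; simp)+
    have "(\<integral>y. (A (x, y) - \<theta> x * B (x, y)) * e i (x, y) \<partial>K x)
        = (\<integral>y. A (x, y) * e i (x, y) - \<theta> x * (B (x, y) * e i (x, y)) \<partial>K x)"
      by (simp add: algebra_simps)
    also have "\<dots> = (\<integral>y. A (x, y) * e i (x, y) \<partial>K x) - \<theta> x * (\<integral>y. B (x, y) * e i (x, y) \<partial>K x)"
      using AB by simp
    also have "\<dots> = 0" using cf0[OF i, of x] ce0[OF i, of x] by (simp add: A_def B_def)
    finally show ?thesis .
  qed
  have orthB: "(\<integral>y. (A (x, y) - \<theta> x * B (x, y)) * B (x, y) \<partial>K x) = 0" for x
  proof -
    have AB: "integrable (K x) (\<lambda>y. A (x, y) * B (x, y))" "integrable (K x) (\<lambda>y. B (x, y) * B (x, y))"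
      by (intro prod_i Am Bm Ab Bb)+
    have "(\<integral>y. (A (x, y) - \<theta> x * B (x, y)) * B (x, y) \<partial>K x)
        = (\<integral>y. A (x, y) * B (x, y) - \<theta> x * (B (x, y) * B (x, y)) \<partial>K x)"
      by (simp add: algebra_simps)
    also have "\<dots> = (\<integral>y. A (x, y) * B (x, y) \<partial>K x) - \<theta> x * (\<integral>y. B (x, y) * B (x, y) \<partial>K x)"
      using AB by simp
    \<comment> \<open>If \<open>B\<close> vanishes almost everywhere, so does \<open>A * B\<close>,
      and the default coefficient 0 is as good as any other.\<close>
    also have "\<dots> = 0"
    proof (cases "(\<integral>y. B (x, y) * B (x, y) \<partial>K x) = 0")
      case True
      then have "AE y in K x. B (x, y) * B (x, y) = 0"
        using integral_nonneg_eq_0_iff_AE[OF AB(2)] by simp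
      then have "(\<integral>y. A (x, y) * B (x, y) \<partial>K x) = 0"
        by (intro integral_eq_zero_AE) (auto elim!: eventually_mono)
      then show ?thesis using True by simp
    qed (simp add: \<theta>_def)
    finally show ?thesis .
  qed
  \<comment> \<open>\<open>e l\<close> is \<open>B\<close> plus a combination of the old functions,
    and the remainder is orthogonal to all of these.\<close>
  have orthl: "(\<integral>y. (A (x, y) - \<theta> x * B (x, y)) * e l (x, y) \<partial>K x) = 0" for x
  proof -
    define D where "D y = A (x, y) - \<theta> x * B (x, y)" for y
    have Db: "\<exists>C. \<forall>y. \<bar>D y\<bar> \<le> C" and Dm: "(\<lambda>z. A z - \<theta> (fst z) * B z) \<in> borel_measurable (borel \<Otimes>\<^sub>M borel)"
    proof -
      obtain C where "\<And>y. \<bar>B (x, y)\<bar> \<le> C" using Bb by auto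
      then have "\<bar>\<theta> x * B (x, y)\<bar> \<le> \<bar>\<theta> x\<bar> * C" for y by (simp add: abs_mult mult_left_mono)
      then show "\<exists>C. \<forall>y. \<bar>D y\<bar> \<le> C" unfolding D_def by (intro diffb[OF Ab]) blast
    qed measurable
    have iD: "integrable (K x) (\<lambda>y. D y * h (x, y))"
      if "h \<in> borel_measurable (borel \<Otimes>\<^sub>M borel)" "\<exists>C. \<forall>y. \<bar>h (x, y)\<bar> \<le> C" for h
      using prod_i[OF Dm that(1), of x] Db that(2) by (simp add: D_def)
    have "(\<integral>y. D y * e l (x, y) \<partial>K x) = (\<integral>y. D y * B (x, y) + (\<Sum>k\<in>I. ce k x * (D y * e k (x, y))) \<partial>K x)"
      by (intro Bochner_Integration.integral_cong) (auto simp: B_def sum_distrib_left algebra_simps)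
    also have "\<dots> = (\<integral>y. D y * B (x, y) \<partial>K x) + (\<Sum>k\<in>I. ce k x * (\<integral>y. D y * e k (x, y) \<partial>K x))"
      using iD[OF Bm Bb] iD em by simp
    also have "\<dots> = 0" using orth orthB by (simp add: D_def)
    finally show ?thesis by (simp add: D_def)
  qed
  show ?case
    by (rule exI[of _ c]) (use cm orth orthl in \<open>auto simp: res\<close>)
qed

end

section \<open>Pointwise consequences of optimality\<close>

context optimal_coupling
begin

definition tilt :: "((real ^ 'n) \<times> (real ^ 'n) \<Rightarrow> real) \<Rightarrow> bool" where
  "tilt \<tau> \<longleftrightarrow> \<tau> \<in> borel_measurable (borel \<Otimes>\<^sub>M borel) \<and> (\<forall>z. \<bar>\<tau> z\<bar> \<le> 1 / 4) \<and>
    (\<forall>x\<in>centered. (\<integral>y. \<tau> (x, y) \<partial>K x) = 0)"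

text \<open>This is the \<open>drift\<close> of \<open>tilt_data\<close>, free of any set
  \<open>G\<close>.\<close>

definition shift :: "((real ^ 'n) \<times> (real ^ 'n) \<Rightarrow> real) \<Rightarrow> real ^ 'n \<Rightarrow> real ^ 'n" where
  "shift \<tau> x = (\<chi> i. \<integral>y. \<tau> (x, y) * y $ i \<partial>K x)"

lemma shift_measurable:
  assumes [measurable]: "\<tau> \<in> borel_measurable (borel \<Otimes>\<^sub>M borel)"
  shows "shift \<tau> \<in> borel_measurable borel"
proof (rule borel_measurable_vecI)
  show "(\<lambda>x. shift \<tau> x $ i) \<in> borel_measurable borel" for i
    using integral_K_measurable[of "\<lambda>z. \<tau> z * snd z $ i"] by (simp add: shift_def)
qed

text \<open>A tilt of mean 0 cannot move the mean of a coordinate that is almost surely constant; so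
  the coordinate has mass strictly below and strictly above its mean. This supplies the first
  alternative of \<open>spread\<close>.\<close>

lemma spread_if_shift:
  assumes x: "x \<in> centered" and \<tau>: "tilt \<tau>" and ne: "shift \<tau> x $ i \<noteq> 0"
  shows "\<exists>a b :: rat. a < b \<and> 0 < measure (K x) {y. y $ i \<le> of_rat a} \<and> 0 < measure (K x) {y. of_rat b \<le> y $ i}"
proof -
  have \<tau>0: "(\<integral>y. \<tau> (x, y) \<partial>K x) = 0" using \<tau> x by (simp add: tilt_def)
  have [measurable]: "\<tau> \<in> borel_measurable (borel \<Otimes>\<^sub>M borel)" using \<tau> by (simp add: tilt_def)
  have nAE: "\<not> (AE y in K x. y $ i = x $ i)"
  proof
    assume "AE y in K x. y $ i = x $ i"
    then have "(\<integral>y. \<tau> (x, y) * y $ i \<partial>K x) = (\<integral>y. \<tau> (x, y) * x $ i \<partial>K x)"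
      by (intro integral_cong_AE) (auto elim!: eventually_mono)
    also have "\<dots> = 0" using \<tau>0 by simp
    finally show False using ne by (simp add: shift_def)
  qed
  note i = integrable_nth[OF x, of i] and m = mean_nth[OF x, of i]
  obtain a :: rat where a: "of_rat a < x $ i" "0 < measure (K x) {y. y $ i \<le> of_rat a}"
    using K.rational_below_expectation[OF i] nAE by (auto simp: m)
  have "\<not> (AE y in K x. - (y $ i) = - (x $ i))" using nAE by simp
  then obtain b :: rat where b: "of_rat b < - (x $ i)" "0 < measure (K x) {y. - (y $ i) \<le> of_rat b}"
    using K.rational_below_expectation[of x "\<lambda>y. - (y $ i)"] i by (auto simp: m)
  have "{y :: real ^ 'n. - (y $ i) \<le> of_rat b} = {y. of_rat (- b) \<le> y $ i}" by (auto simp: of_rat_minus)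
  moreover have "(of_rat a :: real) < of_rat (- b)" using a(1) b(1) by (simp add: of_rat_minus)
  then have "a < - b" by (simp only: of_rat_less)
  ultimately show ?thesis using a(2) b(2) by (intro exI[of _ a] exI[of _ "- b"]) simp
qed

lemma first_order_optimality:
  assumes \<sigma>: "tilt \<sigma>" and \<sigma>1: "\<And>x. x \<in> centered \<Longrightarrow> shift \<sigma> x = 0" and \<tau>: "tilt \<tau>"
  shows "AE x in \<rho>. (\<integral>y. norm (shift \<tau> x) * of_bool (y = x) + \<sigma> (x, y) * (sgn (x - y) \<bullet> shift \<tau> x) \<partial>K x) \<le> 0"
proof -
  define g where "g x = (\<integral>y. norm (shift \<tau> x) * of_bool (y = x) + \<sigma> (x, y) * (sgn (x - y) \<bullet> shift \<tau> x) \<partial>K x)" for x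
  have \<sigma>m[measurable]: "\<sigma> \<in> borel_measurable (borel \<Otimes>\<^sub>M borel)" and \<tau>m[measurable]: "\<tau> \<in> borel_measurable (borel \<Otimes>\<^sub>M borel)"
    using \<sigma> \<tau> by (auto simp: tilt_def)
  have sm[measurable]: "shift \<tau> \<in> borel_measurable borel" by (rule shift_measurable[OF \<tau>m])
  have gm[measurable]: "g \<in> borel_measurable borel"
    using integral_K_measurable[of "\<lambda>z. norm (shift \<tau> (fst z)) * of_bool (snd z = fst z) + \<sigma> z * (sgn (fst z - snd z) \<bullet> shift \<tau> (fst z))"]
    unfolding g_def by simp
  \<comment> \<open>Then \<open>3 * CARD('n) * \<epsilon> n\<close> is half of the gain
    \<open>1 / Suc n\<close> required on \<open>H n\<close>, so \<open>uniform_gain_le\<close> makes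
    that set null.\<close>
  define \<epsilon> where "\<epsilon> n = 1 / (6 * real CARD('n) * real (Suc n))" for n
  have \<epsilon>0: "0 < \<epsilon> n" for n by (simp add: \<epsilon>_def)
  \<comment> \<open>Countably many sets, each admissible as the \<open>G\<close> of \<open>tilt_data\<close>, cover the points of positive gain.\<close>
  define H where "H n k c a b = {x \<in> centered. 1 / real (Suc n) \<le> g x \<and> (\<forall>i. \<bar>shift \<tau> x $ i - of_rat (c i)\<bar> \<le> \<epsilon> n) \<and>
      (\<forall>i. 1 / real (Suc k) \<le> measure (K x) {y. y $ i \<le> of_rat (a i)} \<and> 1 / real (Suc k) \<le> measure (K x) {y. of_rat (b i) \<le> y $ i}
        \<or> shift \<tau> x $ i = 0 \<and> c i = 0)}"
    for n k and c a b :: "'n \<Rightarrow> rat"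
  have Hm[measurable]: "H n k c a b \<in> sets borel" for n k c a b
  proof -
    have "H n k c a b = centered \<inter> {x \<in> space borel. 1 / real (Suc n) \<le> g x} \<inter>
      (\<Inter>i. {x \<in> space borel. \<bar>shift \<tau> x $ i - of_rat (c i)\<bar> \<le> \<epsilon> n}) \<inter>
      (\<Inter>i. {x \<in> space borel. (1 / real (Suc k) \<le> measure (K x) {y. y $ i \<le> of_rat (a i)} \<and>
         1 / real (Suc k) \<le> measure (K x) {y. of_rat (b i) \<le> y $ i}) \<or> (shift \<tau> x $ i = 0 \<and> c i = 0)})"
      unfolding H_def by auto
    also have "\<dots> \<in> sets borel" by measurable
    finally show ?thesis .
  qed
  have null: "AE x in \<rho>. x \<notin> H n k c a b" if ab: "\<And>i. a i < b i" for n k c a b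
  proof -
    let ?G = "H n k c a b"
    interpret T: tilt_data \<pi> K ?G \<sigma> \<tau> "\<lambda>i. of_rat (c i)" "\<lambda>i. of_rat (a i)" "\<lambda>i. of_rat (b i)" "\<epsilon> n" "1 / real (Suc k)"
    proof unfold_locales
      show "?G \<subseteq> centered" by (auto simp: H_def)
      show "\<bar>\<sigma> z\<bar> \<le> 1 / 4" "\<bar>\<tau> z\<bar> \<le> 1 / 4" for z using \<sigma> \<tau> unfolding tilt_def by blast+
      fix x assume x: "x \<in> ?G"
      then have xc: "x \<in> centered" by (simp add: H_def)
      show "(\<integral>y. \<sigma> (x, y) \<partial>K x) = 0" "(\<integral>y. \<tau> (x, y) \<partial>K x) = 0"
        using xc \<sigma> \<tau> by (auto simp: tilt_def)
      fix i
      show "(\<integral>y. \<sigma> (x, y) * y $ i \<partial>K x) = 0"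
        using \<sigma>1[OF xc] by (simp add: shift_def vec_eq_iff)
      show "\<bar>(\<integral>y. \<tau> (x, y) * y $ i \<partial>K x) - of_rat (c i)\<bar> \<le> \<epsilon> n"
        using x by (simp add: H_def shift_def)
      show "(1 / real (Suc k) \<le> measure (K x) {y. y $ i \<le> of_rat (a i)} \<and>
          1 / real (Suc k) \<le> measure (K x) {y. of_rat (b i) \<le> y $ i}) \<or>
        ((\<integral>y. \<tau> (x, y) * y $ i \<partial>K x) = 0 \<and> of_rat (c i) = (0 :: real))"
        using x unfolding H_def shift_def by auto
    qed (use ab \<epsilon>0 in \<open>auto simp: of_rat_less\<close>)
    define N where "N = real (Suc n)"
    have N: "0 < N" by (simp add: N_def)
    have "T.drift = shift \<tau>" by (simp add: fun_eq_iff T.drift_def shift_def)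
    then have "1 / real (Suc n) * measure \<rho> ?G \<le> 3 * real CARD('n) * \<epsilon> n * measure \<rho> ?G"
      by (intro T.uniform_gain_le) (auto simp: H_def g_def)
    then have le: "1 / N * measure \<rho> ?G \<le> 3 * real CARD('n) * \<epsilon> n * measure \<rho> ?G" by (simp only: N_def)
    have "3 * real CARD('n) * \<epsilon> n = 1 / (2 * N)" unfolding \<epsilon>_def N_def[symmetric] using N by (simp add: field_simps)
    with le have "2 * N * (1 / N * measure \<rho> ?G) \<le> 2 * N * (1 / (2 * N) * measure \<rho> ?G)"
      using N by (intro mult_left_mono) auto
    then have "measure \<rho> ?G \<le> 0" using N by simp
    then have "measure \<rho> ?G = 0" using measure_nonneg[of \<rho> ?G] by linarith
    then show ?thesis using \<rho>.prob_eq_0[of ?G] by simp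
  qed
  have "AE x in \<rho>. \<forall>n k. \<forall>c a b :: 'n \<Rightarrow> rat. (\<forall>i. a i < b i) \<longrightarrow> x \<notin> H n k c a b"
    unfolding AE_all_countable
  proof (intro allI)
    fix n k and c a b :: "'n \<Rightarrow> rat"
    show "AE x in \<rho>. (\<forall>i. a i < b i) \<longrightarrow> x \<notin> H n k c a b"
      using null[of a b] by (cases "\<forall>i. a i < b i") auto
  qed
  with AE_centered have "AE x in \<rho>. g x \<le> 0"
  proof eventually_elim
    case (elim x)
    show ?case
    proof (rule ccontr)
      assume "\<not> g x \<le> 0"
      then obtain n where n: "1 / real (Suc n) \<le> g x"
        using reals_Archimedean[of "g x"] by (auto simp: inverse_eq_divide intro: less_imp_le)
      let ?v = "\<lambda>i. shift \<tau> x $ i"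
      \<comment> \<open>The approximation must be exactly 0 where the component vanishes: such a
        coordinate may have no spread, and only \<open>c i = 0\<close> then leaves it
        unmoved.\<close>
      have "\<exists>q :: rat. \<bar>?v i - of_rat q\<bar> \<le> \<epsilon> n \<and> (?v i = 0 \<longrightarrow> q = 0)" for i
      proof (cases "?v i = 0")
        case True
        then show ?thesis using \<epsilon>0[of n] by (intro exI[of _ 0]) auto
      next
        case False
        obtain q where "?v i - \<epsilon> n < of_rat q" "of_rat q < ?v i + \<epsilon> n"
          using of_rat_dense[of "?v i - \<epsilon> n" "?v i + \<epsilon> n"] \<epsilon>0[of n] by auto
        then show ?thesis using False by (intro exI[of _ q]) auto
      qed
      then obtain c :: "'n \<Rightarrow> rat" where c: "\<And>i. \<bar>?v i - of_rat (c i)\<bar> \<le> \<epsilon> n" "\<And>i. ?v i = 0 \<Longrightarrow> c i = 0" by metis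
      have "\<exists>a b :: rat. a < b \<and> (?v i \<noteq> 0 \<longrightarrow> 0 < measure (K x) {y. y $ i \<le> of_rat a} \<and> 0 < measure (K x) {y. of_rat b \<le> y $ i})" for i
      proof (cases "?v i = 0")
        case True
        then show ?thesis by (intro exI[of _ 0] exI[of _ 1]) auto
      next
        case False
        then show ?thesis using spread_if_shift[OF elim(1) \<tau> False] by blast
      qed
      then obtain a b :: "'n \<Rightarrow> rat" where ab: "\<And>i. a i < b i"
        and ab': "\<And>i. ?v i \<noteq> 0 \<Longrightarrow> 0 < measure (K x) {y. y $ i \<le> of_rat (a i)} \<and> 0 < measure (K x) {y. of_rat (b i) \<le> y $ i}"
        by metis
      have "\<exists>k. ?v i \<noteq> 0 \<longrightarrow> 1 / real (Suc k) \<le> measure (K x) {y. y $ i \<le> of_rat (a i)} \<and> 1 / real (Suc k) \<le> measure (K x) {y. of_rat (b i) \<le> y $ i}" for i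
      proof (cases "?v i = 0")
        case False
        then obtain k where "inverse (real (Suc k)) < min (measure (K x) {y. y $ i \<le> of_rat (a i)}) (measure (K x) {y. of_rat (b i) \<le> y $ i})"
          using reals_Archimedean[of "min (measure (K x) {y. y $ i \<le> of_rat (a i)}) (measure (K x) {y. of_rat (b i) \<le> y $ i})"] ab'[of i] by auto
        then show ?thesis by (intro exI[of _ k]) (auto simp: inverse_eq_divide)
      qed simp
      then obtain k where k: "\<And>i. ?v i \<noteq> 0 \<Longrightarrow> 1 / real (Suc (k i)) \<le> measure (K x) {y. y $ i \<le> of_rat (a i)} \<and> 1 / real (Suc (k i)) \<le> measure (K x) {y. of_rat (b i) \<le> y $ i}"
        by metis
      define k' where "k' = Max (range k)"
      have "1 / real (Suc k') \<le> 1 / real (Suc (k i))" for i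
        by (intro divide_left_mono) (auto simp: k'_def)
      then have "x \<in> H n k' c a b"
        unfolding H_def using elim(1) n c k order.trans by blast
      then show False using elim(2) ab by blast
    qed
  qed
  then show ?thesis by (simp add: g_def)
qed

text \<open>A bounded stand-in for the identity with the same sign: tilts must be bounded although
  \<open>y\<close> need not be, and only the sign of \<open>saturate r * r\<close> matters.\<close>

definition saturate :: "real \<Rightarrow> real" where "saturate r = r / (1 + \<bar>r\<bar>)"

lemma saturate_measurable [measurable]: "saturate \<in> borel_measurable borel"
  unfolding saturate_def by measurable

lemma abs_saturate_le: "\<bar>saturate r\<bar> \<le> 1"
  by (simp add: saturate_def abs_divide)

lemma saturate_mult: "0 \<le> saturate r * r" "saturate r * r = 0 \<longleftrightarrow> r = 0"
proof -
  have "0 < 1 + \<bar>r\<bar>" by linarith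
  moreover have "saturate r * r = r * r / (1 + \<bar>r\<bar>)" by (simp add: saturate_def)
  ultimately show "0 \<le> saturate r * r" "saturate r * r = 0 \<longleftrightarrow> r = 0" by auto
qed

text \<open>A bounded tilt that moves \<open>x\<close> in a direction making an acute angle with \<open>\<xi> x\<close>.\<close>

definition probe :: "(real ^ 'n \<Rightarrow> real ^ 'n) \<Rightarrow> (real ^ 'n) \<times> (real ^ 'n) \<Rightarrow> real" where
  "probe \<xi> z = indicator centered (fst z) *
    ((saturate (\<xi> (fst z) \<bullet> (snd z - fst z)) - (\<integral>y. saturate (\<xi> (fst z) \<bullet> (y - fst z)) \<partial>K (fst z))) / 8)"

lemma integrable_saturate: "integrable (K x) (\<lambda>y. saturate (u \<bullet> (y - x)))"
  by (rule integrable_K_bounded[OF _ abs_saturate_le]) measurable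

lemma tilt_probe:
  assumes [measurable]: "\<xi> \<in> borel_measurable borel"
  shows "tilt (probe \<xi>)"
  unfolding tilt_def
proof (intro conjI allI ballI)
  have [measurable]: "(\<lambda>x. \<integral>y. saturate (\<xi> x \<bullet> (y - x)) \<partial>K x) \<in> borel_measurable borel"
    using integral_K_measurable[of "\<lambda>z. saturate (\<xi> (fst z) \<bullet> (snd z - fst z))"] by simp
  show "probe \<xi> \<in> borel_measurable (borel \<Otimes>\<^sub>M borel)" unfolding probe_def by measurable
  fix z :: "(real ^ 'n) \<times> (real ^ 'n)"
  let ?m = "\<integral>y. saturate (\<xi> (fst z) \<bullet> (y - fst z)) \<partial>K (fst z)"
  have "\<bar>?m\<bar> \<le> (\<integral>y. \<bar>saturate (\<xi> (fst z) \<bullet> (y - fst z))\<bar> \<partial>K (fst z))" by (rule integral_abs_bound)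
  also have "\<dots> \<le> (\<integral>y. 1 \<partial>K (fst z))"
    using integrable_saturate abs_saturate_le by (intro integral_mono) auto
  finally have "\<bar>?m\<bar> \<le> 1" by simp
  \<comment> \<open>The divisor 8 in \<open>probe\<close> brings this bound 2 down to 1/4.\<close>
  then have "\<bar>saturate (\<xi> (fst z) \<bullet> (snd z - fst z)) - ?m\<bar> \<le> 2"
    using abs_saturate_le[of "\<xi> (fst z) \<bullet> (snd z - fst z)"] by linarith
  then show "\<bar>probe \<xi> z\<bar> \<le> 1 / 4" by (simp add: probe_def indicator_def)
next
  fix x
  show "(\<integral>y. probe \<xi> (x, y) \<partial>K x) = 0"
    using integrable_saturate[of x "\<xi> x"] by (simp add: probe_def)
qed

lemma integrable_tilt_nth:
  assumes "tilt \<tau>" and x: "x \<in> centered"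
  shows "integrable (K x) (\<lambda>y. \<tau> (x, y) * y $ i)"
proof -
  have [measurable]: "\<tau> \<in> borel_measurable (borel \<Otimes>\<^sub>M borel)" and "\<And>z. \<bar>\<tau> z\<bar> \<le> 1 / 4"
    using assms by (auto simp: tilt_def)
  then show ?thesis
    using assms(1) unfolding tilt_def
    by (intro integrable_K_bounded_mult[where C="1/4"] integrable_nth[OF x]) auto
qed

lemma inner_centered:
  assumes x: "x \<in> centered"
  shows "integrable (K x) (\<lambda>y. u \<bullet> (y - x))" "(\<integral>y. u \<bullet> (y - x) \<partial>K x) = 0"
proof -
  have i: "integrable (K x) (\<lambda>y. u $ i * (y $ i - x $ i))" for i
    using integrable_nth[OF x, of i] by simp
  have z: "(\<integral>y. u $ i * (y $ i - x $ i) \<partial>K x) = 0" for i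
    using integrable_nth[OF x, of i] mean_nth[OF x, of i] by simp
  have eq: "u \<bullet> (y - x) = (\<Sum>i\<in>UNIV. u $ i * (y $ i - x $ i))" for y
    by (simp add: inner_vec_def)
  show "integrable (K x) (\<lambda>y. u \<bullet> (y - x))"
    unfolding eq by (intro Bochner_Integration.integrable_sum i)
  have "(\<integral>y. u \<bullet> (y - x) \<partial>K x) = (\<Sum>i\<in>UNIV. \<integral>y. u $ i * (y $ i - x $ i) \<partial>K x)"
    unfolding eq by (intro Bochner_Integration.integral_sum i)
  then show "(\<integral>y. u \<bullet> (y - x) \<partial>K x) = 0" by (simp only: z sum.neutral_const)
qed

text \<open>The mean subtracted in \<open>probe\<close> multiplies
  \<open>\<xi> x \<bullet> (y - x)\<close>, whose integral vanishes at a centred point. What remains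
  is the integral of \<open>saturate r * r\<close>, which is nonnegative and vanishes only if
  \<open>r\<close> does almost surely.\<close>

lemma inner_shift_probe:
  assumes x: "x \<in> centered" and \<xi>[measurable]: "\<xi> \<in> borel_measurable borel"
  shows "\<xi> x \<bullet> shift (probe \<xi>) x = (\<integral>y. saturate (\<xi> x \<bullet> (y - x)) * (\<xi> x \<bullet> (y - x)) \<partial>K x) / 8"
    and "integrable (K x) (\<lambda>y. saturate (\<xi> x \<bullet> (y - x)) * (\<xi> x \<bullet> (y - x)))"
proof -
  let ?\<tau> = "\<lambda>y. probe \<xi> (x, y)" and ?r = "\<lambda>y. \<xi> x \<bullet> (y - x)"
  define M where "M = (\<integral>y. saturate (?r y) \<partial>K x)"
  have t: "tilt (probe \<xi>)" by (rule tilt_probe[OF \<xi>])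
  have \<tau>0: "(\<integral>y. ?\<tau> y \<partial>K x) = 0" using t x by (simp add: tilt_def)
  have \<tau>m[measurable]: "probe \<xi> \<in> borel_measurable (borel \<Otimes>\<^sub>M borel)" using t by (simp add: tilt_def)
  have \<tau>b: "\<bar>?\<tau> y\<bar> \<le> 1 / 4" for y using t unfolding tilt_def by blast
  have i\<tau>: "integrable (K x) ?\<tau>" by (rule integrable_K_bounded[OF _ \<tau>b]) measurable
  have i\<tau>r: "integrable (K x) (\<lambda>y. ?\<tau> y * ?r y)"
    by (rule integrable_K_bounded_mult[OF inner_centered(1)[OF x] _ \<tau>b]) measurable
  show isr: "integrable (K x) (\<lambda>y. saturate (?r y) * ?r y)"
    by (rule integrable_K_bounded_mult[OF inner_centered(1)[OF x] _ abs_saturate_le]) measurable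
  have "\<xi> x \<bullet> shift (probe \<xi>) x = (\<Sum>i\<in>UNIV. \<xi> x $ i * (\<integral>y. ?\<tau> y * y $ i \<partial>K x))"
    by (simp add: inner_vec_def shift_def)
  also have "\<dots> = (\<integral>y. (\<Sum>i\<in>UNIV. \<xi> x $ i * (?\<tau> y * y $ i)) \<partial>K x)"
    using integrable_tilt_nth[OF t x] by (simp add: Bochner_Integration.integral_sum)
  also have "\<dots> = (\<integral>y. ?\<tau> y * ?r y + ?\<tau> y * (\<xi> x \<bullet> x) \<partial>K x)"
    by (simp add: inner_vec_def sum_distrib_left algebra_simps sum_subtractf)
  also have "\<dots> = (\<integral>y. ?\<tau> y * ?r y \<partial>K x)"
    using i\<tau> i\<tau>r \<tau>0 by simp
  also have "\<dots> = (\<integral>y. (saturate (?r y) * ?r y - M * ?r y) / 8 \<partial>K x)"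
    using x by (intro Bochner_Integration.integral_cong) (auto simp: probe_def M_def algebra_simps)
  also have "\<dots> = (\<integral>y. saturate (?r y) * ?r y \<partial>K x) / 8"
    using isr inner_centered[OF x, of "\<xi> x"] by simp
  finally show "\<xi> x \<bullet> shift (probe \<xi>) x = (\<integral>y. saturate (?r y) * ?r y \<partial>K x) / 8" .
qed

lemma inner_shift_probe_nonneg:
  assumes "x \<in> centered" and "\<xi> \<in> borel_measurable borel"
  shows "0 \<le> \<xi> x \<bullet> shift (probe \<xi>) x"
proof -
  have "0 \<le> (\<integral>y. saturate (\<xi> x \<bullet> (y - x)) * (\<xi> x \<bullet> (y - x)) \<partial>K x)"
    using saturate_mult(1) by (intro integral_nonneg_AE) auto
  then show ?thesis using inner_shift_probe(1)[OF assms] by simp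
qed

lemma inner_shift_probe_eq_0:
  assumes "x \<in> centered" and "\<xi> \<in> borel_measurable borel" and "\<xi> x \<bullet> shift (probe \<xi>) x = 0"
  shows "AE y in K x. \<xi> x \<bullet> (y - x) = 0"
proof -
  have "(\<integral>y. saturate (\<xi> x \<bullet> (y - x)) * (\<xi> x \<bullet> (y - x)) \<partial>K x) = 0"
    using inner_shift_probe(1)[OF assms(1,2)] assms(3) by simp
  then show ?thesis
    using integral_nonneg_eq_0_iff_AE[OF inner_shift_probe(2)[OF assms(1,2)]] saturate_mult by simp
qed

text \<open>With \<open>\<sigma> = 0\<close> only the kink remains,
  \<open>norm (shift \<tau> x) * measure (K x) {x}\<close>. An atom at \<open>x\<close> thus forces
  every probed shift to vanish, and probing the coordinate axes leaves no direction in which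
  \<open>K x\<close> can spread.\<close>

lemma AE_atom_at_mean: "AE x in \<rho>. measure (K x) {x} \<noteq> 0 \<longrightarrow> (AE y in K x. y = x)"
proof -
  have t0: "tilt (\<lambda>_. 0)" by (simp add: tilt_def)
  have s0: "shift (\<lambda>_. 0) x = 0" for x by (simp add: shift_def vec_eq_iff)
  have one: "AE x in \<rho>. measure (K x) {x} \<noteq> 0 \<longrightarrow> (AE y in K x. (y - x) $ i = 0)" for i
  proof -
    let ?\<xi> = "\<lambda>_ :: real ^ 'n. axis i 1 :: real ^ 'n"
    have \<xi>: "?\<xi> \<in> borel_measurable borel" by simp
    have "AE x in \<rho>. (\<integral>y. norm (shift (probe ?\<xi>) x) * of_bool (y = x) + 0 * (sgn (x - y) \<bullet> shift (probe ?\<xi>) x) \<partial>K x) \<le> 0"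
      by (rule first_order_optimality[OF t0 s0 tilt_probe[OF \<xi>]])
    with AE_centered show ?thesis
    proof eventually_elim
      case (elim x)
      let ?V = "shift (probe ?\<xi>) x"
      have "(\<integral>y. norm ?V * of_bool (y = x) + 0 * (sgn (x - y) \<bullet> ?V) \<partial>K x) = (\<integral>y. norm ?V * indicator {x} y \<partial>K x)"
        by (intro Bochner_Integration.integral_cong) (auto simp: indicator_def)
      also have "\<dots> = norm ?V * measure (K x) {x}" by simp
      finally have le: "norm ?V * measure (K x) {x} \<le> 0" using elim(2) by (simp only:)
      show ?case
      proof
        assume "measure (K x) {x} \<noteq> 0"
        then have "measure (K x) {x} > 0" by (simp add: less_le)
        then have "shift (probe ?\<xi>) x = 0"
          using le by (simp add: mult_le_0_iff)
        then have "AE y in K x. axis i 1 \<bullet> (y - x) = 0"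
          using inner_shift_probe_eq_0[OF elim(1) \<xi>] by simp
        then show "AE y in K x. (y - x) $ i = 0" by (simp add: inner_axis')
      qed
    qed
  qed
  have "AE x in \<rho>. \<forall>i\<in>UNIV. measure (K x) {x} \<noteq> 0 \<longrightarrow> (AE y in K x. (y - x) $ i = 0)"
    using one by (intro AE_finite_allI) auto
  then show ?thesis
  proof eventually_elim
    case (elim x)
    show ?case
    proof
      assume "measure (K x) {x} \<noteq> 0"
      then have "AE y in K x. \<forall>i\<in>UNIV. (y - x) $ i = 0"
        using elim by (intro AE_finite_allI) auto
      then show "AE y in K x. y = x" by eventually_elim (simp add: vec_eq_iff)
    qed
  qed
qed

text \<open>The probe is taken along \<open>w\<close> itself. Its gain is at least
  \<open>w x \<bullet> shift (probe w) x\<close>, which is nonnegative, so optimality makes it 0 and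
  \<open>w x\<close> is orthogonal to almost every \<open>y - x\<close>. As
  \<open>sgn (x - y)\<close> is parallel to \<open>y - x\<close>, the integral representing
  \<open>w x \<bullet> w x\<close> vanishes.\<close>

lemma AE_residual_orthogonal:
  assumes \<sigma>: "tilt \<sigma>" and \<sigma>1: "\<And>x. x \<in> centered \<Longrightarrow> shift \<sigma> x = 0"
  shows "AE x in \<rho>. \<forall>i. (\<integral>y. \<sigma> (x, y) * sgn (x - y) $ i \<partial>K x) = 0"
proof -
  have \<sigma>m[measurable]: "\<sigma> \<in> borel_measurable (borel \<Otimes>\<^sub>M borel)" and \<sigma>b: "\<bar>\<sigma> z\<bar> \<le> 1 / 4" for z
    using \<sigma> unfolding tilt_def by blast+
  define w where "w x = (\<chi> i. \<integral>y. \<sigma> (x, y) * sgn (x - y) $ i \<partial>K x)" for x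
  have sgn_m[measurable]: "sgn \<in> borel_measurable (borel :: (real ^ 'n) measure)"
    unfolding sgn_div_norm by measurable
  have wm: "w \<in> borel_measurable borel"
  proof (rule borel_measurable_vecI)
    show "(\<lambda>x. w x $ i) \<in> borel_measurable borel" for i
      using integral_K_measurable[of "\<lambda>z. \<sigma> z * sgn (fst z - snd z) $ i"] by (simp add: w_def)
  qed
  have sgn1: "\<bar>sgn v $ i\<bar> \<le> 1" for v :: "real ^ 'n" and i
    using component_le_norm_cart[of "sgn v" i] norm_sgn[of v] by (auto split: if_splits)
  have iw: "integrable (K x) (\<lambda>y. \<sigma> (x, y) * sgn (x - y) $ i)" for x i
    by (rule integrable_K_bounded_mult[OF integrable_K_bounded[OF _ sgn1] _ \<sigma>b]) measurable
  have w_inner: "(\<integral>y. \<sigma> (x, y) * (sgn (x - y) \<bullet> v) \<partial>K x) = w x \<bullet> v"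
    and iw_inner: "integrable (K x) (\<lambda>y. \<sigma> (x, y) * (sgn (x - y) \<bullet> v))" for x v
  proof -
    have eq: "\<sigma> (x, y) * (sgn (x - y) \<bullet> v) = (\<Sum>i\<in>UNIV. (\<sigma> (x, y) * sgn (x - y) $ i) * v $ i)" for y
      by (simp add: inner_vec_def sum_distrib_left mult.assoc)
    show "integrable (K x) (\<lambda>y. \<sigma> (x, y) * (sgn (x - y) \<bullet> v))" unfolding eq using iw by simp
    show "(\<integral>y. \<sigma> (x, y) * (sgn (x - y) \<bullet> v) \<partial>K x) = w x \<bullet> v"
      unfolding eq using iw by (simp add: Bochner_Integration.integral_sum inner_vec_def w_def)
  qed
  have "AE x in \<rho>. (\<integral>y. norm (shift (probe w) x) * of_bool (y = x) + \<sigma> (x, y) * (sgn (x - y) \<bullet> shift (probe w) x) \<partial>K x) \<le> 0"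
    by (rule first_order_optimality[OF \<sigma> \<sigma>1 tilt_probe[OF wm]])
  with AE_centered show ?thesis
  proof eventually_elim
    case (elim x)
    let ?V = "shift (probe w) x"
    have "(\<integral>y. \<sigma> (x, y) * (sgn (x - y) \<bullet> ?V) \<partial>K x)
        \<le> (\<integral>y. norm ?V * of_bool (y = x) + \<sigma> (x, y) * (sgn (x - y) \<bullet> ?V) \<partial>K x)"
    proof (rule integral_mono[OF iw_inner])
      have "integrable (K x) (\<lambda>y. norm ?V * indicator {x} y)"
        by (intro integrable_mult_right integrable_K_bounded[where C=1]) (auto simp: indicator_def)
      moreover have "(\<lambda>y. norm ?V * indicator {x} y) = (\<lambda>y. norm ?V * of_bool (y = x))"
        by (auto simp: indicator_def)
      ultimately show "integrable (K x) (\<lambda>y. norm ?V * of_bool (y = x) + \<sigma> (x, y) * (sgn (x - y) \<bullet> ?V))"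
        using iw_inner[of x ?V] by simp
    qed simp
    then have "w x \<bullet> ?V \<le> 0" using elim(2) by (simp add: w_inner)
    then have "w x \<bullet> ?V = 0" using inner_shift_probe_nonneg[OF elim(1) wm] by simp
    then have "AE y in K x. w x \<bullet> (y - x) = 0" by (rule inner_shift_probe_eq_0[OF elim(1) wm])
    then have "AE y in K x. \<sigma> (x, y) * (sgn (x - y) \<bullet> w x) = 0"
    proof eventually_elim
      case (elim y)
      then have "(x - y) \<bullet> w x = 0" by (simp add: inner_diff_left inner_diff_right inner_commute)
      then show ?case by (simp add: sgn_div_norm)
    qed
    then have "w x \<bullet> w x = 0" unfolding w_inner[symmetric] by (rule integral_eq_zero_AE)
    then have "w x = 0" by simp
    then show ?case by (simp add: w_def vec_eq_iff)
  qed
qed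

text \<open>The residual \<open>R\<close> of the projection is orthogonal to every
  \<open>E k\<close> by construction and to \<open>f\<close> by optimality. Being \<open>f\<close>
  minus a combination of the \<open>E k\<close>, it is orthogonal to itself, hence vanishes almost
  everywhere.\<close>

lemma AE_direction_nth_affine:
  "AE x in \<rho>. \<exists>a (b :: 'n \<Rightarrow> real). AE y in K x. sgn (x - y) $ j = a + (\<Sum>i\<in>UNIV. b i * (y - x) $ i)"
proof -
  \<comment> \<open>The factor \<open>1 / (1 + norm (y - x))\<close> makes all functions bounded; it enters \<open>\<sigma>\<close> twice.\<close>
  define E where "E k z = (case k of None \<Rightarrow> 1 | Some i \<Rightarrow> (snd z - fst z) $ i) / (1 + norm (snd z - fst z))"
    for k :: "'n option" and z :: "(real ^ 'n) \<times> (real ^ 'n)"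
  define f where "f z = sgn (fst z - snd z) $ j / (1 + norm (snd z - fst z))" for z :: "(real ^ 'n) \<times> (real ^ 'n)"
  have sgn_m[measurable]: "sgn \<in> borel_measurable (borel :: (real ^ 'n) measure)"
    unfolding sgn_div_norm by measurable
  have fm[measurable]: "f \<in> borel_measurable (borel \<Otimes>\<^sub>M borel)" unfolding f_def by measurable
  have Em[measurable]: "E k \<in> borel_measurable (borel \<Otimes>\<^sub>M borel)" for k
    unfolding E_def by (cases k) simp_all
  have sgn1: "\<bar>sgn v $ i\<bar> \<le> 1" for v :: "real ^ 'n" and i
    using component_le_norm_cart[of "sgn v" i] norm_sgn[of v] by (auto split: if_splits)
  have pos: "0 < 1 + norm v" for v :: "real ^ 'n" by (rule add_pos_nonneg) auto
  have f1: "\<bar>f z\<bar> \<le> 1" for z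
    unfolding f_def abs_divide using sgn1[of "fst z - snd z" j] pos[of "snd z - fst z"]
    by (simp add: divide_le_eq) (meson norm_ge_zero add_increasing2 order.trans)
  have E1: "\<bar>E k z\<bar> \<le> 1" for k z
  proof (cases k)
    case (Some i)
    have "\<bar>(snd z - fst z) $ i\<bar> \<le> 1 + norm (snd z - fst z)"
      using component_le_norm_cart[of "snd z - fst z" i] by simp
    then show ?thesis unfolding E_def Some abs_divide using pos[of "snd z - fst z"] by (simp add: divide_le_eq)
  qed (use pos[of "snd z - fst z"] in \<open>simp add: E_def divide_le_eq\<close>)
  obtain c where cm[measurable]: "\<And>k. c k \<in> borel_measurable borel"
    and c: "\<And>x k. (\<integral>y. (f (x, y) - (\<Sum>k\<in>UNIV. c k x * E k (x, y))) * E k (x, y) \<partial>K x) = 0"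
  proof -
    have "\<exists>c. (\<forall>k. c k \<in> borel_measurable borel) \<and>
      (\<forall>x. \<forall>k\<in>UNIV. (\<integral>y. (f (x, y) - (\<Sum>k\<in>UNIV. c k x * E k (x, y))) * E k (x, y) \<partial>K x) = 0)"
    proof (rule kernel_projection)
      show "\<exists>C. \<forall>y. \<bar>f (x, y)\<bar> \<le> C" "\<exists>C. \<forall>y. \<bar>E k (x, y)\<bar> \<le> C" for k x
        using f1 E1 by blast+
    qed (use fm Em in auto)
    then show ?thesis using that by blast
  qed
  define R where "R z = f z - (\<Sum>k\<in>UNIV. c k (fst z) * E k z)" for z
  \<comment> \<open>\<open>N x / 4\<close> bounds the residual over all \<open>y\<close>. Depending
    on \<open>x\<close> alone, it can be divided out without disturbing orthogonality.\<close>
  define N where "N x = 4 * (1 + (\<Sum>k\<in>UNIV. \<bar>c k x\<bar>))" for x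
  have N: "4 \<le> N x" for x unfolding N_def by (simp add: sum_nonneg)
  have Rm[measurable]: "R \<in> borel_measurable (borel \<Otimes>\<^sub>M borel)" unfolding R_def by measurable
  have Nm[measurable]: "N \<in> borel_measurable borel" unfolding N_def by measurable
  have RN: "\<bar>R (x, y)\<bar> \<le> N x / 4" for x y
  proof -
    have "\<bar>\<Sum>k\<in>UNIV. c k x * E k (x, y)\<bar> \<le> (\<Sum>k\<in>UNIV. \<bar>c k x\<bar> * 1)"
      using E1 by (intro order.trans[OF sum_abs] sum_mono) (auto simp: abs_mult intro!: mult_left_le)
    then have "\<bar>R (x, y)\<bar> \<le> 1 + (\<Sum>k\<in>UNIV. \<bar>c k x\<bar>)"
      using f1[of "(x, y)"] abs_triangle_ineq4[of "f (x, y)" "\<Sum>k\<in>UNIV. c k x * E k (x, y)"]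
      unfolding R_def fst_conv by simp
    then show ?thesis by (simp add: N_def)
  qed
  define \<sigma> where "\<sigma> z = R z / ((1 + norm (snd z - fst z)) * N (fst z))" for z
  have \<sigma>m[measurable]: "\<sigma> \<in> borel_measurable (borel \<Otimes>\<^sub>M borel)" unfolding \<sigma>_def by measurable
  have \<sigma>E: "\<sigma> (x, y) = R (x, y) * E None (x, y) / N x" "\<sigma> (x, y) * (y - x) $ i = R (x, y) * E (Some i) (x, y) / N x"
    "\<sigma> (x, y) * sgn (x - y) $ j = R (x, y) * f (x, y) / N x" for x y i
    by (simp_all add: \<sigma>_def E_def f_def)
  have RE: "(\<integral>y. R (x, y) * E k (x, y) \<partial>K x) = 0" for x k using c by (simp add: R_def)
  have \<sigma>0: "(\<integral>y. \<sigma> (x, y) \<partial>K x) = 0" for x unfolding \<sigma>E(1) using RE by simp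
  have \<sigma>b: "\<bar>\<sigma> z\<bar> \<le> 1 / 4" for z
  proof -
    have "\<bar>R z\<bar> \<le> N (fst z) / 4" using RN[of "fst z" "snd z"] by simp
    also have "\<dots> \<le> (1 + norm (snd z - fst z)) * N (fst z) / 4"
      using N[of "fst z"] by (simp add: mult_le_cancel_right1)
    finally show ?thesis
      unfolding \<sigma>_def abs_divide using N[of "fst z"] pos[of "snd z - fst z"]
      by (simp add: divide_le_eq abs_mult)
  qed
  have t: "tilt \<sigma>" using \<sigma>0 \<sigma>b by (simp add: tilt_def)
  have shift0: "shift \<sigma> x = 0" if x: "x \<in> centered" for x
  proof -
    have "(\<integral>y. \<sigma> (x, y) * y $ i \<partial>K x) = 0" for i
    proof -
      have "(\<integral>y. \<sigma> (x, y) * (y - x) $ i \<partial>K x) = 0" unfolding \<sigma>E(2) using RE by simp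
      moreover have "integrable (K x) (\<lambda>y. \<sigma> (x, y))"
        by (rule integrable_K_bounded[OF _ \<sigma>b]) measurable
      moreover have "(\<integral>y. \<sigma> (x, y) * y $ i \<partial>K x) - (\<integral>y. \<sigma> (x, y) * x $ i \<partial>K x) = (\<integral>y. \<sigma> (x, y) * (y - x) $ i \<partial>K x)"
        using integrable_tilt_nth[OF t x, of i] \<open>integrable (K x) (\<lambda>y. \<sigma> (x, y))\<close>
        by (subst Bochner_Integration.integral_diff[symmetric]) (auto simp: algebra_simps)
      ultimately show ?thesis using \<sigma>0 by simp
    qed
    then show ?thesis by (simp add: shift_def vec_eq_iff)
  qed
  have "AE x in \<rho>. \<forall>i. (\<integral>y. \<sigma> (x, y) * sgn (x - y) $ i \<partial>K x) = 0"
    by (rule AE_residual_orthogonal[OF t shift0])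
  then show ?thesis
  proof eventually_elim
    case (elim x)
    have iR: "integrable (K x) (\<lambda>y. R (x, y))" by (rule integrable_K_bounded[OF _ RN]) measurable
    have iRE: "integrable (K x) (\<lambda>y. R (x, y) * E k (x, y))" "integrable (K x) (\<lambda>y. R (x, y) * f (x, y))"
      "integrable (K x) (\<lambda>y. R (x, y) * R (x, y))" for k
    proof -
      have "integrable (K x) (\<lambda>y. E k (x, y) * R (x, y))"
        by (rule integrable_K_bounded_mult[OF iR _ E1]) measurable
      then show "integrable (K x) (\<lambda>y. R (x, y) * E k (x, y))" by (simp add: mult.commute)
      have "integrable (K x) (\<lambda>y. f (x, y) * R (x, y))"
        by (rule integrable_K_bounded_mult[OF iR _ f1]) measurable
      then show "integrable (K x) (\<lambda>y. R (x, y) * f (x, y))" by (simp add: mult.commute)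
      show "integrable (K x) (\<lambda>y. R (x, y) * R (x, y))"
        by (rule integrable_K_bounded_mult[OF iR _ RN]) measurable
    qed
    have "(\<integral>y. R (x, y) * f (x, y) / N x \<partial>K x) = 0" using elim by (simp add: \<sigma>E(3)[symmetric])
    then have Rf: "(\<integral>y. R (x, y) * f (x, y) \<partial>K x) = 0" using N[of x] by simp
    have "(\<integral>y. R (x, y) * R (x, y) \<partial>K x) = (\<integral>y. R (x, y) * f (x, y) - (\<Sum>k\<in>UNIV. c k x * (R (x, y) * E k (x, y))) \<partial>K x)"
      by (intro Bochner_Integration.integral_cong refl)
        (subst (2) R_def, simp add: algebra_simps sum_distrib_left)
    also have "\<dots> = 0" using iRE Rf RE by simp
    finally have "AE y in K x. R (x, y) * R (x, y) = 0"
      using integral_nonneg_eq_0_iff_AE[OF iRE(3)] by simp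
    then have "AE y in K x. sgn (x - y) $ j = c None x + (\<Sum>i\<in>UNIV. c (Some i) x * (y - x) $ i)"
    proof eventually_elim
      case (elim y)
      let ?n = "1 + norm (y - x)"
      have "f (x, y) = c None x * E None (x, y) + (\<Sum>i\<in>UNIV. c (Some i) x * E (Some i) (x, y))"
        using elim by (simp add: R_def UNIV_option_conv sum.reindex)
      then have "sgn (x - y) $ j / ?n = (c None x + (\<Sum>i\<in>UNIV. c (Some i) x * (y - x) $ i)) / ?n"
        by (simp add: f_def E_def add_divide_distrib sum_divide_distrib)
      then show ?case using pos[of "y - x"] by simp
    qed
    then show ?case by (rule exI[of _ "c None x", OF exI[of _ "\<lambda>i. c (Some i) x"]])
  qed
qed

end

section \<open>Extremality\<close>

text \<open>The set \<open>C\<close> is the hull of the set \<open>S\<close> of points obeying the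
  direction formula. For \<open>y\<close> in \<open>S\<close> with direction \<open>u\<close>, the
  affine function \<open>f z = u \<bullet> (a + L (z - x))\<close> is at most 1 on \<open>S\<close>,
  with equality only on the line through \<open>x\<close> along \<open>u\<close>. A segment of the
  hull around \<open>y\<close> must lie in that line, where \<open>norm a < 1\<close> keeps
  \<open>f\<close> from being constantly 1.\<close>

lemma extreme_points_if_direction_affine:
  fixes x a :: "'a::euclidean_space" and L :: "'a \<Rightarrow> 'a"
  assumes "prob_space M" and sM: "sets M = sets borel" and L: "linear L"
    and mi: "\<And>u. integrable M (\<lambda>y. u \<bullet> (y - x))" and m0: "\<And>u. (\<integral>y. u \<bullet> (y - x) \<partial>M) = 0"
    and ne: "AE y in M. y \<noteq> x" and dir: "AE y in M. sgn (x - y) = a + L (y - x)"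
  shows "\<exists>C. convex C \<and> (AE y in M. y extreme_point_of C)"
proof -
  interpret prob_space M by fact
  \<comment> \<open>\<open>a\<close> is the mean of the unit vectors \<open>sgn (x - y)\<close>, as
    \<open>L (y - x)\<close> has mean 0. Were its norm at least 1, almost every \<open>y\<close>
    would satisfy \<open>a \<bullet> sgn (x - y) = a \<bullet> a\<close>, so all mass would lie
    strictly on one side of \<open>x\<close>, against \<open>m0\<close>.\<close>
  have na: "norm a < 1"
  proof (rule ccontr)
    assume "\<not> norm a < 1"
    then have a1: "1 \<le> norm a" by simp
    then have n1: "norm a \<le> a \<bullet> a" "0 < a \<bullet> a"
      unfolding dot_square_norm power2_eq_square using mult_left_mono[OF a1, of "norm a"] by auto
    have aL: "a \<bullet> L z = adjoint L a \<bullet> z" for z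
      using adjoint_works[OF L, of z a] by (simp add: inner_commute)
    have i: "integrable M (\<lambda>y. a \<bullet> a - a \<bullet> (a + L (y - x)))" "(\<integral>y. a \<bullet> a - a \<bullet> (a + L (y - x)) \<partial>M) = 0"
      using mi[of "adjoint L a"] m0[of "adjoint L a"] by (simp_all add: inner_add_right aL)
    have "AE y in M. 0 \<le> a \<bullet> a - a \<bullet> (a + L (y - x))"
      using dir
    proof eventually_elim
      case (elim y)
      have "a \<bullet> sgn (x - y) \<le> norm a * norm (sgn (x - y))" by (rule norm_cauchy_schwarz)
      also have "\<dots> \<le> norm a * 1" by (intro mult_left_mono) (auto simp: norm_sgn)
      finally show ?case using n1 elim by simp
    qed
    then have "AE y in M. a \<bullet> a - a \<bullet> (a + L (y - x)) = 0"
      using integral_nonneg_eq_0_iff_AE[OF i(1)] i(2) by simp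
    with dir ne have neg: "AE y in M. 0 < a \<bullet> (x - y)"
    proof eventually_elim
      case (elim y)
      have "a \<bullet> v = norm v * (a \<bullet> sgn v)" for v
        by (cases "v = 0") (simp_all add: sgn_div_norm)
      then have "a \<bullet> (x - y) = norm (x - y) * (a \<bullet> sgn (x - y))" .
      also have "a \<bullet> sgn (x - y) = a \<bullet> a" using elim by simp
      finally show ?case using elim n1 by simp
    qed
    have im: "integrable M (\<lambda>y. a \<bullet> (x - y))" "(\<integral>y. a \<bullet> (x - y) \<partial>M) = 0"
      using mi[of "- a"] m0[of "- a"] by (simp_all add: inner_diff_right algebra_simps)
    have "AE y in M. a \<bullet> (x - y) = 0"
    proof -
      have "AE y in M. 0 \<le> a \<bullet> (x - y)" using neg by eventually_elim simp
      then show ?thesis using integral_nonneg_eq_0_iff_AE[OF im(1)] im(2) by simp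
    qed
    with neg have "AE y in M. False" by eventually_elim simp
    then show False by simp
  qed
  define S where "S = {y. y \<noteq> x \<and> sgn (x - y) = a + L (y - x)}"
  have "y extreme_point_of (convex hull S)" if y: "y \<in> S" for y
  proof -
    define u where "u = sgn (x - y)"
    have norm1: "norm (sgn (x - s)) = 1" if "s \<in> S" for s
      using that norm_sgn[of "x - s"] by (auto simp: S_def)
    have u1: "norm u = 1" unfolding u_def by (rule norm1[OF y])
    define f where "f z = u \<bullet> (a + L (z - x))" for z
    have fc: "f (s *\<^sub>R p + t *\<^sub>R q) = s * f p + t * f q" if "s + t = 1" for s t p q
    proof -
      have "s *\<^sub>R p + t *\<^sub>R q - x = s *\<^sub>R (p - x) + t *\<^sub>R (q - x)"
        using that by (simp add: algebra_simps flip: scaleR_add_left)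
      then have "L (s *\<^sub>R p + t *\<^sub>R q - x) = s *\<^sub>R L (p - x) + t *\<^sub>R L (q - x)"
        by (simp add: linear_add[OF L] linear_scale[OF L])
      moreover have "a = s *\<^sub>R a + t *\<^sub>R a" using that by (simp flip: scaleR_add_left)
      ultimately have "a + L (s *\<^sub>R p + t *\<^sub>R q - x) = s *\<^sub>R (a + L (p - x)) + t *\<^sub>R (a + L (q - x))"
        by (metis (no_types, lifting) add.assoc add.left_commute scaleR_add_right)
      then show ?thesis by (simp add: f_def inner_add_right)
    qed
    \<comment> \<open>An open half-space together with a line in its boundary: it contains \<open>S\<close> because unit vectors
      \<open>u\<close>, \<open>v\<close> satisfy \<open>u \<bullet> v < 1\<close> unless \<open>u = v\<close>.\<close>
    define E where "E = {z. f z < 1 \<or> (f z = 1 \<and> z - x \<in> span {u})}"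
    have "convex E"
    proof (rule convexI)
      fix p q and s t :: real
      assume pq: "p \<in> E" "q \<in> E" and st: "0 \<le> s" "0 \<le> t" "s + t = 1"
      have fp: "f p \<le> 1" "f q \<le> 1" using pq by (auto simp: E_def)
      have fle: "s * f p + t * f q \<le> s * 1 + t * 1"
        using fp st by (intro add_mono mult_left_mono) auto
      show "s *\<^sub>R p + t *\<^sub>R q \<in> E"
      proof (cases "s = 0 \<or> t = 0")
        case True
        then show ?thesis using pq st by auto
      next
        case False
        then have pos: "0 < s" "0 < t" using st by auto
        show ?thesis
        proof (cases "f p = 1 \<and> f q = 1")
          case True
          have "s *\<^sub>R p + t *\<^sub>R q - x = s *\<^sub>R (p - x) + t *\<^sub>R (q - x)"
            using st(3) by (simp add: algebra_simps flip: scaleR_add_left)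
          moreover have "p - x \<in> span {u}" "q - x \<in> span {u}" using True pq by (auto simp: E_def)
          ultimately have "s *\<^sub>R p + t *\<^sub>R q - x \<in> span {u}" by (simp add: span_add span_scale)
          moreover have "f (s *\<^sub>R p + t *\<^sub>R q) = 1" using True fc[OF st(3)] st(3) by simp
          ultimately show ?thesis by (simp add: E_def)
        next
          case False
          then have "s * f p < s * 1 \<or> t * f q < t * 1" using fp pos by (auto simp: less_le)
          moreover have "s * f p \<le> s * 1" "t * f q \<le> t * 1" using fp pos by (auto intro: mult_left_mono)
          ultimately have "s * f p + t * f q < 1" using st(3) by linarith
          then show ?thesis using fc[OF st(3)] by (simp add: E_def)
        qed
      qed
    qed
    moreover have "S \<subseteq> E"
    proof
      fix s assume s: "s \<in> S"
      define v where "v = sgn (x - s)"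
      have v1: "norm v = 1" unfolding v_def by (rule norm1[OF s])
      have fs: "f s = u \<bullet> v" using s by (simp add: f_def v_def S_def)
      have le: "u \<bullet> v \<le> 1" using norm_cauchy_schwarz[of u v] u1 v1 by simp
      show "s \<in> E"
      proof (cases "u \<bullet> v = 1")
        case True
        have "u \<bullet> u = 1" "v \<bullet> v = 1" using u1 v1 by (simp_all add: dot_square_norm)
        moreover have "(u - v) \<bullet> (u - v) = u \<bullet> u - 2 * (u \<bullet> v) + v \<bullet> v"
          by (simp only: inner_diff_left inner_diff_right inner_commute[of v u])
        ultimately have "(u - v) \<bullet> (u - v) = 0" using True by simp
        then have "u = v" by simp
        have polar: "norm w *\<^sub>R sgn w = w" for w :: 'a
          by (cases "w = 0") (simp_all add: sgn_div_norm)
        have "s - x = - (norm (x - s) *\<^sub>R sgn (x - s))" by (simp only: polar) simp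
        then have "s - x = (- norm (x - s)) *\<^sub>R u" by (simp only: \<open>u = v\<close> v_def scaleR_minus_left)
        then have "s - x \<in> span {u}" by (metis span_base span_scale singletonI)
        then show ?thesis using True fs by (simp add: E_def)
      qed (use le fs in \<open>simp add: E_def\<close>)
    qed
    ultimately have hull: "convex hull S \<subseteq> E" by (rule hull_minimal[rotated])
    show ?thesis
      unfolding extreme_point_of_def
    proof (intro conjI ballI notI)
      show "y \<in> convex hull S" using y by (rule hull_inc)
      fix p q assume p: "p \<in> convex hull S" and q: "q \<in> convex hull S" and "y \<in> open_segment p q"
      then obtain t where pq: "p \<noteq> q" and t: "0 < t" "t < 1" and yt: "y = (1 - t) *\<^sub>R p + t *\<^sub>R q"
        by (auto simp: in_segment)
      have E: "p \<in> E" "q \<in> E" using p q hull by auto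
      have "f y = u \<bullet> u" using y by (simp add: f_def u_def S_def)
      then have "f y = 1" using u1 by (simp add: dot_square_norm)
      then have eq: "(1 - t) * f p + t * f q = 1" using fc[of "1 - t" t p q] yt by simp
      have "f p \<le> 1" "f q \<le> 1" using E by (auto simp: E_def)
      then have "(1 - t) * (1 - f p) \<ge> 0" "t * (1 - f q) \<ge> 0" using t by auto
      moreover have "(1 - t) * (1 - f p) + t * (1 - f q) = 0" using eq by (simp add: algebra_simps)
      ultimately have "(1 - t) * (1 - f p) = 0" "t * (1 - f q) = 0" by linarith+
      then have f1: "f p = 1" "f q = 1" using t by auto
      then have "p - x \<in> span {u}" "q - x \<in> span {u}" using E by (auto simp: E_def)
      then obtain \<alpha> \<beta> where \<alpha>: "p - x = \<alpha> *\<^sub>R u" and \<beta>: "q - x = \<beta> *\<^sub>R u"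
        by (auto simp: span_singleton)
      have "\<alpha> \<noteq> \<beta>"
      proof
        assume "\<alpha> = \<beta>"
        then have "p - x = q - x" using \<alpha> \<beta> by simp
        then show False using pq by simp
      qed
      \<comment> \<open>Two different points of the line give \<open>f\<close> the value 1, so
        \<open>f\<close> has slope 0 along it; its value at \<open>x\<close> is then
        \<open>u \<bullet> a = 1\<close>, too large for \<open>norm a < 1\<close>.\<close>
      have "u \<bullet> a + \<alpha> * (u \<bullet> L u) = 1" "u \<bullet> a + \<beta> * (u \<bullet> L u) = 1"
        using f1 by (simp_all add: f_def \<alpha> \<beta> linear_scale[OF L] inner_add_right)
      then have "(\<alpha> - \<beta>) * (u \<bullet> L u) = 0" unfolding left_diff_distrib by linarith
      then have "u \<bullet> L u = 0" using \<open>\<alpha> \<noteq> \<beta>\<close> by simp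
      then have "u \<bullet> a = 1" using \<open>u \<bullet> a + \<alpha> * (u \<bullet> L u) = 1\<close> by simp
      then show False using norm_cauchy_schwarz[of u a] u1 na by simp
    qed
  qed
  moreover have "AE y in M. y \<in> S" using ne dir by eventually_elim (simp add: S_def)
  ultimately have "AE y in M. y extreme_point_of (convex hull S)" by (auto elim: eventually_mono)
  then show ?thesis using convex_convex_hull by blast
qed

theorem theorem1p1:
  fixes \<mu> \<nu> :: "'n::finite \<Rightarrow> real measure"
    and \<pi> :: "((real ^ 'n) \<times> (real ^ 'n)) measure"
    and K :: "real ^ 'n \<Rightarrow> (real ^ 'n) measure"
  assumes "\<And>i. prob_space (\<mu> i)" and "\<And>i. sets (\<mu> i) = sets borel"
    and "\<And>i. prob_space (\<nu> i)" and "\<And>i. sets (\<nu> i) = sets borel"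
    and "\<And>i. integrable (\<mu> i) (\<lambda>x. x)" and "\<And>i. integrable (\<nu> i) (\<lambda>x. x)"
    and "\<And>i. convex_order (\<mu> i) (\<nu> i)"
    and "\<And>i. absolutely_continuous lborel (\<mu> i)"
    and "is_arg_max (\<lambda>\<gamma>. \<integral>z. norm (fst z - snd z) \<partial>\<gamma>) (\<lambda>\<gamma>. \<gamma> \<in> VMT \<mu> \<nu>) \<pi>"
    and "disintegration \<pi> K"
  shows "AE x in distr \<pi> borel fst.
           \<exists>C. convex C \<and> (AE y in K x. y extreme_point_of C)"
proof -
  have \<pi>: "\<pi> \<in> VMT \<mu> \<nu>"
    and opt: "\<And>\<gamma>. \<gamma> \<in> VMT \<mu> \<nu> \<Longrightarrow> (\<integral>z. norm (fst z - snd z) \<partial>\<gamma>) \<le> (\<integral>z. norm (fst z - snd z) \<partial>\<pi>)"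
    using assms(9) unfolding is_arg_max_linorder by auto
  note iff = VMT_iff[OF assms(5,6)]
  interpret optimal_coupling \<pi> K
  proof (intro optimal_coupling.intro martingale_coupling.intro disintegrated.intro
      martingale_coupling_axioms.intro optimal_coupling_axioms.intro)
    show "prob_space \<pi>" "sets \<pi> = sets borel" "disintegration \<pi> K"
      using \<pi> assms(10) unfolding iff by auto
    show "integrable \<pi> (\<lambda>z. fst z $ i)" "integrable \<pi> (\<lambda>z. snd z $ i)" for i
      using VMT_integrable[OF assms(5,6) \<pi>] by auto
    show "(\<integral>z. indicator A (fst z) * (snd z $ i - fst z $ i) \<partial>\<pi>) = 0" if "A \<in> sets borel" for i A
      using \<pi> that unfolding iff by blast
    show "absolutely_continuous lborel (distr \<pi> borel (\<lambda>z. fst z $ i))" for i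
      using \<pi> assms(8) unfolding iff by simp
    show "(\<integral>z. norm (fst z - snd z) \<partial>\<gamma>) \<le> (\<integral>z. norm (fst z - snd z) \<partial>\<pi>)"
      if "prob_space \<gamma>" "sets \<gamma> = sets borel"
        "\<And>i. distr \<gamma> borel (\<lambda>z. fst z $ i) = distr \<pi> borel (\<lambda>z. fst z $ i)"
        "\<And>i. distr \<gamma> borel (\<lambda>z. snd z $ i) = distr \<pi> borel (\<lambda>z. snd z $ i)"
        "\<And>i A. A \<in> sets borel \<Longrightarrow> (\<integral>z. indicator A (fst z) * (snd z $ i - fst z $ i) \<partial>\<gamma>) = 0" for \<gamma>
    proof (rule opt)
      show "\<gamma> \<in> VMT \<mu> \<nu>" using \<pi> that unfolding iff by auto
    qed
  qed
  have "AE x in \<rho>. \<forall>j\<in>UNIV. \<exists>a (b :: 'n \<Rightarrow> real). AE y in K x. sgn (x - y) $ j = a + (\<Sum>i\<in>UNIV. b i * (y - x) $ i)"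
    using AE_direction_nth_affine by (intro AE_finite_allI) auto
  with AE_centered AE_atom_at_mean show ?thesis
  proof eventually_elim
    case (elim x)
    \<comment> \<open>With an atom at \<open>x\<close>, \<open>K x\<close> is a point mass and a
      singleton serves. Otherwise \<open>y \<noteq> x\<close> almost surely, so
      \<open>sgn (x - y)\<close> is a unit vector, as the strict convexity argument
      requires.\<close>
    show ?case
    proof (cases "measure (K x) {x} = 0")
      case False
      then have "AE y in K x. y extreme_point_of {x}"
        using elim(2) by (auto simp: extreme_point_of_def)
      then show ?thesis by (intro exI[of _ "{x}"]) simp
    next
      case True
      then have ne: "AE y in K x. y \<noteq> x" using K.prob_eq_0[of "{x}" x] by simp
      have "\<forall>j. \<exists>ab :: real \<times> ('n \<Rightarrow> real). AE y in K x. sgn (x - y) $ j = fst ab + (\<Sum>i\<in>UNIV. snd ab i * (y - x) $ i)"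
        using elim(3) by auto
      from choice[OF this] obtain ab :: "'n \<Rightarrow> real \<times> ('n \<Rightarrow> real)"
        where ab: "\<And>j. AE y in K x. sgn (x - y) $ j = fst (ab j) + (\<Sum>i\<in>UNIV. snd (ab j) i * (y - x) $ i)"
        by auto
      define L where "L z = (\<chi> j. \<Sum>i\<in>UNIV. snd (ab j) i * z $ i)" for z :: "real ^ 'n"
      have L: "linear L"
        by (rule linearI) (simp_all add: L_def vec_eq_iff sum.distrib sum_distrib_left algebra_simps)
      have "AE y in K x. \<forall>j\<in>UNIV. sgn (x - y) $ j = fst (ab j) + (\<Sum>i\<in>UNIV. snd (ab j) i * (y - x) $ i)"
        using ab by (intro AE_finite_allI) auto
      then have dir: "AE y in K x. sgn (x - y) = (\<chi> j. fst (ab j)) + L (y - x)"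
        by eventually_elim (simp add: vec_eq_iff L_def)
      show ?thesis
        by (rule extreme_points_if_direction_affine[OF prob_space_K sets_K L inner_centered[OF elim(1)] ne dir])
    qed
  qed
qed

end
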